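(* Let $G$ be a locally compact second countable group. An ergodic nonsingular $G$-space is totally dissipative if and only if it is isomorphic to a compactly fibered coset $G$-space.
   Context: Fix a left Haar measure $\lambda$ on $G$. A Borel $G$-space is a standard Borel space $X$ with a Borel action map $G\times X\to X$, $(g,x)\mapsto g.x$. A nonsingular $G$-space is a Borel $G$-space $X$ with a (nonzero) $\sigma$-finite Borel measure $\mu$ such that $\mu\circ g\sim\mu$ for all $g\in G$, where $(\mu\circ g)(A)=\mu(g.A)$. It is ergodic if every $G$-invariant Borel set is null or conull. Two nonsingular $G$-spaces $(X,\mu)$, $(Y,\nu)$ are isomorphic if there are $G$-invariant conull sets $X_o\subseteq X$, $Y_o\subseteq Y$ and a Borel bijection $\varphi:X_o\to Y_o$ with $\varphi_*\mu\sim\nu$ and, for every $g\in G$, $\varphi(g.x)=g.\varphi(x)$ for $\mu$-a.e. $x\in X_o$. The Radon--Nikodym cocycle is a Borel map $\nabla:G\times X\to\mathbb{R}_{>0}$ satisfying $\nabla_e(x)=1$, $\nabla_{gh}(x)=\nabla_g(h.x)\nabla_h(x)$ for all $g,h,x$, and $\nabla_g=\frac{d\mu\circ g}{d\mu}$ $\mu$-a.e. for each $g$. $L^1_+(X,\mu)$ is the class of everywhere strictly positive functions in $L^1(X,\mu)$, and $S_f^G(x)=\int_G\nabla_g(x)f(g.x)\,d\lambda(g)$. The Hopf decomposition is the essentially unique decomposition $X=\mathcal{C}\sqcup\mathcal{D}$ into $G$-invariant Borel sets such that for every $f\in L^1_+(X,\mu)$, modulo $\mu$, $\mathcal{C}=\{S_f^G=+\infty\}$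 and $\mathcal{D}=\{S_f^G<+\infty\}$. $(X,\mu)$ is totally dissipative if $\mu(\mathcal{C})=0$. A coset $G$-space is a nonsingular $G$-space $(G/K,\kappa)$, where $K$ is a closed subgroup of $G$, $G$ acts by $g.hK=ghK$, and $\kappa$ is the unique (up to measure class) nonzero quasi-invariant $\sigma$-finite Borel measure on $G/K$. It is compactly fibered if $K$ is compact. *)

theory Defs
  imports "HOL-Analysis.Analysis" "HOL-Library.Set_Algebras"
begin

text \<open>
  The distribution's topological groups are additive: class \<open>topological_group_add\<close> extends
  \<open>group_add\<close>, in which addition need not commute. So \<open>g + h\<close> stands for the product \<open>gh\<close>,
  \<open>0\<close> for the identity, \<open>- g\<close> for the inverse of \<open>g\<close>, and \<open>h +o K\<close> for the left coset \<open>hK\<close>.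

  A space with its measure is a single \<open>M :: 'x measure\<close>. Notions that concern only the Borel
  structure use \<open>space M\<close> and \<open>sets M\<close> alone.
\<close>

definition left_haar_measure :: "'g::topological_group_add measure \<Rightarrow> bool" where
  "left_haar_measure haar \<longleftrightarrow>
     sets haar = sets borel \<and>
     emeasure haar UNIV \<noteq> 0 \<and>
     (\<forall>C. compact C \<longrightarrow> emeasure haar C < \<infinity>) \<and>
     (\<forall>g. \<forall>A\<in>sets borel. emeasure haar ((+) g ` A) = emeasure haar A)"
  \<comment> \<open>No regularity clause: it is automatic on a locally compact second countable Hausdorff space.\<close>

definition standard_borel :: "'x measure \<Rightarrow> bool" where
  "standard_borel M \<longleftrightarrow>
     (\<exists>T. completely_metrizable_space T \<and> second_countable T \<and>
          topspace T = space M \<and> sets M = sigma_sets (space M) {U. openin T U})"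

definition borel_G_space ::
  "('g::topological_group_add \<Rightarrow> 'x \<Rightarrow> 'x) \<Rightarrow> 'x measure \<Rightarrow> bool" where
  "borel_G_space act M \<longleftrightarrow>
     standard_borel M \<and>
     (\<lambda>(g, x). act g x) \<in> borel \<Otimes>\<^sub>M M \<rightarrow>\<^sub>M M \<and>
     (\<forall>x\<in>space M. act 0 x = x) \<and>
     (\<forall>g h. \<forall>x\<in>space M. act (g + h) x = act g (act h x))"

definition equivalent_measures :: "'x measure \<Rightarrow> 'x measure \<Rightarrow> bool" where
  "equivalent_measures M N \<longleftrightarrow>
     sets M = sets N \<and> absolutely_continuous M N \<and> absolutely_continuous N M"

text \<open>
  The measure \<open>A \<mapsto> \<mu>(g.A)\<close>: pushing forward along \<open>- g\<close> works because the preimage of \<open>A\<close>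
  under \<open>- g\<close> is \<open>g.A\<close>, as \<open>emeasure_translated\<close> confirms.
\<close>

definition translated :: "('g::uminus \<Rightarrow> 'x \<Rightarrow> 'x) \<Rightarrow> 'x measure \<Rightarrow> 'g \<Rightarrow> 'x measure" where
  "translated act M g = distr M M (act (- g))"

lemma emeasure_translated:
  assumes "borel_G_space act M" "A \<in> sets M"
  shows "emeasure (translated act M g) A = emeasure M (act g ` A)"
proof -
  have meas: "act h \<in> M \<rightarrow>\<^sub>M M" for h
  proof -
    have "(\<lambda>(g, x). act g x) \<in> borel \<Otimes>\<^sub>M M \<rightarrow>\<^sub>M M"
      using assms(1) by (simp add: borel_G_space_def)
    from measurable_compose[OF measurable_Pair1' this, of h] show ?thesis by simp
  qed
  have inverse: "act (- g) (act g x) = x" "act g (act (- g) x) = x" if "x \<in> space M" for x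
    using assms(1) that unfolding borel_G_space_def
    by (metis left_minus, metis right_minus)
  have "act (- g) -` A \<inter> space M = act g ` A"
  proof
    show "act (- g) -` A \<inter> space M \<subseteq> act g ` A"
      using inverse by (force simp: image_iff)
    show "act g ` A \<subseteq> act (- g) -` A \<inter> space M"
      using inverse sets.sets_into_space[OF assms(2)] measurable_space[OF meas] by auto
  qed
  then show ?thesis
    using meas assms(2) by (simp add: translated_def emeasure_distr)
qed

definition nonsingular_G_space ::
  "('g::topological_group_add \<Rightarrow> 'x \<Rightarrow> 'x) \<Rightarrow> 'x measure \<Rightarrow> bool" where
  "nonsingular_G_space act M \<longleftrightarrow>
     borel_G_space act M \<and>
     sigma_finite_measure M \<and>
     emeasure M (space M) \<noteq> 0 \<and>
     (\<forall>g. equivalent_measures (translated act M g) M)"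

definition G_invariant :: "('g \<Rightarrow> 'x \<Rightarrow> 'x) \<Rightarrow> 'x measure \<Rightarrow> 'x set \<Rightarrow> bool" where
  "G_invariant act M A \<longleftrightarrow> A \<subseteq> space M \<and> (\<forall>g. act g ` A = A)"

definition conull :: "'x measure \<Rightarrow> 'x set \<Rightarrow> bool" where
  "conull M A \<longleftrightarrow> A \<in> sets M \<and> space M - A \<in> null_sets M"

definition ergodic_G_space :: "('g \<Rightarrow> 'x \<Rightarrow> 'x) \<Rightarrow> 'x measure \<Rightarrow> bool" where
  "ergodic_G_space act M \<longleftrightarrow>
     (\<forall>A\<in>sets M. G_invariant act M A \<longrightarrow> A \<in> null_sets M \<or> conull M A)"

definition isomorphic_G_spaces ::
  "('g \<Rightarrow> 'x \<Rightarrow> 'x) \<Rightarrow> 'x measure \<Rightarrow> ('g \<Rightarrow> 'y \<Rightarrow> 'y) \<Rightarrow> 'y measure \<Rightarrow> bool" where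
  "isomorphic_G_spaces act M act' N \<longleftrightarrow>
     (\<exists>X\<^sub>0 Y\<^sub>0 \<phi>.
        G_invariant act M X\<^sub>0 \<and> conull M X\<^sub>0 \<and>
        G_invariant act' N Y\<^sub>0 \<and> conull N Y\<^sub>0 \<and>
        \<phi> \<in> restrict_space M X\<^sub>0 \<rightarrow>\<^sub>M restrict_space N Y\<^sub>0 \<and>
        bij_betw \<phi> X\<^sub>0 Y\<^sub>0 \<and>
        equivalent_measures (distr (restrict_space M X\<^sub>0) N \<phi>) N \<and>
        (\<forall>g. AE x in M. x \<in> X\<^sub>0 \<longrightarrow> \<phi> (act g x) = act' g (\<phi> x)))"

definition RN_cocycle ::
  "('g::topological_group_add \<Rightarrow> 'x \<Rightarrow> 'x) \<Rightarrow> 'x measure \<Rightarrow> ('g \<Rightarrow> 'x \<Rightarrow> real) \<Rightarrow> bool" where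
  "RN_cocycle act M nab \<longleftrightarrow>
     (\<lambda>(g, x). nab g x) \<in> borel_measurable (borel \<Otimes>\<^sub>M M) \<and>
     (\<forall>g. \<forall>x\<in>space M. nab g x > 0) \<and>
     (\<forall>x\<in>space M. nab 0 x = 1) \<and>
     (\<forall>g h. \<forall>x\<in>space M. nab (g + h) x = nab g (act h x) * nab h x) \<and>
     (\<forall>g. AE x in M. ennreal (nab g x) = RN_deriv M (translated act M g) x)"

definition L1_plus :: "'x measure \<Rightarrow> ('x \<Rightarrow> real) set" where
  "L1_plus M = {f. integrable M f \<and> (\<forall>x\<in>space M. f x > 0)}"

definition S_fun ::
  "'g measure \<Rightarrow> ('g \<Rightarrow> 'x \<Rightarrow> 'x) \<Rightarrow> ('g \<Rightarrow> 'x \<Rightarrow> real) \<Rightarrow> ('x \<Rightarrow> real) \<Rightarrow> 'x \<Rightarrow> ennreal" where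
  "S_fun haar act nab f x = (\<integral>\<^sup>+ g. ennreal (nab g x * f (act g x)) \<partial>haar)"

definition Hopf_decomposition ::
  "'g measure \<Rightarrow> ('g \<Rightarrow> 'x \<Rightarrow> 'x) \<Rightarrow> 'x measure \<Rightarrow> ('g \<Rightarrow> 'x \<Rightarrow> real)
     \<Rightarrow> 'x set \<Rightarrow> 'x set \<Rightarrow> bool" where
  "Hopf_decomposition haar act M nab C D \<longleftrightarrow>
     C \<in> sets M \<and> D \<in> sets M \<and>
     G_invariant act M C \<and> G_invariant act M D \<and>
     C \<inter> D = {} \<and> C \<union> D = space M \<and>
     (\<forall>f\<in>L1_plus M. AE x in M.
        (x \<in> C \<longleftrightarrow> S_fun haar act nab f x = \<infinity>) \<and> (x \<in> D \<longleftrightarrow> S_fun haar act nab f x < \<infinity>))"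

text \<open>
  The cocycle is determined up to a null set for each group element, so the functions
  \<open>S_fun haar act nab f\<close>, and with them the Hopf decomposition, are determined up to null sets: it does
  not matter which cocycle and which decomposition are taken.
\<close>

definition totally_dissipative ::
  "'g::topological_group_add measure \<Rightarrow> ('g \<Rightarrow> 'x \<Rightarrow> 'x) \<Rightarrow> 'x measure \<Rightarrow> bool" where
  "totally_dissipative haar act M \<longleftrightarrow>
     (\<exists>nab C D. RN_cocycle act M nab \<and> Hopf_decomposition haar act M nab C D \<and> emeasure M C = 0)"

definition closed_subgroup :: "'g::topological_group_add set \<Rightarrow> bool" where
  "closed_subgroup K \<longleftrightarrow>
     closed K \<and> 0 \<in> K \<and> (\<forall>a\<in>K. \<forall>b\<in>K. a + b \<in> K) \<and> (\<forall>a\<in>K. - a \<in> K)"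

definition left_cosets :: "'g::plus set \<Rightarrow> 'g set set" where
  "left_cosets K = range (\<lambda>g. g +o K)"

text \<open>The Borel sets of \<open>G/K\<close> are generated by the open sets of the quotient topology.\<close>

definition coset_borel :: "'g::topological_group_add set \<Rightarrow> 'g set measure" where
  "coset_borel K = sigma (left_cosets K) {U. U \<subseteq> left_cosets K \<and> open {g. g +o K \<in> U}}"

text \<open>The action \<open>g.hK = ghK\<close>, written on subsets of the group.\<close>

definition coset_act :: "'g::plus \<Rightarrow> 'g set \<Rightarrow> 'g set" where
  "coset_act g A = g +o A"

text \<open>
  The measure \<open>\<kappa>\<close> may be any member of the unique invariant measure class of \<open>G/K\<close>, that is,
  any nonzero quasi-invariant \<open>\<sigma>\<close>-finite Borel measure.
\<close>

definition coset_G_space :: "'g::topological_group_add set \<Rightarrow> 'g set measure \<Rightarrow> bool" where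
  "coset_G_space K \<kappa> \<longleftrightarrow>
     closed_subgroup K \<and>
     space \<kappa> = left_cosets K \<and> sets \<kappa> = sets (coset_borel K) \<and>
     nonsingular_G_space coset_act \<kappa>"

definition compactly_fibered :: "'g::topological_group_add set \<Rightarrow> 'g set measure \<Rightarrow> bool" where
  "compactly_fibered K \<kappa> \<longleftrightarrow> coset_G_space K \<kappa> \<and> compact K"

end

theory Submission
  imports Defs
begin

text \<open>
  The theorem says that the only ergodic actions with finite orbital sums are the transitive
  ones with compact stabilizers.

  Suppose first that the action is ergodic and totally dissipative, and fix a strictly positive
  integrable \<open>f\<close> whose orbital sum is finite almost everywhere. For almost every \<open>x\<close> the integrand
  \<open>g \<mapsto> nab g x * f (act g x)\<close> is then the density of a finite measure on the group, equivalent
  to Haar measure. Its image under the orbit map \<open>g \<mapsto> act g x\<close> is a finite measure on the space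
  that is carried by the orbit of \<open>x\<close>. Moving \<open>x\<close> along its orbit translates the density on the
  right, and a right translation changes Haar measure only by a constant
  (\<open>left_haar_right_translate\<close>), so the normalized image measure is an invariant function of \<open>x\<close>.
  Ergodicity makes it almost everywhere constant (\<open>mass_proportional\<close>). Two different orbits cannot
  carry the same nonzero measure, and hence a single orbit is conull (\<open>conull_orbit\<close>).

  The stabilizer of a point of this orbit preserves, by right translations, the finite measure on
  the group found above. A finite measure has a compact set carrying more than half of its mass;
  every translation that preserves the measure makes this set meet its translate, so the stabilizer
  is relatively compact. It is also closed: by Lusin's theorem the orbit map is continuous on a large
  compact set, and a limit of stabilizing elements can be tested there (\<open>stab_compact\<close>). The orbit
  is in bijection with the coset space, and the bijection is Borel because the orbit image of an open
  set can be described by the Haar measure of the set of times at which a point visits a Borel set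
  (\<open>orbit_image_open\<close>).

  Conversely let the space be isomorphic to the space of cosets of a compact subgroup. All nonsingular
  measures on a coset space have the same null sets (\<open>coset_null_iff\<close>). For a generic point \<open>x\<close>, the
  image of Haar measure under the orbit map of \<open>x\<close> is an invariant measure with the null sets of the
  given one (\<open>orbit_null_iff\<close>), and it is \<open>\<sigma>\<close>-finite because the subgroup is compact. If
  \<open>F\<close> is the density of the given measure with respect to it, then \<open>F (act g y) / F y\<close> is a
  Radon--Nikodym cocycle without exceptional sets, and the orbital sum of an integrable \<open>f\<close> at almost
  every point is a finite multiple of the integral of \<open>f\<close>.

  Images of Borel sets under Borel maps need not be Borel. Wherever such images occur, the group is
  exhausted up to a null set by compact sets on which the relevant map is continuous
  (\<open>sigma_compact_conull\<close>).
\<close>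

section \<open>Compact approximation of Borel sets\<close>

lemma emeasure_Diff_finite_UN_small:
  assumes "finite_measure \<rho>" "\<And>n. C n \<in> sets \<rho>" "B = (\<Union>n::nat. C n)" "(e::real) > 0"
  shows "\<exists>m. emeasure \<rho> (B - (\<Union>n\<le>m. C n)) < ennreal e"
proof -
  interpret finite_measure \<rho> by fact
  have meas: "B - (\<Union>n\<le>m. C n) \<in> sets \<rho>" for m
    using assms(2,3) by auto
  have "decseq (\<lambda>m. B - (\<Union>n\<le>m. C n))"
    by (intro antimonoI Diff_mono UN_mono) auto
  then have "(\<lambda>m. emeasure \<rho> (B - (\<Union>n\<le>m. C n))) \<longlonglongrightarrow> emeasure \<rho> (\<Inter>m. B - (\<Union>n\<le>m. C n))"
    using meas by (intro Lim_emeasure_decseq) auto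
  also have "(\<Inter>m. B - (\<Union>n\<le>m. C n)) = {}" using assms(3) by auto
  finally have "(\<lambda>m. emeasure \<rho> (B - (\<Union>n\<le>m. C n))) \<longlonglongrightarrow> 0" by simp
  moreover have "0 < ennreal e" using assms(4) by simp
  ultimately have "\<forall>\<^sub>F m in sequentially. emeasure \<rho> (B - (\<Union>n\<le>m. C n)) < ennreal e"
    by (rule order_tendstoD)
  then show ?thesis by (auto simp: eventually_sequentially)
qed

lemma emeasure_UN_le_geometric:
  assumes "\<And>n. A n \<in> sets \<rho>" "\<And>n::nat. emeasure \<rho> (A n) \<le> ennreal (e * (1/2) ^ Suc n)" "e > 0"
  shows "emeasure \<rho> (\<Union>n. A n) \<le> ennreal e"
proof -
  have "emeasure \<rho> (\<Union>n. A n) \<le> (\<Sum>n. emeasure \<rho> (A n))"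
    using assms(1) by (intro emeasure_subadditive_countably) auto
  also have "\<dots> \<le> (\<Sum>n. ennreal (e * (1/2) ^ Suc n))"
    using assms(2) by (intro suminf_le) auto
  also have "\<dots> = ennreal (e * 1)"
    using assms(3) by (intro suminf_ennreal_eq sums_mult power_half_series) auto
  finally show ?thesis by simp
qed

lemma Hausdorff_space_t2: "Hausdorff_space (euclidean :: 'a::t2_space topology)"
  unfolding Hausdorff_space_def disjnt_def using hausdorff by auto

text \<open>
  Among the members of a countable base, those whose closure is a compact subset of an open set
  already cover it, because compact neighbourhoods are arbitrarily small.
\<close>

lemma open_sigma_compact:
  fixes U :: "'g::{second_countable_topology, t2_space} set"
  assumes lc: "locally_compact_space (euclidean :: 'g topology)" and "open U"
  shows "\<exists>C. (\<forall>n::nat. compact (C n)) \<and> U = (\<Union>n. C n)"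
proof -
  obtain \<B> :: "'g set set" where \<B>: "countable \<B>" "topological_basis \<B>"
    using ex_countable_basis by blast
  define \<C> where "\<C> = insert {} (closure ` {B\<in>\<B>. compact (closure B) \<and> closure B \<subseteq> U})"
  have nb: "neighbourhood_base_of (compactin euclidean) (euclidean :: 'g topology)"
    using lc by (subst locally_compact_space_neighbourhood_base[symmetric]) (auto simp: Hausdorff_space_t2)
  have "x \<in> \<Union>\<C>" if "x \<in> U" for x
  proof -
    obtain V C where VC: "open V" "compact C" "x \<in> V" "V \<subseteq> C" "C \<subseteq> U"
      using nb[unfolded neighbourhood_base_of, rule_format, of U x] \<open>x \<in> U\<close> \<open>open U\<close>
      by (auto simp del: ex_simps)
    obtain B where B: "B \<in> \<B>" "x \<in> B" "B \<subseteq> V"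
      using topological_basisE[OF \<B>(2) VC(1,3)] by metis
    have "closure B \<subseteq> C"
      using B VC by (intro closure_minimal) (auto intro: compact_imp_closed)
    moreover from this have "compact (closure B)"
      using VC(2) compact_Int_closed[OF VC(2) closed_closure, of B] by (simp add: Int_absorb1)
    ultimately show ?thesis
      using B VC closure_subset[of B] unfolding \<C>_def by (intro UnionI[of "closure B"]) auto
  qed
  then have U: "U = \<Union>\<C>" unfolding \<C>_def by auto
  have "countable \<C>" "\<C> \<noteq> {}" using \<B>(1) by (auto simp: \<C>_def)
  then have "range (from_nat_into \<C>) = \<C>" by (rule range_from_nat_into[rotated])
  moreover have "compact C" if "C \<in> \<C>" for C using that by (auto simp: \<C>_def)
  ultimately have "\<forall>n. compact (from_nat_into \<C> n)" "U = (\<Union>n. from_nat_into \<C> n)"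
    using U rangeI by auto
  then show ?thesis by blast
qed

definition compact_inner_regular :: "'g::topological_space measure \<Rightarrow> 'g set \<Rightarrow> bool" where
  "compact_inner_regular \<rho> B \<longleftrightarrow> (\<forall>e>0. \<exists>C\<subseteq>B. compact C \<and> emeasure \<rho> (B - C) \<le> ennreal e)"

lemma compact_inner_regularD:
  assumes "compact_inner_regular \<rho> B" "e > 0"
  obtains C where "C \<subseteq> B" "compact C" "emeasure \<rho> (B - C) \<le> ennreal e"
  using assms unfolding compact_inner_regular_def by blast

lemma sigma_compact_inner_regular:
  fixes \<rho> :: "'g::t2_space measure"
  assumes "finite_measure \<rho>" "sets \<rho> = sets borel" "\<And>n::nat. compact (C n)" "B = (\<Union>n. C n)"
  shows "compact_inner_regular \<rho> B"
  unfolding compact_inner_regular_def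
proof (intro allI impI)
  fix e :: real assume e: "e > 0"
  have "C n \<in> sets \<rho>" for n using assms(2,3) by (simp add: borel_compact)
  from emeasure_Diff_finite_UN_small[OF assms(1) this assms(4) e]
  obtain m where m: "emeasure \<rho> (B - (\<Union>n\<le>m. C n)) < ennreal e" ..
  show "\<exists>C'\<subseteq>B. compact C' \<and> emeasure \<rho> (B - C') \<le> ennreal e"
  proof (intro exI conjI)
    show "(\<Union>n\<le>m. C n) \<subseteq> B" using assms(4) by auto
    show "compact (\<Union>n\<le>m. C n)" using assms(3) by (intro compact_UN) auto
    show "emeasure \<rho> (B - (\<Union>n\<le>m. C n)) \<le> ennreal e" using m by (rule less_imp_le)
  qed
qed

text \<open>
  The sets that are approximable from inside together with their complements form a
  \<open>\<sigma>\<close>-algebra. It contains the open sets, since open and closed sets are both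
  \<open>\<sigma>\<close>-compact here.
\<close>

theorem borel_compact_inner_regular:
  fixes \<rho> :: "'g::{second_countable_topology, t2_space} measure"
  assumes lc: "locally_compact_space (euclidean :: 'g topology)"
    and fin: "finite_measure \<rho>" and sets: "sets \<rho> = sets borel" and B: "B \<in> sets borel"
  shows "compact_inner_regular \<rho> B"
proof -
  interpret finite_measure \<rho> by fact
  have cl: "C \<in> sets \<rho>" if "compact C" for C
    using that sets by (simp add: borel_compact)
  obtain K :: "nat \<Rightarrow> 'g set" where K: "\<And>n. compact (K n)" "UNIV = (\<Union>n. K n)"
    using open_sigma_compact[OF lc open_UNIV] by blast
  have "B \<in> sigma_sets UNIV {S. open S}" using B by (simp add: borel_def)
  then have "B \<in> sets \<rho> \<and> compact_inner_regular \<rho> B \<and> compact_inner_regular \<rho> (- B)"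
  proof induction
    case (Basic U)
    then have U: "open U" by simp
    obtain C :: "nat \<Rightarrow> 'g set" where C: "\<And>n. compact (C n)" "U = (\<Union>n. C n)"
      using open_sigma_compact[OF lc U] by blast
    have "- U = (\<Union>n. K n \<inter> - U)" using K(2) by blast
    moreover have "compact (K n \<inter> - U)" for n
      using K(1) U by (intro compact_Int_closed) auto
    ultimately have "compact_inner_regular \<rho> (- U)"
      by (intro sigma_compact_inner_regular[OF fin sets])
    moreover have "compact_inner_regular \<rho> U"
      using C by (intro sigma_compact_inner_regular[OF fin sets])
    ultimately show ?case using U sets by simp
  next
    case Empty
    have "compact_inner_regular \<rho> UNIV"
      using K by (intro sigma_compact_inner_regular[OF fin sets])
    then show ?case by (auto simp: compact_inner_regular_def)
  next
    case (Compl A)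
    have "UNIV - A \<in> sets \<rho>"
      using sets.compl_sets[of A \<rho>] sets_eq_imp_space_eq[OF sets] Compl.IH by simp
    moreover have "UNIV - A = - A" by blast
    ultimately show ?case using Compl.IH by (metis double_complement)
  next
    case (Union A)
    have IH: "compact_inner_regular \<rho> (A i)" "compact_inner_regular \<rho> (- A i)" "A i \<in> sets \<rho>" for i
      using Union.IH[of i] by auto
    have "compact_inner_regular \<rho> (\<Union>i. A i)" unfolding compact_inner_regular_def
    proof (intro allI impI)
      fix e :: real assume "e > 0"
      then have e2: "e / 2 > 0" by simp
      have "\<exists>C. C \<subseteq> A i \<and> compact C \<and> emeasure \<rho> (A i - C) \<le> ennreal ((e / 2) * (1/2) ^ Suc i)" for i
        using compact_inner_regularD[OF IH(1)[of i], of "(e / 2) * (1/2) ^ Suc i"] e2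
        by (metis zero_less_power half_gt_zero_iff mult_pos_pos zero_less_one)
      then obtain C where C: "\<And>i. C i \<subseteq> A i" "\<And>i. compact (C i)"
        "\<And>i. emeasure \<rho> (A i - C i) \<le> ennreal ((e / 2) * (1/2) ^ Suc i)" by metis
      from emeasure_Diff_finite_UN_small[OF fin cl[OF C(2)] refl e2]
      obtain m where m: "emeasure \<rho> ((\<Union>i. C i) - (\<Union>n\<le>m. C n)) < ennreal (e / 2)" ..
      have "emeasure \<rho> ((\<Union>i. A i) - (\<Union>n\<le>m. C n))
          \<le> emeasure \<rho> ((\<Union>i. A i - C i) \<union> ((\<Union>i. C i) - (\<Union>n\<le>m. C n)))"
        using IH(3) cl C(2) by (intro emeasure_mono) (auto intro!: sets.Un sets.Diff sets.countable_UN sets.finite_UN)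
      also have "\<dots> \<le> emeasure \<rho> (\<Union>i. A i - C i) + emeasure \<rho> ((\<Union>i. C i) - (\<Union>n\<le>m. C n))"
        using IH(3) cl C(2) by (intro emeasure_subadditive) (auto intro!: sets.Diff sets.countable_UN sets.finite_UN)
      also have "\<dots> \<le> ennreal (e / 2) + ennreal (e / 2)"
        using m C IH(3) cl \<open>e > 0\<close> by (intro add_mono emeasure_UN_le_geometric) (auto intro: less_imp_le)
      also have "\<dots> = ennreal e" using \<open>e > 0\<close> by (simp flip: ennreal_plus)
      finally show "\<exists>C'\<subseteq>\<Union> (range A). compact C' \<and> emeasure \<rho> (\<Union> (range A) - C') \<le> ennreal e"
      proof (intro exI conjI)
        show "(\<Union>n\<le>m. C n) \<subseteq> \<Union> (range A)" using C(1) by blast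
        show "compact (\<Union>n\<le>m. C n)" using C(2) by (intro compact_UN) auto
      qed
    qed
    moreover have "compact_inner_regular \<rho> (- (\<Union>i. A i))" unfolding compact_inner_regular_def
    proof (intro allI impI)
      fix e :: real assume e: "e > 0"
      have "\<exists>C. C \<subseteq> - A i \<and> compact C \<and> emeasure \<rho> (- A i - C) \<le> ennreal (e * (1/2) ^ Suc i)" for i
        using compact_inner_regularD[OF IH(2)[of i], of "e * (1/2) ^ Suc i"] e
        by (metis zero_less_power half_gt_zero_iff mult_pos_pos zero_less_one)
      then obtain C where C: "\<And>i. C i \<subseteq> - A i" "\<And>i. compact (C i)"
        "\<And>i. emeasure \<rho> (- A i - C i) \<le> ennreal (e * (1/2) ^ Suc i)" by metis
      have A: "- A i \<in> sets \<rho>" for i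
        using IH(3)[of i] sets by auto
      have "emeasure \<rho> (- (\<Union>i. A i) - (\<Inter>i. C i)) \<le> emeasure \<rho> (\<Union>i. - A i - C i)"
        using A cl C(2) by (intro emeasure_mono) auto
      also have "\<dots> \<le> ennreal e"
        using A cl C e by (intro emeasure_UN_le_geometric) auto
      finally have "emeasure \<rho> (- (\<Union>i. A i) - (\<Inter>i. C i)) \<le> ennreal e" .
      moreover have "compact (\<Inter>i. C i)" 
        using C(2) compact_Int_closed[OF C(2)[of 0], of "\<Inter>i. C i"]
        by (simp add: closed_INT compact_imp_closed Int_absorb1 INT_lower)
      moreover have "(\<Inter>i. C i) \<subseteq> - (\<Union>i. A i)" using C(1) by blast
      ultimately show "\<exists>C\<subseteq>- \<Union> (range A). compact C \<and> emeasure \<rho> (- \<Union> (range A) - C) \<le> ennreal e"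
        by blast
    qed
    moreover have "(\<Union>i. A i) \<in> sets \<rho>" using IH(3) by blast
    ultimately show ?case by blast
  qed
  then show ?thesis by blast
qed

text \<open>
  For each member \<open>U\<close> of a countable base of the target, two compact sets exhaust the preimages of
  \<open>U\<close> and of its complement up to a small error. On the intersection of their unions both preimages
  are relatively closed, hence relatively clopen, so the map is continuous there.
\<close>

theorem Lusin_compact:
  fixes \<rho> :: "'g::{second_countable_topology, t2_space} measure"
    and \<theta> :: "'g \<Rightarrow> 'b::second_countable_topology"
  assumes lc: "locally_compact_space (euclidean :: 'g topology)"
    and fin: "finite_measure \<rho>" and sets: "sets \<rho> = sets borel"
    and \<theta>: "\<theta> \<in> borel_measurable borel" and B: "B \<in> sets borel" and e: "e > 0"
  obtains C where "C \<subseteq> B" "compact C" "continuous_on C \<theta>" "emeasure \<rho> (B - C) \<le> ennreal e"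
proof -
  note reg = borel_compact_inner_regular[OF lc fin sets]
  obtain \<U> :: "'b set set" where \<U>: "countable \<U>" "topological_basis \<U>"
    using ex_countable_basis by blast
  define U where "U = from_nat_into (insert {} \<U>)"
  have U_range: "range U = insert {} \<U>" unfolding U_def
    using \<U>(1) by (intro range_from_nat_into) auto
  have U_open: "open (U n)" for n
    using U_range \<U>(2) by (metis insertE open_empty rangeI topological_basis_open)
  have \<theta>U: "\<theta> -` U n \<in> sets borel" "\<theta> -` (- U n) \<in> sets borel" for n
    using measurable_sets_borel[OF \<theta>] U_open by (auto intro: borel_open borel_closed)
  have "\<exists>P Q. compact P \<and> compact Q \<and> P \<subseteq> \<theta> -` U n \<and> Q \<subseteq> \<theta> -` (- U n) \<and>
      emeasure \<rho> (B - (P \<union> Q)) \<le> ennreal ((e/2) * (1/2) ^ Suc n)" for n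
  proof -
    have "e/2 > 0" using e by simp
    then have e': "(e/2) * (1/2) ^ Suc n > 0" by simp
    define d where "d = (e/2) * (1/2) ^ Suc n / 2"
    have d: "d > 0" using e' unfolding d_def by simp
    obtain P where P: "P \<subseteq> \<theta> -` U n" "compact P" "emeasure \<rho> (\<theta> -` U n - P) \<le> ennreal d"
      using compact_inner_regularD[OF reg[OF \<theta>U(1)] d] .
    obtain Q where Q: "Q \<subseteq> \<theta> -` (- U n)" "compact Q" "emeasure \<rho> (\<theta> -` (- U n) - Q) \<le> ennreal d"
      using compact_inner_regularD[OF reg[OF \<theta>U(2)] d] .
    have PQ: "P \<in> sets borel" "Q \<in> sets borel" using P Q by (auto intro: borel_compact)
    have "emeasure \<rho> (B - (P \<union> Q)) \<le> emeasure \<rho> ((\<theta> -` U n - P) \<union> (\<theta> -` (- U n) - Q))"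
      using \<theta>U PQ B P(1) Q(1) sets by (intro emeasure_mono) auto
    also have "\<dots> \<le> emeasure \<rho> (\<theta> -` U n - P) + emeasure \<rho> (\<theta> -` (- U n) - Q)"
      using \<theta>U PQ sets by (intro emeasure_subadditive) auto
    also have "\<dots> \<le> ennreal d + ennreal d" using P Q by (intro add_mono)
    also have "\<dots> = ennreal ((e/2) * (1/2) ^ Suc n)"
      using d by (simp add: d_def flip: ennreal_plus)
    finally show ?thesis using P Q by blast
  qed
  then obtain P Q where PQ: "\<And>n. compact (P n)" "\<And>n. compact (Q n)" "\<And>n. P n \<subseteq> \<theta> -` U n"
    "\<And>n. Q n \<subseteq> \<theta> -` (- U n)" "\<And>n. emeasure \<rho> (B - (P n \<union> Q n)) \<le> ennreal ((e/2) * (1/2) ^ Suc n)"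
    by metis
  have "e/2 > 0" using e by simp
  then obtain C0 where C0: "C0 \<subseteq> B" "compact C0" "emeasure \<rho> (B - C0) \<le> ennreal (e/2)"
    using compact_inner_regularD[OF reg[OF B]] by blast
  define C where "C = C0 \<inter> (\<Inter>n. P n \<union> Q n)"
  have PQs: "P n \<union> Q n \<in> sets \<rho>" for n
    using PQ(1,2) sets by (auto intro!: sets.Un simp: borel_compact)
  have "closed (\<Inter>n. P n \<union> Q n)"
    using PQ(1,2) by (intro closed_INT ballI compact_imp_closed compact_Un)
  then have "compact C" unfolding C_def using C0(2) by (rule compact_Int_closed[rotated])
  moreover have "emeasure \<rho> (B - C) \<le> ennreal e"
  proof -
    have "B - C = (B - C0) \<union> (\<Union>n. B - (P n \<union> Q n))" unfolding C_def by auto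
    then have "emeasure \<rho> (B - C) \<le> emeasure \<rho> (B - C0) + emeasure \<rho> (\<Union>n. B - (P n \<union> Q n))"
      using B C0 PQs sets by (auto intro!: emeasure_subadditive sets.Diff borel_compact)
    also have "\<dots> \<le> ennreal (e/2) + ennreal (e/2)"
      using C0(3) PQ(5) B PQs sets e by (intro add_mono emeasure_UN_le_geometric) auto
    also have "\<dots> = ennreal e" using \<open>e > 0\<close> by (simp flip: ennreal_plus)
    finally show ?thesis .
  qed
  moreover have "continuous_on C \<theta>"
    unfolding continuous_on_open_invariant
  proof (intro allI impI)
    fix V :: "'b set" assume "open V"
    then obtain \<V> where \<V>: "\<V> \<subseteq> \<U>" "\<Union>\<V> = V"
      using \<U>(2) unfolding topological_basis_def by blast
    define W where "W = (\<Union>n\<in>{n. U n \<in> \<V>}. - Q n)"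
    have "open W" unfolding W_def using PQ(2) by (intro open_UN ballI open_Compl compact_imp_closed)
    moreover have "W \<inter> C = \<theta> -` V \<inter> C"
    proof -
      have "x \<in> W \<longleftrightarrow> \<theta> x \<in> V" if "x \<in> C" for x
      proof -
        have *: "x \<notin> Q n \<longleftrightarrow> \<theta> x \<in> U n" for n
          using that PQ(3,4)[of n] unfolding C_def by blast
        have "\<theta> x \<in> V \<longleftrightarrow> (\<exists>n. U n \<in> \<V> \<and> \<theta> x \<in> U n)"
        proof
          assume "\<theta> x \<in> V"
          then obtain S where "S \<in> \<V>" "\<theta> x \<in> S" using \<V>(2) by blast
          moreover from this obtain n where "S = U n" using \<V>(1) U_range by (metis insertI2 rangeE subsetD)
          ultimately show "\<exists>n. U n \<in> \<V> \<and> \<theta> x \<in> U n" by blast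
        qed (use \<V> in blast)
        then show ?thesis unfolding W_def using * by auto
      qed
      then show ?thesis by blast
    qed
    ultimately show "\<exists>A. open A \<and> A \<inter> C = \<theta> -` V \<inter> C" by blast
  qed
  ultimately show ?thesis using that[of C] C0(1) unfolding C_def by blast
qed

text \<open>
  Lusin's theorem for a \<open>\<sigma>\<close>-finite measure, applied to an equivalent finite one.
  This is the form used to keep images of Borel maps measurable: the images of the sets \<open>C n\<close> are
  compact.
\<close>

theorem sigma_compact_conull:
  fixes \<mu> :: "'g::{second_countable_topology, t2_space} measure"
    and \<theta> :: "'g \<Rightarrow> 'b::second_countable_topology"
  assumes lc: "locally_compact_space (euclidean :: 'g topology)"
    and sf: "sigma_finite_measure \<mu>" and sets: "sets \<mu> = sets borel"
    and \<theta>: "\<theta> \<in> borel_measurable borel" and B: "B \<in> sets borel"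
  obtains C where "\<And>n::nat. compact (C n)" "\<And>n. C n \<subseteq> B" "\<And>n. continuous_on (C n) \<theta>"
    "B - (\<Union>n. C n) \<in> null_sets \<mu>"
proof -
  interpret sigma_finite_measure \<mu> by fact
  have sp: "space \<mu> = UNIV" using sets_eq_imp_space_eq[OF sets] by simp
  obtain h where h [measurable]: "h \<in> borel_measurable \<mu>" and hfin: "integral\<^sup>N \<mu> h \<noteq> \<infinity>"
    and hpos: "\<And>x. 0 < h x"
    using Ex_finite_integrable_function sp by auto
  define \<rho> where "\<rho> = density \<mu> h"
  have fin: "finite_measure \<rho>"
  proof (rule finite_measureI)
    have "emeasure \<rho> (space \<rho>) = integral\<^sup>N \<mu> h"
      unfolding \<rho>_def by (subst emeasure_density) (auto intro!: nn_integral_cong)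
    then show "emeasure \<rho> (space \<rho>) \<noteq> \<infinity>" using hfin by simp
  qed
  have s\<rho>: "sets \<rho> = sets borel" by (simp add: \<rho>_def sets)
  have "\<exists>C. C \<subseteq> B \<and> compact C \<and> continuous_on C \<theta> \<and> emeasure \<rho> (B - C) \<le> ennreal (1 / Suc n)" for n
  proof -
    have "0 < 1 / real (Suc n)" by simp
    then obtain C where "C \<subseteq> B" "compact C" "continuous_on C \<theta>"
      "emeasure \<rho> (B - C) \<le> ennreal (1 / Suc n)"
      by (rule Lusin_compact[OF lc fin s\<rho> \<theta> B])
    then show ?thesis by (intro exI conjI)
  qed
  then obtain C where C: "\<And>n. C n \<subseteq> B" "\<And>n. compact (C n)" "\<And>n. continuous_on (C n) \<theta>"
    "\<And>n. emeasure \<rho> (B - C n) \<le> ennreal (1 / Suc n)" by metis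
  have N: "B - (\<Union>n. C n) \<in> sets \<mu>" 
    using B borel_compact[OF C(2)] sets by auto
  have "emeasure \<rho> (B - (\<Union>n. C n)) \<le> ennreal (1 / Suc n)" for n
  proof -
    have "emeasure \<rho> (B - (\<Union>n. C n)) \<le> emeasure \<rho> (B - C n)"
      using B C(2) s\<rho> by (intro emeasure_mono) (auto simp: borel_compact)
    then show ?thesis using C(4)[of n] by simp
  qed
  moreover have "(\<lambda>n. ennreal (1 / Suc n)) \<longlonglongrightarrow> ennreal 0"
    using LIMSEQ_inverse_real_of_nat by (intro tendsto_ennrealI) (simp add: inverse_eq_divide)
  ultimately have "emeasure \<rho> (B - (\<Union>n. C n)) \<le> 0"
    by (intro LIMSEQ_le_const[of "\<lambda>n. ennreal (1 / Suc n)" 0]) auto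
  then have "AE x in \<mu>. h x * indicator (B - (\<Union>n. C n)) x = 0"
    unfolding \<rho>_def using N by (subst (asm) emeasure_density) (auto simp: nn_integral_0_iff_AE)
  then have "AE x in \<mu>. x \<notin> B - (\<Union>n. C n)"
  proof eventually_elim
    case (elim x)
    then show ?case using hpos[of x] by (auto split: split_indicator_asm)
  qed
  then have "B - (\<Union>n. C n) \<in> null_sets \<mu>" using N by (subst AE_iff_null_sets) auto
  with C that show ?thesis by blast
qed

section \<open>Haar measure and right translations\<close>

lemma measurable_group_uminus [measurable]:
  "(uminus :: 'g \<Rightarrow> 'g::topological_group_add) \<in> borel \<rightarrow>\<^sub>M borel"
  by (intro borel_measurable_continuous_onI continuous_intros)

lemma image_add_eq_vimage: "(+) (g::'g::group_add) ` A = (+) (- g) -` A"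
  by (auto simp: image_iff add.assoc[symmetric] intro!: bexI[of _ "- g + _"])

lemma left_haar_nn_integral:
  fixes haar :: "'g::{topological_group_add, second_countable_topology} measure"
  assumes "left_haar_measure haar" and f [measurable]: "f \<in> borel_measurable borel"
  shows "(\<integral>\<^sup>+ x. f (g + x) \<partial>haar) = (\<integral>\<^sup>+ x. f x \<partial>haar)"
proof -
  have [measurable_cong]: "sets haar = sets borel" using assms by (simp add: left_haar_measure_def)
  have "distr haar haar ((+) g) = haar"
  proof (rule measure_eqI)
    fix A assume "A \<in> sets (distr haar haar ((+) g))"
    then have A: "A \<in> sets borel" using \<open>sets haar = sets borel\<close> by simp
    have "emeasure (distr haar haar ((+) g)) A = emeasure haar ((+) g -` A \<inter> space haar)"
      using A by (intro emeasure_distr) simp_all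
    also have "(+) g -` A \<inter> space haar = (+) (- g) ` A"
      using sets_eq_imp_space_eq[OF \<open>sets haar = sets borel\<close>] by (simp add: image_add_eq_vimage)
    also have "emeasure haar \<dots> = emeasure haar A"
      using assms(1) A by (simp add: left_haar_measure_def)
    finally show "emeasure (distr haar haar ((+) g)) A = emeasure haar A" .
  qed simp
  then have "(\<integral>\<^sup>+ x. f x \<partial>haar) = (\<integral>\<^sup>+ x. f x \<partial>distr haar haar ((+) g))" by simp
  also have "\<dots> = (\<integral>\<^sup>+ x. f (g + x) \<partial>haar)"
    by (intro nn_integral_distr) simp_all
  finally show ?thesis ..
qed

lemma left_haar_sigma_finite:
  fixes haar :: "'g::{topological_group_add, second_countable_topology, t2_space} measure"
  assumes lc: "locally_compact_space (euclidean :: 'g topology)" and "left_haar_measure haar"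
  shows "sigma_finite_measure haar"
proof
  have sets: "sets haar = sets borel" using assms by (simp add: left_haar_measure_def)
  obtain K :: "nat \<Rightarrow> 'g set" where K: "\<And>n. compact (K n)" "UNIV = (\<Union>n. K n)"
    using open_sigma_compact[OF lc open_UNIV] by blast
  show "\<exists>A. countable A \<and> A \<subseteq> sets haar \<and> \<Union>A = space haar \<and> (\<forall>a\<in>A. emeasure haar a \<noteq> \<infinity>)"
    using K assms(2) sets sets_eq_imp_space_eq[OF sets]
    by (intro exI[of _ "range K"]) (auto simp: left_haar_measure_def borel_compact less_top)
qed

text \<open>
  Countably many translates of a nonempty open set cover the group, by the Lindelof property.
\<close>

lemma left_haar_open_pos:
  fixes haar :: "'g::{topological_group_add, second_countable_topology} measure"
  assumes haar: "left_haar_measure haar" and U: "open U" "U \<noteq> {}"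
  shows "emeasure haar U > 0"
proof (rule ccontr)
  assume "\<not> emeasure haar U > 0"
  then have U0: "emeasure haar U = 0" by simp
  have sets: "sets haar = sets borel" using haar by (simp add: left_haar_measure_def)
  obtain u where u: "u \<in> U" using U by blast
  define \<F> where "\<F> = range (\<lambda>g. (+) g ` U)"
  have op: "open ((+) g ` U)" for g
    unfolding image_add_eq_vimage by (intro open_vimage U continuous_intros)
  have cover: "\<Union>\<F> = UNIV"
  proof -
    have "x \<in> (+) (x - u) ` U" for x using u by (auto simp: image_iff intro!: bexI[of _ u])
    then show ?thesis unfolding \<F>_def by blast
  qed
  obtain \<F>' where F': "\<F>' \<subseteq> \<F>" "countable \<F>'" "\<Union>\<F>' = \<Union>\<F>"
    using Lindelof[of \<F>] op unfolding \<F>_def by blast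
  have "A \<in> null_sets haar" if "A \<in> \<F>'" for A
  proof -
    obtain g where "A = (+) g ` U" using \<open>A \<in> \<F>'\<close> F'(1) unfolding \<F>_def by blast
    then show ?thesis
      using haar U0 U op[of g] sets by (auto simp: null_sets_def left_haar_measure_def)
  qed
  then have "\<Union>\<F>' \<in> null_sets haar" 
    using null_sets_UN'[of \<F>' "\<lambda>A. A" haar] F'(2) by simp
  then have "emeasure haar UNIV = 0" using F' cover by auto
  then show False using haar by (simp add: left_haar_measure_def)
qed

lemma compact_right_translate:
  fixes C :: "'g::topological_group_add set"
  assumes "compact C" shows "compact {x. x + h \<in> C}"
proof -
  have "{x. x + h \<in> C} = (\<lambda>x. x - h) ` C"
    by (auto simp: image_iff) (metis add_diff_cancel)
  then show ?thesis using assms by (auto intro!: compact_continuous_image continuous_intros)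
qed

text \<open>
  The map \<open>(x, y) \<mapsto> (- y, x + y)\<close> preserves the product of two left Haar measures, being
  composed of the two shears \<open>(x, y) \<mapsto> (x, x + y)\<close> and \<open>(x, y) \<mapsto> (- y + x, y)\<close>. The lemma is this
  invariance for a product function.
\<close>

lemma left_haar_shear:
  fixes \<alpha> \<nu> :: "'g::{topological_group_add, second_countable_topology, t2_space} measure"
  assumes lc: "locally_compact_space (euclidean :: 'g topology)"
    and \<alpha>: "left_haar_measure \<alpha>" and \<nu>: "left_haar_measure \<nu>"
    and f [measurable]: "f \<in> borel_measurable borel" and g [measurable]: "g \<in> borel_measurable borel"
  shows "(\<integral>\<^sup>+ x. f x \<partial>\<alpha>) * (\<integral>\<^sup>+ y. g y \<partial>\<nu>) = (\<integral>\<^sup>+ y. f (- y) * (\<integral>\<^sup>+ x. g (x + y) \<partial>\<alpha>) \<partial>\<nu>)"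
proof -
  have [measurable_cong]: "sets \<alpha> = sets borel" "sets \<nu> = sets borel"
    using \<alpha> \<nu> by (auto simp: left_haar_measure_def)
  interpret L: sigma_finite_measure \<alpha> using left_haar_sigma_finite[OF lc \<alpha>] .
  interpret N: sigma_finite_measure \<nu> using left_haar_sigma_finite[OF lc \<nu>] .
  interpret pair_sigma_finite \<alpha> \<nu> ..
  have "(\<integral>\<^sup>+ x. f x \<partial>\<alpha>) * (\<integral>\<^sup>+ y. g y \<partial>\<nu>) = (\<integral>\<^sup>+ y. (\<integral>\<^sup>+ x. f x \<partial>\<alpha>) * g y \<partial>\<nu>)"
    by (simp add: nn_integral_cmult)
  also have "\<dots> = (\<integral>\<^sup>+ y. (\<integral>\<^sup>+ x. f x * g y \<partial>\<alpha>) \<partial>\<nu>)"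
    by (simp add: nn_integral_multc)
  also have "\<dots> = (\<integral>\<^sup>+ y. (\<integral>\<^sup>+ x. f (- y + x) * g y \<partial>\<alpha>) \<partial>\<nu>)"
    by (intro nn_integral_cong left_haar_nn_integral[OF \<alpha>, symmetric]) simp
  also have "\<dots> = (\<integral>\<^sup>+ x. (\<integral>\<^sup>+ y. f (- y + x) * g y \<partial>\<nu>) \<partial>\<alpha>)"
    by (intro Fubini') measurable
  also have "\<dots> = (\<integral>\<^sup>+ x. (\<integral>\<^sup>+ y. f (- (x + y) + x) * g (x + y) \<partial>\<nu>) \<partial>\<alpha>)"
    by (intro nn_integral_cong left_haar_nn_integral[OF \<nu>, symmetric]) simp
  also have "\<dots> = (\<integral>\<^sup>+ x. (\<integral>\<^sup>+ y. f (- y) * g (x + y) \<partial>\<nu>) \<partial>\<alpha>)"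
    by (simp add: minus_add add.assoc)
  also have "\<dots> = (\<integral>\<^sup>+ y. (\<integral>\<^sup>+ x. f (- y) * g (x + y) \<partial>\<alpha>) \<partial>\<nu>)"
    by (intro Fubini'[symmetric]) measurable
  also have "\<dots> = (\<integral>\<^sup>+ y. f (- y) * (\<integral>\<^sup>+ x. g (x + y) \<partial>\<alpha>) \<partial>\<nu>)"
    by (intro nn_integral_cong nn_integral_cmult) simp
  finally show ?thesis .
qed

lemma ennreal_divide_mult_cancel: "0 < D \<Longrightarrow> D < \<infinity> \<Longrightarrow> a / D * D = (a :: ennreal)"
  by (subst mult.commute, subst ennreal_times_divide, subst mult.commute)
     (simp add: ennreal_mult_divide_eq less_top[symmetric])

text \<open>
  Choosing \<open>f\<close> in \<open>left_haar_shear\<close> so that the inner integral cancels expresses the integral of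
  \<open>a\<close> as that of \<open>g\<close> times a factor. The factor only depends on the first Haar measure,
  so it is the same for \<open>\<nu>\<close> and for \<open>\<alpha>\<close> itself.
\<close>

lemma left_haar_proportional:
  fixes \<alpha> \<nu> :: "'g::{topological_group_add, second_countable_topology, t2_space} measure"
  assumes lc: "locally_compact_space (euclidean :: 'g topology)"
    and \<alpha>: "left_haar_measure \<alpha>" and \<nu>: "left_haar_measure \<nu>"
    and g [measurable]: "g \<in> borel_measurable borel" and a [measurable]: "a \<in> borel_measurable borel"
    and D: "\<And>y. 0 < (\<integral>\<^sup>+ x. g (x + y) \<partial>\<alpha>)" "\<And>y. (\<integral>\<^sup>+ x. g (x + y) \<partial>\<alpha>) < \<infinity>"
  shows "(\<integral>\<^sup>+ x. g x \<partial>\<alpha>) * (\<integral>\<^sup>+ y. a y \<partial>\<nu>) = (\<integral>\<^sup>+ x. g x \<partial>\<nu>) * (\<integral>\<^sup>+ y. a y \<partial>\<alpha>)"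
proof -
  have [measurable_cong]: "sets \<alpha> = sets borel" "sets \<nu> = sets borel"
    using \<alpha> \<nu> by (auto simp: left_haar_measure_def)
  interpret L: sigma_finite_measure \<alpha> using left_haar_sigma_finite[OF lc \<alpha>] .
  \<comment> \<open>The factor \<open>f (- y)\<close> cancels the integral of \<open>g\<close> translated by \<open>y\<close>.\<close>
  define f where "f x = a (- x) / (\<integral>\<^sup>+ z. g (z + (- x)) \<partial>\<alpha>)" for x
  have f [measurable]: "f \<in> borel_measurable borel"
    unfolding f_def by measurable
  have key: "(\<integral>\<^sup>+ x. f x \<partial>\<alpha>) * (\<integral>\<^sup>+ y. g y \<partial>\<mu>) = (\<integral>\<^sup>+ y. a y \<partial>\<mu>)" if \<mu>: "left_haar_measure \<mu>" for \<mu>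
  proof -
    have "(\<integral>\<^sup>+ x. f x \<partial>\<alpha>) * (\<integral>\<^sup>+ y. g y \<partial>\<mu>) = (\<integral>\<^sup>+ y. f (- y) * (\<integral>\<^sup>+ x. g (x + y) \<partial>\<alpha>) \<partial>\<mu>)"
      by (rule left_haar_shear[OF lc \<alpha> \<mu> f g])
    also have "\<dots> = (\<integral>\<^sup>+ y. a y \<partial>\<mu>)"
    proof (intro nn_integral_cong)
      fix y
      show "f (- y) * (\<integral>\<^sup>+ x. g (x + y) \<partial>\<alpha>) = a y"
        using D[of y] unfolding f_def minus_minus
        by (rule ennreal_divide_mult_cancel)
    qed
    finally show ?thesis .
  qed
  show ?thesis
    unfolding key[OF \<nu>, symmetric] key[OF \<alpha>, symmetric] by (simp add: ac_simps)
qed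

text \<open>
  By \<open>left_haar_proportional\<close> the two measures are proportional on subsets of compact sets. A fixed open set \<open>W\<close>
  is added to the set under consideration to make the inner integrals positive.
\<close>

theorem left_haar_unique:
  fixes \<alpha> \<nu> :: "'g::{topological_group_add, second_countable_topology, t2_space} measure"
  assumes lc: "locally_compact_space (euclidean :: 'g topology)"
    and \<alpha>: "left_haar_measure \<alpha>" and \<nu>: "left_haar_measure \<nu>"
  obtains c where "0 < c" "c < \<infinity>" "\<nu> = scale_measure c \<alpha>"
proof -
  have sets: "sets \<alpha> = sets borel" "sets \<nu> = sets borel"
    using \<alpha> \<nu> by (auto simp: left_haar_measure_def)
  note [measurable_cong] = sets
  have fin: "emeasure \<mu> B < \<infinity>" if "left_haar_measure \<mu>" "B \<subseteq> C" "compact C" for \<mu> and B C :: "'g set"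
  proof -
    have "emeasure \<mu> B \<le> emeasure \<mu> C"
      using that by (intro emeasure_mono) (auto simp: left_haar_measure_def borel_compact)
    then show ?thesis using that(1,3) by (auto simp: left_haar_measure_def intro: le_less_trans)
  qed
  have "\<exists>W C. open W \<and> compact C \<and> (0::'g) \<in> W \<and> W \<subseteq> C"
    using lc unfolding locally_compact_space_def by simp
  then obtain W C0 :: "'g set" where W: "open W" "compact C0" "0 \<in> W" "W \<subseteq> C0" by blast
  have [measurable]: "W \<in> sets borel" using W by simp
  have pos: "emeasure \<alpha> W > 0" "emeasure \<nu> W > 0"
    using left_haar_open_pos[OF \<alpha> W(1)] left_haar_open_pos[OF \<nu> W(1)] W(3) by auto
  have finW: "emeasure \<alpha> W < \<infinity>" "emeasure \<nu> W < \<infinity>"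
    using fin[OF \<alpha> W(4,2)] fin[OF \<nu> W(4,2)] by auto
  have eq: "emeasure \<alpha> B * emeasure \<nu> W = emeasure \<nu> B * emeasure \<alpha> W"
    if B [measurable]: "B \<in> sets borel" and BC: "B \<subseteq> C" "compact C" for B C
  proof -
    define g :: "'g \<Rightarrow> ennreal" where "g x = indicator B x + indicator W x" for x
    have [measurable]: "g \<in> borel_measurable borel" unfolding g_def by measurable
    have int_g: "(\<integral>\<^sup>+ x. g (x + y) \<partial>\<mu>) = emeasure \<mu> {x. x + y \<in> B} + emeasure \<mu> {x. x + y \<in> W}"
      if mu: "left_haar_measure \<mu>" for \<mu> and y :: 'g
    proof -
      have sm [measurable_cong]: "sets \<mu> = sets borel" using mu by (simp add: left_haar_measure_def)
      have spm: "space \<mu> = UNIV" using sets_eq_imp_space_eq[OF sm] by simp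
      have m: "{x. x + y \<in> B} \<in> sets \<mu>" "{x. x + y \<in> W} \<in> sets \<mu>"
        using measurable_sets_borel[of "\<lambda>x. x + y" borel] sm by (auto simp: vimage_def)
      have "(\<integral>\<^sup>+ x. g (x + y) \<partial>\<mu>) = (\<integral>\<^sup>+ x. indicator {x. x + y \<in> B} x + indicator {x. x + y \<in> W} x \<partial>\<mu>)"
        by (intro nn_integral_cong) (simp add: g_def indicator_def)
      also have "\<dots> = emeasure \<mu> {x. x + y \<in> B} + emeasure \<mu> {x. x + y \<in> W}"
        using m by (subst nn_integral_add) auto
      finally show ?thesis .
    qed
    have "(\<integral>\<^sup>+ x. g x \<partial>\<alpha>) * (\<integral>\<^sup>+ y. indicator W y \<partial>\<nu>) = (\<integral>\<^sup>+ x. g x \<partial>\<nu>) * (\<integral>\<^sup>+ y. indicator W y \<partial>\<alpha>)"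
    proof (rule left_haar_proportional[OF lc \<alpha> \<nu>])
      fix y
      have "open {x. x + y \<in> W}" using open_vimage[OF W(1), of "\<lambda>x. x + y"]
        by (simp add: vimage_def continuous_intros)
      moreover have "- y \<in> {x. x + y \<in> W}" using W(3) by simp
      ultimately have "0 < emeasure \<alpha> {x. x + y \<in> W}"
        by (intro left_haar_open_pos[OF \<alpha>]) blast+
      then show "0 < (\<integral>\<^sup>+ x. g (x + y) \<partial>\<alpha>)"
        unfolding int_g[OF \<alpha>] by (simp add: zero_less_iff_neq_zero)
      have "emeasure \<alpha> {x. x + y \<in> B} < \<infinity>" "emeasure \<alpha> {x. x + y \<in> W} < \<infinity>"
        using fin[OF \<alpha> _ compact_right_translate[OF BC(2)], of "{x. x + y \<in> B}" y] BC(1)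
          fin[OF \<alpha> _ compact_right_translate[OF W(2)], of "{x. x + y \<in> W}" y] W(4) by auto
      then show "(\<integral>\<^sup>+ x. g (x + y) \<partial>\<alpha>) < \<infinity>" unfolding int_g[OF \<alpha>] by (simp add: less_top)
    qed simp_all
    then have "(emeasure \<alpha> B + emeasure \<alpha> W) * emeasure \<nu> W = (emeasure \<nu> B + emeasure \<nu> W) * emeasure \<alpha> W"
      using int_g[OF \<alpha>, of 0] int_g[OF \<nu>, of 0] sets by simp
    then have "emeasure \<alpha> W * emeasure \<nu> W + emeasure \<alpha> B * emeasure \<nu> W
        = emeasure \<alpha> W * emeasure \<nu> W + emeasure \<nu> B * emeasure \<alpha> W"
      by (simp only: distrib_right add.commute mult.commute[of "emeasure \<nu> W" "emeasure \<alpha> W"])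
    moreover have "emeasure \<alpha> W * emeasure \<nu> W \<noteq> top"
      using finW by (simp add: ennreal_mult_eq_top_iff less_top[symmetric])
    ultimately show ?thesis unfolding ennreal_add_left_cancel by auto
  qed
  define c where "c = emeasure \<nu> W / emeasure \<alpha> W"
  have "0 < c" "c < \<infinity>" unfolding c_def using pos finW
    by (auto simp: ennreal_divide_eq_top_iff zero_less_iff_neq_zero less_top[symmetric] ennreal_divide_eq_0_iff)
  have eq': "emeasure \<nu> B = c * emeasure \<alpha> B" if "B \<in> sets borel" "B \<subseteq> C" "compact C" for B C
  proof -
    have "c * emeasure \<alpha> B = emeasure \<nu> B * emeasure \<alpha> W / emeasure \<alpha> W"
      unfolding c_def eq[OF that, symmetric]
      by (simp only: ennreal_divide_times ennreal_times_divide mult.commute[of "emeasure \<nu> W"])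
    then show ?thesis using pos finW by (simp add: ennreal_mult_divide_eq less_top[symmetric])
  qed
  obtain K :: "nat \<Rightarrow> 'g set" where K: "\<And>n. compact (K n)" "UNIV = (\<Union>n. K n)"
    using open_sigma_compact[OF lc open_UNIV] by blast
  define E where "E = {B \<in> sets borel. \<exists>C::'g set. compact C \<and> B \<subseteq> C}"
  have KE: "K n \<in> E" for n using K unfolding E_def by (auto simp: borel_compact)
  have "\<nu> = scale_measure c \<alpha>"
  proof (rule measure_eqI_generator_eq[where \<Omega>=UNIV and E=E and A=K])
    show "Int_stable E" unfolding Int_stable_def E_def by (auto intro: le_infI1)
    have "sigma_sets UNIV E = sets borel"
    proof
      show "sigma_sets UNIV E \<subseteq> sets borel"
        using sets.sigma_sets_subset[of E borel] unfolding E_def by auto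
      show "sets borel \<subseteq> sigma_sets UNIV E"
      proof
        fix B :: "'g set" assume B: "B \<in> sets borel"
        have "B \<inter> K n \<in> E" for n using B K unfolding E_def by (auto simp: borel_compact)
        then have "(\<Union>n. B \<inter> K n) \<in> sigma_sets UNIV E"
          by (intro sigma_sets.Union sigma_sets.Basic)
        moreover have "(\<Union>n. B \<inter> K n) = B" using K(2) by blast
        ultimately show "B \<in> sigma_sets UNIV E" by simp
      qed
    qed
    then show "sets \<nu> = sigma_sets UNIV E" "sets (scale_measure c \<alpha>) = sigma_sets UNIV E"
      using sets by auto
    show "emeasure \<nu> X = emeasure (scale_measure c \<alpha>) X" if "X \<in> E" for X
      using that eq' unfolding E_def by auto
    show "emeasure \<nu> (K i) \<noteq> \<infinity>" for i using fin[OF \<nu> _ K(1)] by (metis order_refl less_irrefl)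
  qed (use K KE in auto)
  then show ?thesis using that \<open>0 < c\<close> \<open>c < \<infinity>\<close> by blast
qed

text \<open>
  The image of a left Haar measure under a right translation is again a left Haar measure, since
  left and right translations commute. The constant is a value of the modular function.
\<close>

theorem left_haar_right_translate:
  fixes haar :: "'g::{topological_group_add, second_countable_topology, t2_space} measure"
  assumes lc: "locally_compact_space (euclidean :: 'g topology)" and haar: "left_haar_measure haar"
  obtains c where "0 < c" "c < \<infinity>"
    "\<And>f. f \<in> borel_measurable borel \<Longrightarrow> (\<integral>\<^sup>+ x. f (x + h) \<partial>haar) = c * (\<integral>\<^sup>+ x. f x \<partial>haar)"
proof -
  have sets [measurable_cong]: "sets haar = sets borel" using haar by (simp add: left_haar_measure_def)
  have sp: "space haar = UNIV" using sets_eq_imp_space_eq[OF sets] by simp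
  define \<nu> where "\<nu> = distr haar haar (\<lambda>x. x + h)"
  have em: "emeasure \<nu> A = emeasure haar {x. x + h \<in> A}" if "A \<in> sets borel" for A
    unfolding \<nu>_def using that sets sp by (subst emeasure_distr) (auto simp: vimage_def)
  have "left_haar_measure \<nu>"
    unfolding left_haar_measure_def
  proof (intro conjI allI impI ballI)
    show "sets \<nu> = sets borel" by (simp add: \<nu>_def sets)
    show "emeasure \<nu> UNIV \<noteq> 0" using haar em[of UNIV] by (simp add: left_haar_measure_def)
    show "emeasure \<nu> C < \<infinity>" if "compact C" for C
      using that haar em[of C] compact_right_translate[OF that, of h] by (simp add: left_haar_measure_def borel_compact)
    fix g and A :: "'g set" assume A [measurable]: "A \<in> sets borel"
    have gA: "(+) g ` A \<in> sets borel"
      unfolding image_add_eq_vimage by (intro measurable_sets_borel[OF _ A]) simp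
    have "{x. x + h \<in> (+) g ` A} = (+) g ` {x. x + h \<in> A}"
      unfolding image_add_eq_vimage by (simp add: vimage_def add.assoc)
    moreover have "{x. x + h \<in> A} \<in> sets borel"
      using measurable_sets_borel[of "\<lambda>x. x + h" borel A] by (simp add: vimage_def)
    ultimately show "emeasure \<nu> ((+) g ` A) = emeasure \<nu> A"
      using haar by (simp add: em gA A left_haar_measure_def)
  qed
  from left_haar_unique[OF lc haar this]
  obtain c where c: "0 < c" "c < \<infinity>" "\<nu> = scale_measure c haar" .
  have "(\<integral>\<^sup>+ x. f (x + h) \<partial>haar) = c * (\<integral>\<^sup>+ x. f x \<partial>haar)" if [measurable]: "f \<in> borel_measurable borel" for f
  proof -
    have "(\<integral>\<^sup>+ x. f (x + h) \<partial>haar) = (\<integral>\<^sup>+ x. f x \<partial>\<nu>)"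
      unfolding \<nu>_def by (subst nn_integral_distr) auto
    then show ?thesis using c(3) by (simp add: nn_integral_scale_measure)
  qed
  with c that show ?thesis by blast
qed

lemma left_haar_null_right_translate:
  fixes haar :: "'g::{topological_group_add, second_countable_topology, t2_space} measure"
  assumes lc: "locally_compact_space (euclidean :: 'g topology)" and haar: "left_haar_measure haar"
    and A [measurable]: "A \<in> sets borel"
  shows "{x. x + h \<in> A} \<in> null_sets haar \<longleftrightarrow> A \<in> null_sets haar"
proof -
  have sets [measurable_cong]: "sets haar = sets borel" using haar by (simp add: left_haar_measure_def)
  obtain c where c: "0 < c" "c < \<infinity>"
    "\<And>f. f \<in> borel_measurable borel \<Longrightarrow> (\<integral>\<^sup>+ x. f (x + h) \<partial>haar) = c * (\<integral>\<^sup>+ x. f x \<partial>haar)"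
    using left_haar_right_translate[OF lc haar] by metis
  have m: "{x. x + h \<in> A} \<in> sets borel"
    using measurable_sets_borel[of "\<lambda>x. x + h" borel A] by (simp add: vimage_def)
  have "emeasure haar {x. x + h \<in> A} = (\<integral>\<^sup>+ x. indicator {x. x + h \<in> A} x \<partial>haar)"
    using m sets by (intro nn_integral_indicator[symmetric]) simp
  also have "\<dots> = (\<integral>\<^sup>+ x. indicator A (x + h) \<partial>haar)"
    by (intro nn_integral_cong) (simp split: split_indicator)
  also have "\<dots> = c * emeasure haar A" using c(3)[of "indicator A"] sets by simp
  finally show ?thesis using c(1) m sets by (auto simp: null_sets_def)
qed

section \<open>Standard Borel spaces and metrization\<close>

text \<open>
  The generator consists of the finite intersections of basic open sets. Closure under intersection
  makes it determine finite measures; separation of points makes it yield the injection of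
  \<open>standard_borel_embedding\<close>.
\<close>

lemma standard_borel_generator:
  assumes "standard_borel M"
  obtains A :: "nat \<Rightarrow> 'x set" where
    "sets M = sigma_sets (space M) (range A)" "Int_stable (range A)" "space M \<in> range A"
    "\<And>x y. x \<in> space M \<Longrightarrow> y \<in> space M \<Longrightarrow> (\<And>n. x \<in> A n \<longleftrightarrow> y \<in> A n) \<Longrightarrow> x = y"
proof -
  obtain T where T: "completely_metrizable_space T" "second_countable T" "topspace T = space M"
    and sets: "sets M = sigma_sets (space M) {U. openin T U}"
    using assms unfolding standard_borel_def by blast
  obtain \<B> where \<B>: "countable \<B>" "\<And>V. V \<in> \<B> \<Longrightarrow> openin T V"
    and base: "\<And>U x. openin T U \<Longrightarrow> x \<in> U \<Longrightarrow> \<exists>V\<in>\<B>. x \<in> V \<and> V \<subseteq> U"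
    using T(2) unfolding second_countable_def by metis
  define \<A> where "\<A> = (\<lambda>F. space M \<inter> \<Inter>F) ` {F. F \<subseteq> \<B> \<and> finite F}"
  have sp: "space M \<in> \<A>" unfolding \<A>_def by (intro image_eqI[of _ _ "{}"]) auto
  have "countable \<A>" unfolding \<A>_def
    using countable_Collect_finite_subset[OF \<B>(1)] by (simp add: conj_commute)
  then have range: "range (from_nat_into \<A>) = \<A>" using sp by (intro range_from_nat_into) auto
  have Int: "Int_stable \<A>" unfolding Int_stable_def
  proof (intro ballI)
    fix A B assume "A \<in> \<A>" "B \<in> \<A>"
    then obtain F G where "F \<subseteq> \<B>" "finite F" "A = space M \<inter> \<Inter>F" "G \<subseteq> \<B>" "finite G" "B = space M \<inter> \<Inter>G"
      unfolding \<A>_def by blast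
    then show "A \<inter> B \<in> \<A>" unfolding \<A>_def by (intro image_eqI[of _ _ "F \<union> G"]) auto
  qed
  have B\<A>: "V \<in> \<A>" if "V \<in> \<B>" for V
    using that \<B>(2)[OF that, THEN openin_subset] T(3) unfolding \<A>_def
    by (intro image_eqI[of _ _ "{V}"]) auto
  have "sets M = sigma_sets (space M) \<A>"
  proof
    have "V \<in> sets M" if "V \<in> \<B>" for V using sets \<B>(2)[OF that] by (auto intro: sigma_sets.Basic)
    have "space M \<inter> \<Inter>F \<in> sets M" if "finite F" "F \<subseteq> \<B>" for F
      using that \<open>\<And>V. V \<in> \<B> \<Longrightarrow> V \<in> sets M\<close> by (induction F rule: finite_induct) (auto simp: Int_left_commute)
    then have "\<A> \<subseteq> sets M" unfolding \<A>_def by auto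
    then show "sigma_sets (space M) \<A> \<subseteq> sets M" by (rule sets.sigma_sets_subset)
    show "sets M \<subseteq> sigma_sets (space M) \<A>" unfolding sets
    proof (rule sigma_sets_mono, clarify)
      fix U assume U: "openin T U"
      have "U = \<Union>{V\<in>\<B>. V \<subseteq> U}" using base[OF U] by blast
      moreover have "\<Union>{V\<in>\<B>. V \<subseteq> U} \<in> sigma_sets (space M) \<A>"
        using \<B>(1) B\<A> by (intro sigma_sets_UNION countable_subset[OF _ \<B>(1)]) (auto intro: sigma_sets.Basic)
      ultimately show "U \<in> sigma_sets (space M) \<A>" by simp
    qed
  qed
  moreover have "x = y" if xy: "x \<in> space M" "y \<in> space M" "\<And>n. x \<in> from_nat_into \<A> n \<longleftrightarrow> y \<in> from_nat_into \<A> n" for x y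
  proof (rule ccontr)
    assume "x \<noteq> y"
    moreover have "Hausdorff_space T"
      using T(1) completely_metrizable_imp_metrizable_space metrizable_imp_Hausdorff_space by blast
    ultimately obtain U where U: "openin T U" "x \<in> U" "y \<notin> U"
      using xy T(3) unfolding Hausdorff_space_def disjnt_iff by metis
    then obtain V where V: "V \<in> \<B>" "x \<in> V" "V \<subseteq> U" using base by blast
    then obtain n where "V = from_nat_into \<A> n" using B\<A> range by (metis rangeE)
    then show False using xy(3)[of n] V U by auto
  qed
  ultimately show ?thesis using that[of "from_nat_into \<A>"] range Int sp by simp
qed

lemma standard_borel_embedding:
  assumes "standard_borel M"
  obtains \<iota> :: "'x \<Rightarrow> nat \<Rightarrow> real" where "\<iota> \<in> borel_measurable M" "inj_on \<iota> (space M)"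
proof -
  obtain A :: "nat \<Rightarrow> 'x set" where A: "sets M = sigma_sets (space M) (range A)"
    "\<And>x y. x \<in> space M \<Longrightarrow> y \<in> space M \<Longrightarrow> (\<And>n. x \<in> A n \<longleftrightarrow> y \<in> A n) \<Longrightarrow> x = y"
    using standard_borel_generator[OF assms] by metis
  have [measurable]: "A n \<in> sets M" for n using A(1) by (auto intro: sigma_sets.Basic)
  define \<iota> :: "'x \<Rightarrow> nat \<Rightarrow> real" where "\<iota> x n = indicator (A n) x" for x n
  have "\<iota> \<in> borel_measurable M"
    by (rule measurable_coordinatewise_then_product) (simp add: \<iota>_def)
  moreover have "inj_on \<iota> (space M)"
  proof (rule inj_onI)
    fix x y assume xy: "x \<in> space M" "y \<in> space M" "\<iota> x = \<iota> y"
    have "x \<in> A n \<longleftrightarrow> y \<in> A n" for n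
      using fun_cong[OF xy(3), of n] by (auto simp: \<iota>_def indicator_def split: if_splits)
    then show "x = y" using A(2) xy by blast
  qed
  ultimately show ?thesis using that by blast
qed

text \<open>
  Urysohn functions for the countably many pairs of basic sets \<open>U\<close>, \<open>V\<close> with the closure of \<open>U\<close>
  inside \<open>V\<close> embed the space into a countable power of the real line.
\<close>

theorem Urysohn_metrization:
  assumes reg: "regular_space X" and haus: "Hausdorff_space X" and sc: "second_countable X"
  shows "metrizable_space X"
proof -
  have normal: "normal_space X"
    using regular_Lindelof_imp_normal_space[OF reg second_countable_imp_Lindelof_space[OF sc]] .
  obtain \<B> where \<B>: "countable \<B>" "\<And>V. V \<in> \<B> \<Longrightarrow> openin X V"
    and base: "\<And>U x. openin X U \<Longrightarrow> x \<in> U \<Longrightarrow> \<exists>V\<in>\<B>. x \<in> V \<and> V \<subseteq> U"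
    using sc unfolding second_countable_def by metis
  define P where "P = {(U, V) \<in> \<B> \<times> \<B>. X closure_of U \<subseteq> V}"
  have "countable P" unfolding P_def using \<B>(1) by (intro countable_subset[OF _ countable_SIGMA]) auto
  have "\<exists>f. continuous_map X euclideanreal f \<and> f ` (X closure_of fst p) \<subseteq> {0} \<and> f ` (topspace X - snd p) \<subseteq> {1}"
    if "p \<in> P" for p
  proof -
    have "closedin X (topspace X - snd p)" "disjnt (X closure_of fst p) (topspace X - snd p)"
      using that \<B>(2) unfolding P_def disjnt_def by auto
    then show ?thesis
      using Urysohn_lemma_alt[OF normal closedin_closure_of] by metis
  qed
  then obtain f where "\<And>p. p \<in> P \<Longrightarrow> continuous_map X euclideanreal (f p) \<and>
      f p ` (X closure_of fst p) \<subseteq> {0::real} \<and> f p ` (topspace X - snd p) \<subseteq> {1}" by metis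
  then have f: "\<And>p. p \<in> P \<Longrightarrow> continuous_map X euclideanreal (f p)"
    "\<And>p x. p \<in> P \<Longrightarrow> x \<in> X closure_of fst p \<Longrightarrow> f p x = (0::real)"
    "\<And>p x. p \<in> P \<Longrightarrow> x \<in> topspace X - snd p \<Longrightarrow> f p x = 1" by blast+
  have pair: "\<exists>p\<in>P. x \<in> X closure_of fst p \<and> snd p \<subseteq> W" if W: "openin X W" "x \<in> W" for W x
  proof -
    obtain V where V: "V \<in> \<B>" "x \<in> V" "V \<subseteq> W" using base[OF W] by blast
    have "neighbourhood_base_of (closedin X) X" using reg by (simp add: neighbourhood_base_of_closedin)
    then obtain U C where UC: "openin X U" "closedin X C" "x \<in> U" "U \<subseteq> C" "C \<subseteq> V"
      unfolding neighbourhood_base_of using V \<B>(2) by metis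
    obtain B where B: "B \<in> \<B>" "x \<in> B" "B \<subseteq> U" using base[OF UC(1,3)] by blast
    have "X closure_of B \<subseteq> C" using B UC by (intro closure_of_minimal) auto
    moreover have "x \<in> X closure_of B"
      using B \<B>(2)[OF B(1)] by (meson closure_of_subset openin_subset subsetD)
    ultimately show ?thesis using B V UC by (intro bexI[of _ "(B, V)"]) (auto simp: P_def)
  qed
  define e where "e x = (\<lambda>p\<in>P. f p x)" for x
  define Y where "Y = subtopology (powertop_real P) (e ` topspace X)"
  have cont: "continuous_map X (powertop_real P) e"
    unfolding continuous_map_componentwise
  proof (intro conjI ballI)
    fix p assume p: "p \<in> P"
    then have "(\<lambda>x. e x p) = f p" by (simp add: e_def)
    then show "continuous_map X euclideanreal (\<lambda>x. e x p)" using f(1)[OF p] by simp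
  qed (auto simp: e_def)
  have "homeomorphic_map X Y e"
  proof (rule bijective_open_imp_homeomorphic_map)
    show "continuous_map X Y e" unfolding Y_def
      using cont by (simp add: continuous_map_in_subtopology)
    show topY: "e ` topspace X = topspace Y"
      unfolding Y_def using continuous_map_image_subset_topspace[OF cont] by auto
    show "inj_on e (topspace X)"
    proof (rule inj_onI, rule ccontr)
      fix x y assume xy: "x \<in> topspace X" "y \<in> topspace X" "e x = e y" "x \<noteq> y"
      then obtain W where W: "openin X W" "x \<in> W" "y \<notin> W"
        using haus unfolding Hausdorff_space_def disjnt_iff by metis
      then obtain p where "p \<in> P" "x \<in> X closure_of fst p" "snd p \<subseteq> W" using pair by blast
      then have "f p x = 0" "f p y = 1" using f(2)[of p x] f(3)[of p y] W xy by blast+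
      then show False using fun_cong[OF xy(3), of p] \<open>p \<in> P\<close> by (simp add: e_def)
    qed
    show "open_map X Y e" unfolding open_map_def
    proof (intro allI impI)
      fix W assume W: "openin X W"
      define S where "S p = {y \<in> topspace Y. y p < 1}" for p
      have S: "openin Y (S p)" if "p \<in> P" for p
      proof -
        have "continuous_map Y euclideanreal (\<lambda>y. y p)"
          unfolding Y_def by (intro continuous_map_from_subtopology continuous_map_product_projection that)
        then have "openin Y {y \<in> topspace Y. y p \<in> {..<1}}"
          by (rule openin_continuous_map_preimage) auto
        then show ?thesis by (simp add: S_def)
      qed
      have "e ` W = \<Union>{S p |p. p \<in> P \<and> snd p \<subseteq> W}"
      proof safe
        fix x assume x: "x \<in> W"
        then obtain p where p: "p \<in> P" "x \<in> X closure_of fst p" "snd p \<subseteq> W" using pair[OF W] by blast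
        moreover have "e x \<in> topspace Y" using topY openin_subset[OF W] x by blast
        ultimately have "e x \<in> S p" using f(2) by (simp add: S_def e_def)
        with p show "e x \<in> \<Union>{S p |p. p \<in> P \<and> snd p \<subseteq> W}" by blast
      next
        fix y p assume y: "y \<in> S p" "p \<in> P" "snd p \<subseteq> W"
        then obtain x where x: "x \<in> topspace X" "y = e x" using topY by (auto simp: S_def)
        then have "x \<in> W" using y f(3)[of p x] by (auto simp: S_def e_def)
        then show "y \<in> e ` W" using x by blast
      qed
      then show "openin Y (e ` W)" using S by auto
    qed
  qed
  then have "X homeomorphic_space Y" by (rule homeomorphic_map_imp_homeomorphic_space)
  moreover have "metrizable_space Y" unfolding Y_def
    using \<open>countable P\<close> by (intro metrizable_space_subtopology)
      (auto simp: metrizable_space_product_topology metrizable_space_euclidean intro: countable_subset[of _ P])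
  ultimately show ?thesis using homeomorphic_metrizable_space by blast
qed

section \<open>The topology of a coset space\<close>

definition coset_topology :: "'g::topological_group_add set \<Rightarrow> 'g set topology" where
  "coset_topology K = topology (\<lambda>U. U \<subseteq> left_cosets K \<and> open {g. g +o K \<in> U})"

lemma openin_coset_topology:
  "openin (coset_topology K) U \<longleftrightarrow> U \<subseteq> left_cosets K \<and> open {g. g +o K \<in> U}"
proof -
  have "istopology (\<lambda>U. U \<subseteq> left_cosets K \<and> open {g. g +o K \<in> U})"
    unfolding istopology_def
  proof (intro conjI allI impI)
    fix S T assume *: "S \<subseteq> left_cosets K \<and> open {g. g +o K \<in> S}" "T \<subseteq> left_cosets K \<and> open {g. g +o K \<in> T}"
    have "{g. g +o K \<in> S \<inter> T} = {g. g +o K \<in> S} \<inter> {g. g +o K \<in> T}" by auto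
    then show "open {g. g +o K \<in> S \<inter> T}" using * by (simp add: open_Int)
    show "S \<inter> T \<subseteq> left_cosets K" using * by blast
  next
    fix \<K> assume *: "\<forall>S\<in>\<K>. S \<subseteq> left_cosets K \<and> open {g. g +o K \<in> S}"
    have "{g. g +o K \<in> \<Union>\<K>} = (\<Union>S\<in>\<K>. {g. g +o K \<in> S})" by auto
    then show "open {g. g +o K \<in> \<Union>\<K>}" using * by auto
    show "\<Union>\<K> \<subseteq> left_cosets K" using * by blast
  qed
  then show ?thesis unfolding coset_topology_def by (simp add: topology_inverse')
qed

lemma topspace_coset_topology [simp]: "topspace (coset_topology K) = left_cosets K"
proof -
  have "openin (coset_topology K) (left_cosets K)"
    by (simp add: openin_coset_topology left_cosets_def)
  then show ?thesis
    by (metis openin_coset_topology openin_subset openin_topspace subset_antisym)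
qed

lemma sets_coset_borel:
  "sets (coset_borel K) = sigma_sets (left_cosets K) {U. openin (coset_topology K) U}"
  unfolding coset_borel_def openin_coset_topology by (rule sets_measure_of) auto

lemma space_coset_borel [simp]: "space (coset_borel K) = left_cosets K"
  unfolding coset_borel_def by (rule space_measure_of) auto

lemma mem_coset_iff: "x \<in> g +o K \<longleftrightarrow> - g + x \<in> (K :: 'g::group_add set)"
  unfolding elt_set_plus_def by (auto simp: add.assoc[symmetric] intro!: bexI[of _ "- g + x"])

lemma coset_add: "(g + h) +o K = g +o (h +o (K :: 'g::group_add set))"
  by (auto simp: mem_coset_iff minus_add add.assoc simp del: add_uminus_conv_diff)

lemma coset_eq_iff:
  assumes "closed_subgroup K"
  shows "g +o K = h +o K \<longleftrightarrow> - g + h \<in> K"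
proof
  assume "g +o K = h +o K"
  moreover have "h \<in> h +o K" using assms by (simp add: mem_coset_iff closed_subgroup_def)
  ultimately show "- g + h \<in> K" by (simp add: mem_coset_iff[symmetric])
next
  assume K: "- g + h \<in> K"
  have add: "a + b \<in> K" "- a \<in> K" if "a \<in> K" "b \<in> K" for a b
    using assms that by (auto simp: closed_subgroup_def)
  have "- g + x \<in> K \<longleftrightarrow> - h + x \<in> K" for x
  proof
    assume "- g + x \<in> K"
    then have "- (- g + h) + (- g + x) \<in> K" using add K by blast
    then show "- h + x \<in> K" by (simp add: minus_add add.assoc[symmetric])
  next
    assume "- h + x \<in> K"
    then have "(- g + h) + (- h + x) \<in> K" using add K by blast
    then show "- g + x \<in> K" by (simp add: add.assoc)
  qed
  then show "g +o K = h +o K" by (auto simp: mem_coset_iff)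
qed

lemma quotient_continuous:
  "continuous_map euclidean (coset_topology K) (\<lambda>g. g +o K)"
  unfolding continuous_map_def by (auto simp: openin_coset_topology left_cosets_def)

lemma open_right_saturation:
  fixes W :: "'g::topological_group_add set"
  assumes "open W" shows "open (\<Union>k\<in>K. {g. g + k \<in> W})"
proof (intro open_UN ballI)
  fix k
  have "open ((\<lambda>g. g + k) -` W)" by (intro open_vimage assms continuous_intros)
  then show "open {g. g + k \<in> W}" by (simp add: vimage_def)
qed

lemma quotient_open:
  assumes K: "closed_subgroup K"
  shows "open_map euclidean (coset_topology K) (\<lambda>g. g +o K)"
  unfolding open_map_def
proof (intro allI impI)
  fix W :: "'a set" assume "openin euclidean W"
  then have W: "open W" by simp
  have "{g. g +o K \<in> (\<lambda>g. g +o K) ` W} = (\<Union>k\<in>K. {g. g + k \<in> W})"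
  proof safe
    fix g w assume "w \<in> W" "g +o K = w +o K"
    then show "g \<in> (\<Union>k\<in>K. {g. g + k \<in> W})"
      using coset_eq_iff[OF K, of g w] by (intro UN_I[of "- g + w"]) (auto simp: add.assoc[symmetric])
  next
    fix g k assume "k \<in> K" "g + k \<in> W"
    then show "g +o K \<in> (\<lambda>g. g +o K) ` W"
      using coset_eq_iff[OF K, of g "g + k"] by (intro image_eqI[of _ _ "g + k"]) (auto simp: add.assoc[symmetric])
  qed
  then show "openin (coset_topology K) ((\<lambda>g. g +o K) ` W)"
    using open_right_saturation[OF W, of K] by (auto simp: openin_coset_topology left_cosets_def)
qed

lemma Hausdorff_coset_topology:
  assumes K: "closed_subgroup (K :: 'g::topological_group_add set)"
  shows "Hausdorff_space (coset_topology K)"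
  unfolding Hausdorff_space_def
proof (intro allI impI)
  fix x y assume "x \<in> topspace (coset_topology K) \<and> y \<in> topspace (coset_topology K) \<and> x \<noteq> y"
  then obtain g h where gh: "x = g +o K" "y = h +o K" and "x \<noteq> y"
    by (auto simp: left_cosets_def)
  then have "- g + h \<notin> K" using coset_eq_iff[OF K] by simp
  have "closed K" using K by (simp add: closed_subgroup_def)
  then have "open ((\<lambda>p. - fst p + snd p) -` (- K))"
    by (intro open_vimage continuous_intros) auto
  moreover have "(g, h) \<in> (\<lambda>p. - fst p + snd p) -` (- K)" using \<open>- g + h \<notin> K\<close> by simp
  ultimately obtain V W where "open V" "open W" "(g, h) \<in> V \<times> W"
    "V \<times> W \<subseteq> (\<lambda>p. - fst p + snd p) -` (- K)"
    by (rule open_prod_elim)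
  then have VW: "open V" "open W" "g \<in> V" "h \<in> W"
    "V \<times> W \<subseteq> (\<lambda>p. - fst p + snd p) -` (- K)" by auto
  show "\<exists>U V. openin (coset_topology K) U \<and> openin (coset_topology K) V \<and> x \<in> U \<and> y \<in> V \<and> disjnt U V"
  proof (intro exI conjI)
    show "openin (coset_topology K) ((\<lambda>g. g +o K) ` V)" "openin (coset_topology K) ((\<lambda>g. g +o K) ` W)"
      using quotient_open[OF K] VW by (auto simp: open_map_def)
    show "x \<in> (\<lambda>g. g +o K) ` V" "y \<in> (\<lambda>g. g +o K) ` W" using gh VW by auto
    show "disjnt ((\<lambda>g. g +o K) ` V) ((\<lambda>g. g +o K) ` W)"
      using VW(5) coset_eq_iff[OF K] unfolding disjnt_def by fastforce
  qed
qed

text \<open>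
  The quotient map is continuous and open, so local compactness and a countable base pass to the
  quotient; closedness of \<open>K\<close> makes it Hausdorff. Such a space is metrizable, and a locally
  compact metrizable space is completely metrizable.
\<close>

theorem completely_metrizable_coset_topology:
  fixes K :: "'g::{topological_group_add, second_countable_topology, t2_space} set"
  assumes lc: "locally_compact_space (euclidean :: 'g topology)" and K: "closed_subgroup K"
  shows "completely_metrizable_space (coset_topology K)" "second_countable (coset_topology K)"
proof -
  have surj: "(\<lambda>g. g +o K) ` topspace euclidean = topspace (coset_topology K)"
    by (simp add: left_cosets_def)
  obtain \<B> :: "'g set set" where \<B>: "countable \<B>" "topological_basis \<B>"
    using ex_countable_basis by blast
  have "second_countable (euclidean :: 'g topology)"
    unfolding second_countable_def
  proof (intro exI[of _ \<B>] conjI allI impI ballI)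
    show "openin euclidean V" if "V \<in> \<B>" for V using that \<B>(2) topological_basis_open by auto
    show "\<exists>V\<in>\<B>. x \<in> V \<and> V \<subseteq> U" if "openin euclidean U \<and> x \<in> U" for U x
      using that topological_basisE[OF \<B>(2)] by (metis open_openin)
  qed (rule \<B>(1))
  then show sc: "second_countable (coset_topology K)"
    using second_countable_open_map_image[OF quotient_continuous quotient_open[OF K] surj] by blast
  have lcq: "locally_compact_space (coset_topology K)"
    using locally_compact_space_continuous_open_map_image[OF quotient_continuous quotient_open[OF K] surj lc] .
  have hd: "Hausdorff_space (coset_topology K)" by (rule Hausdorff_coset_topology[OF K])
  have reg: "regular_space (coset_topology K)"
    using locally_compact_Hausdorff_imp_regular_space[OF lcq hd] .
  from Urysohn_metrization[OF reg hd sc] lcq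
  show "completely_metrizable_space (coset_topology K)"
    by (intro locally_compact_imp_completely_metrizable_space)
qed

lemma measurable_quotient:
  "(\<lambda>g. g +o K) \<in> borel \<rightarrow>\<^sub>M coset_borel (K :: 'g::topological_group_add set)"
  unfolding coset_borel_def
proof (rule measurable_measure_of)
  show "(\<lambda>g. g +o K) -` U \<inter> space borel \<in> sets borel"
    if "U \<in> {U. U \<subseteq> left_cosets K \<and> open {g. g +o K \<in> U}}" for U
    using that by (auto simp: vimage_def)
qed (auto simp: left_cosets_def)

section \<open>Borel actions and their orbits\<close>

locale borel_action =
  fixes act :: "'g::{topological_group_add, second_countable_topology, t2_space} \<Rightarrow> 'x \<Rightarrow> 'x"
    and M :: "'x measure"
  assumes borel_G_space: "borel_G_space act M"
begin

lemma act_measurable: "(\<lambda>(g, x). act g x) \<in> borel \<Otimes>\<^sub>M M \<rightarrow>\<^sub>M M"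
  using borel_G_space by (simp add: borel_G_space_def)

lemma measurable_act [measurable (raw)]:
  assumes "a \<in> N \<rightarrow>\<^sub>M borel" "b \<in> N \<rightarrow>\<^sub>M M"
  shows "(\<lambda>z. act (a z) (b z)) \<in> N \<rightarrow>\<^sub>M M"
  using measurable_compose[OF measurable_Pair[OF assms] act_measurable] by simp

lemma act_0 [simp]: "x \<in> space M \<Longrightarrow> act 0 x = x"
  using borel_G_space by (simp add: borel_G_space_def)

lemma act_add: "x \<in> space M \<Longrightarrow> act (g + h) x = act g (act h x)"
  using borel_G_space by (simp add: borel_G_space_def)

lemma act_space [simp]: "x \<in> space M \<Longrightarrow> act g x \<in> space M"
  using measurable_space[OF measurable_act[of "\<lambda>_. g" M "\<lambda>x. x"]] by simp

lemma act_minus [simp]: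
  "x \<in> space M \<Longrightarrow> act (- g) (act g x) = x" "x \<in> space M \<Longrightarrow> act g (act (- g) x) = x"
  by (simp_all flip: act_add)

lemma G_invariantI:
  assumes "A \<subseteq> space M" "\<And>g x. x \<in> A \<Longrightarrow> act g x \<in> A"
  shows "G_invariant act M A"
  unfolding G_invariant_def
proof (intro conjI allI)
  fix g
  have "x \<in> act g ` A" if "x \<in> A" for x
    using assms that by (intro image_eqI[of _ _ "act (- g) x"]) auto
  then show "act g ` A = A" using assms by blast
qed fact

lemma G_invariantD: "G_invariant act M A \<Longrightarrow> x \<in> A \<Longrightarrow> act g x \<in> A"
  unfolding G_invariant_def by blast

definition stab :: "'x \<Rightarrow> 'g set" where
  "stab x = {g. act g x = x}"

lemma same_image_iff:
  assumes "x \<in> space M" shows "act g x = act h x \<longleftrightarrow> - g + h \<in> stab x"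
proof -
  have "act (- g + h) x = act (- g) (act h x)" using assms by (rule act_add)
  moreover have "act (- g) (act h x) = x \<longleftrightarrow> act h x = act g x"
    using assms by (metis act_minus act_space)
  ultimately show ?thesis by (auto simp: stab_def)
qed

text \<open>
  Each rational sublevel set is invariant, hence null or conull. Intersecting the conull ones and the
  complements of the null ones leaves a set on which no sublevel set separates two points; being an
  intersection of invariant sets, it is strictly invariant.
\<close>

lemma ergodic_common_value:
  fixes p :: "nat \<Rightarrow> 'x \<Rightarrow> real"
  assumes erg: "ergodic_G_space act M"
    and X: "conull M X" "G_invariant act M X"
    and p [measurable]: "\<And>n. p n \<in> borel_measurable M"
    and inv: "\<And>n g x. x \<in> X \<Longrightarrow> p n (act g x) = p n x"
  obtains Y where "conull M Y" "G_invariant act M Y" "Y \<subseteq> X"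
    "\<And>n x y. x \<in> Y \<Longrightarrow> y \<in> Y \<Longrightarrow> p n x = p n y"
proof -
  have Xs [measurable]: "X \<in> sets M" and XM: "X \<subseteq> space M"
    using X by (auto simp: conull_def G_invariant_def)
  define E where "E = (\<lambda>(n, q). {x\<in>X. p n x < real_of_rat q})"
  have Es: "E i \<in> sets M" for i
  proof -
    have "E i = {x\<in>space M. p (fst i) x < real_of_rat (snd i)} \<inter> X"
      using XM by (auto simp: E_def split_beta)
    then show ?thesis by simp
  qed
  have Einv: "G_invariant act M (E i)" for i
    using XM inv G_invariantD[OF X(2)] by (intro G_invariantI) (auto simp: E_def split_beta)
  have dich: "E i \<in> null_sets M \<or> conull M (E i)" for i
    using erg Es Einv unfolding ergodic_G_space_def by blast
  define Z where "Z i = (if E i \<in> null_sets M then X - E i else E i)" for i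
  have Zn: "space M - Z i \<in> null_sets M" and Zs: "Z i \<in> sets M" for i
  proof -
    have "space M - (X - E i) \<subseteq> (space M - X) \<union> E i" by blast
    then show "space M - Z i \<in> null_sets M"
      using dich[of i] X(1) Es[of i] Xs unfolding Z_def conull_def
      by (auto intro: null_sets_subset[OF null_sets.Un[of "space M - X" M "E i"]])
    show "Z i \<in> sets M" using Es[of i] Xs by (simp add: Z_def)
  qed
  define Y where "Y = (\<Inter>i. Z i)"
  have ZX: "Z i \<subseteq> X" for i by (auto simp: Z_def E_def split_beta)
  have actZ: "act g x \<in> Z i" if "x \<in> Z i" for g x i
  proof -
    have "x \<in> X" using that ZX by blast
    then have "act g x \<in> X" "act g x \<in> E i \<longleftrightarrow> x \<in> E i"
      using G_invariantD[OF X(2)] inv by (auto simp: E_def split_beta)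
    then show ?thesis using that by (auto simp: Z_def split: if_splits)
  qed
  show ?thesis
  proof (rule that)
    have "Y \<in> sets M" unfolding Y_def using Zs by (intro sets.countable_INT') auto
    moreover have "space M - Y = (\<Union>i. space M - Z i)" unfolding Y_def by blast
    moreover have "(\<Union>i. space M - Z i) \<in> null_sets M" using Zn by (intro null_sets_UN') auto
    ultimately show "conull M Y" by (simp add: conull_def)
    show "Y \<subseteq> X" unfolding Y_def using ZX by blast
    then show "G_invariant act M Y" using XM actZ by (intro G_invariantI) (auto simp: Y_def)
    have less: "p n x < real_of_rat q \<longleftrightarrow> p n y < real_of_rat q" if "x \<in> Y" "y \<in> Y" for x y n q
    proof -
      have "x \<in> Z (n, q)" "y \<in> Z (n, q)" using that by (auto simp: Y_def)
      then show ?thesis by (auto simp: Z_def E_def split: if_splits)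
    qed
    show "p n x = p n y" if "x \<in> Y" "y \<in> Y" for n x y
      using less[OF that] of_rat_dense[of "p n x" "p n y"] of_rat_dense[of "p n y" "p n x"]
      by (metis linorder_neqE_linordered_idom order.asym)
  qed
qed

end

locale haar_action = borel_action act M
  for act :: "'g::{topological_group_add, second_countable_topology, t2_space} \<Rightarrow> 'x \<Rightarrow> 'x"
    and M :: "'x measure" +
  fixes haar :: "'g measure"
  assumes lc: "locally_compact_space (euclidean :: 'g topology)"
    and haar: "left_haar_measure haar"
begin

lemma sets_haar [measurable_cong]: "sets haar = sets borel"
  using haar by (simp add: left_haar_measure_def)

lemma space_haar [simp]: "space haar = UNIV"
  using sets_eq_imp_space_eq[OF sets_haar] by simp

sublocale haar: sigma_finite_measure haar
  using left_haar_sigma_finite[OF lc haar] .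

text \<open>
  The injection \<open>\<iota>\<close> turns the orbit image into a compact set of sequences, so it is measurable as
  a preimage.
\<close>

lemma orbit_image_compact:
  assumes \<iota>: "\<iota> \<in> borel_measurable M" "inj_on \<iota> (space M)" and x: "x \<in> space M"
    and C: "compact C" "continuous_on C (\<lambda>g. \<iota> (act g x) :: nat \<Rightarrow> real)"
  shows "(\<lambda>g. act g x) ` C \<in> sets M"
proof -
  have "compact ((\<lambda>g. \<iota> (act g x)) ` C)" using C by (intro compact_continuous_image)
  then have "\<iota> -` ((\<lambda>g. \<iota> (act g x)) ` C) \<inter> space M \<in> sets M"
    by (intro measurable_sets[OF \<iota>(1)] borel_compact)
  moreover have "\<iota> -` ((\<lambda>g. \<iota> (act g x)) ` C) \<inter> space M = (\<lambda>g. act g x) ` C"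
    using \<iota>(2) x by (auto dest: inj_onD)
  ultimately show ?thesis by simp
qed

lemma orbit_set_approx:
  assumes st: "standard_borel M" and x: "x \<in> space M" and B: "B \<in> sets borel"
  obtains C where "\<And>n::nat. compact (C n)" "\<And>n. C n \<subseteq> B" "\<And>n. (\<lambda>g. act g x) ` C n \<in> sets M"
    "B - (\<Union>n. C n) \<in> null_sets haar"
proof -
  obtain \<iota> :: "'x \<Rightarrow> nat \<Rightarrow> real" where \<iota>: "\<iota> \<in> borel_measurable M" "inj_on \<iota> (space M)"
    using standard_borel_embedding[OF st] by metis
  have "(\<lambda>g. \<iota> (act g x)) \<in> borel_measurable borel"
    using x by (intro measurable_compose[OF _ \<iota>(1)]) measurable
  then obtain C where C: "\<And>n::nat. compact (C n)" "\<And>n. C n \<subseteq> B"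
    "\<And>n. continuous_on (C n) (\<lambda>g. \<iota> (act g x))" "B - (\<Union>n. C n) \<in> null_sets haar"
    using sigma_compact_conull[OF lc haar.sigma_finite_measure_axioms sets_haar _ B] by metis
  show ?thesis
    using C orbit_image_compact[OF \<iota> x] by (intro that[of C]) auto
qed

text \<open>
  The orbit map need not be open and images of Borel sets need not be Borel, so the image of \<open>U\<close> is
  recovered by integration. It suffices to treat small open sets covering \<open>U\<close>, namely
  \<open>N = - V + V + g\<close> for an open neighbourhood \<open>V\<close> of zero. With \<open>B = V + g + stab x\<close>, the sets \<open>N\<close> and
  \<open>- V + B\<close> have the same orbit image.
  Up to a null set, \<open>B\<close> consists of the \<open>b\<close> with \<open>act b x \<in> E\<close> for some Borel set \<open>E\<close>, which is
  a countable union of compact images. As \<open>V\<close> and \<open>B\<close> are open, \<open>act s x\<close> lies in the orbit image of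
  \<open>N\<close> if and only if \<open>act (v + s) x \<in> E\<close> for a set of \<open>v \<in> V\<close> of positive Haar measure, and
  this condition is measurable in the point \<open>act s x\<close>.
\<close>

lemma orbit_image_open:
  assumes st: "standard_borel M" and x: "x \<in> space M"
    and orbit: "range (\<lambda>g. act g x) \<in> sets M"
    and U: "open U" "\<And>g k. g \<in> U \<Longrightarrow> k \<in> stab x \<Longrightarrow> g + k \<in> U"
  shows "(\<lambda>g. act g x) ` U \<in> sets M"
proof -
  have nbhd: "\<exists>N. open N \<and> g \<in> N \<and> N \<subseteq> U \<and> (\<lambda>g. act g x) ` N \<in> sets M" if g: "g \<in> U" for g
  proof -
    have "open ((\<lambda>p. - fst p + snd p + g) -` U)"
      by (intro open_vimage U continuous_intros)
    moreover have "(0, 0) \<in> (\<lambda>p. - fst p + snd p + g) -` U" using g by simp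
    ultimately obtain V1 V2 where "open V1" "open V2" "(0, 0) \<in> V1 \<times> V2"
      "V1 \<times> V2 \<subseteq> (\<lambda>p. - fst p + snd p + g) -` U" by (rule open_prod_elim)
    then have V12: "open (V1 \<inter> V2)" "0 \<in> V1 \<inter> V2" "\<And>v w. v \<in> V1 \<inter> V2 \<Longrightarrow> w \<in> V1 \<inter> V2 \<Longrightarrow> - v + w + g \<in> U"
      by auto
    define V where "V = V1 \<inter> V2"
    note V = V12[folded V_def]
    have [measurable]: "V \<in> sets borel" using V(1) by simp
    \<comment> \<open>\<open>N = - V + V + g\<close>, written as a union of open sets.\<close>
    define N where "N = (\<Union>v\<in>V. {n. v + n - g \<in> V})"
    have N_iff: "n \<in> N \<longleftrightarrow> (\<exists>v\<in>V. \<exists>w\<in>V. n = - v + w + g)" for n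
    proof
      assume "n \<in> N"
      then obtain v where v: "v \<in> V" "v + n - g \<in> V" by (auto simp: N_def)
      have "n = - v + (v + n - g) + g"
        by (simp add: add.assoc diff_conv_add_uminus del: add_uminus_conv_diff)
      then show "\<exists>v\<in>V. \<exists>w\<in>V. n = - v + w + g" using v by blast
    next
      assume "\<exists>v\<in>V. \<exists>w\<in>V. n = - v + w + g"
      then obtain v w where vw: "v \<in> V" "w \<in> V" "n = - v + w + g" by blast
      then have "v + n - g \<in> V"
        by (simp add: add.assoc diff_conv_add_uminus del: add_uminus_conv_diff)
      then show "n \<in> N" unfolding N_def using vw(1) by blast
    qed
    have "open N" unfolding N_def
    proof (intro open_UN ballI)
      fix v show "open {n. v + n - g \<in> V}"
        using open_vimage[OF V(1), of "\<lambda>n. v + n - g"] by (simp add: vimage_def continuous_intros)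
    qed
    moreover have "g \<in> N" unfolding N_iff using V(2) by force
    moreover have "N \<subseteq> U"
    proof
      fix n assume "n \<in> N"
      then obtain v w where "v \<in> V" "w \<in> V" "n = - v + w + g" unfolding N_iff by blast
      then show "n \<in> U" using V(3) by simp
    qed
    moreover have "(\<lambda>g. act g x) ` N \<in> sets M"
    proof -
      \<comment> \<open>\<open>B = V + g + stab x\<close>, written as a union of open sets.\<close>
      define B where "B = (\<Union>k\<in>stab x. {b. b + k - g \<in> V})"
      have "open B" unfolding B_def
      proof (intro open_UN ballI)
        fix k show "open {b. b + k - g \<in> V}"
          using open_vimage[OF V(1), of "\<lambda>b. b + k - g"] by (simp add: vimage_def continuous_intros)
      qed
      then have [measurable]: "B \<in> sets borel" by simp
      have stab_add: "k + l \<in> stab x" if "k \<in> stab x" "l \<in> stab x" for k l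
        using that x by (simp add: stab_def act_add)
      have stab_minus: "- k \<in> stab x" if "k \<in> stab x" for k
        using that x act_minus(1)[OF x, of k] by (simp add: stab_def)
      have Bk: "b + k \<in> B" if "b \<in> B" "k \<in> stab x" for b k
      proof -
        obtain l where l: "l \<in> stab x" "b + l - g \<in> V" using \<open>b \<in> B\<close> by (auto simp: B_def)
        have "b + k + (- k + l) - g \<in> V" using l(2) by (simp add: add.assoc)
        then show ?thesis using stab_add[OF stab_minus[OF that(2)] l(1)] by (auto simp: B_def)
      qed
      obtain C where C: "\<And>n::nat. compact (C n)" "\<And>n. C n \<subseteq> B" "\<And>n. (\<lambda>g. act g x) ` C n \<in> sets M"
        "B - (\<Union>n. C n) \<in> null_sets haar"
        using orbit_set_approx[OF st x \<open>B \<in> sets borel\<close>] by metis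
      define E where "E = (\<Union>n. (\<lambda>g. act g x) ` C n)"
      have [measurable]: "E \<in> sets M" unfolding E_def using C(3) by auto
      have EB: "h \<in> B" if "act h x \<in> E" for h
      proof -
        obtain n c where c: "c \<in> C n" "act c x = act h x"
          using \<open>act h x \<in> E\<close> unfolding E_def by (auto simp: eq_commute)
        then have "- c + h \<in> stab x" using same_image_iff[OF x] by simp
        then have "c + (- c + h) \<in> B" using Bk C(2) c(1) by blast
        then show ?thesis by (simp add: add.assoc[symmetric])
      qed
      have mE [measurable]: "{h. act h x \<in> E} \<in> sets borel"
        using measurable_sets[OF measurable_act[of "\<lambda>h. h" borel "\<lambda>_. x"] \<open>E \<in> sets M\<close>] x
        by (simp add: vimage_def)
      have BE: "B - {h. act h x \<in> E} \<in> null_sets haar"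
      proof (rule null_sets_subset[OF C(4)])
        show "B - {h. act h x \<in> E} \<in> sets haar"
          using sets.Diff[OF \<open>B \<in> sets borel\<close> mE] by (simp only: sets_haar)
      qed (auto simp: E_def)
      define F where "F = {y \<in> space M. 0 < (\<integral>\<^sup>+ v. indicator V v * indicator E (act v y) \<partial>haar)} \<inter> range (\<lambda>g. act g x)"
      have "F \<in> sets M" unfolding F_def using orbit by measurable
      moreover have "F = (\<lambda>g. act g x) ` N"
      proof safe
        fix y assume y: "y \<in> F"
        then obtain s where s: "y = act s x" by (auto simp: F_def)
        have "\<exists>v. v \<in> V \<and> act v y \<in> E"
        proof (rule ccontr)
          assume "\<nexists>v. v \<in> V \<and> act v y \<in> E"
          then have "(\<integral>\<^sup>+ v. indicator V v * indicator E (act v y) \<partial>haar) = (\<integral>\<^sup>+ v. 0 \<partial>haar)"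
            by (intro nn_integral_cong) (auto split: split_indicator)
          then show False using y by (simp add: F_def)
        qed
        then obtain v where v: "v \<in> V" "act v y \<in> E" by blast
        then have "v + s \<in> B" using EB[of "v + s"] s x by (simp add: act_add)
        then obtain k where k: "k \<in> stab x" "v + s + k - g \<in> V" by (auto simp: B_def)
        have "s + k \<in> N" using v(1) k(2) by (auto simp: N_def add.assoc)
        moreover have "act (s + k) x = y" using k(1) s x by (simp add: act_add stab_def)
        ultimately show "y \<in> (\<lambda>g. act g x) ` N" by blast
      next
        fix n assume "n \<in> N"
        then obtain v where v: "v \<in> V" "v + n - g \<in> V" by (auto simp: N_def)
        have "0 \<in> stab x" using x by (simp add: stab_def)
        then have vB: "v + n \<in> B" using v(2) by (auto simp: B_def intro!: bexI[of _ 0])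
        define W where "W = V \<inter> {w. w + n \<in> B}"
        have "open {w. w + n \<in> B}"
          using open_vimage[OF \<open>open B\<close>, of "\<lambda>w. w + n"] by (simp add: vimage_def continuous_intros)
        then have "open W" "v \<in> W" using V(1) v(1) vB by (auto simp: W_def)
        then have Wpos: "emeasure haar W > 0" by (intro left_haar_open_pos[OF haar]) auto
        have Wm: "W \<in> sets borel" using \<open>open W\<close> by simp
        \<comment> \<open>Times \<open>w\<close> at which \<open>w + n\<close> is in \<open>B\<close> although \<open>act (w + n) x\<close> is not in \<open>E\<close>.\<close>
        define R where "R = {w. w + n \<in> B - {h. act h x \<in> E}}"
        have Rn: "R \<in> null_sets haar"
          unfolding R_def using left_haar_null_right_translate[OF lc haar, of "B - {h. act h x \<in> E}" n] BE by simp
        have "emeasure haar W = emeasure haar (W - R)"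
          using Rn Wm by (intro emeasure_Diff_null_set[symmetric]) (auto simp: sets_haar)
        also have "\<dots> = (\<integral>\<^sup>+ w. indicator (W - R) w \<partial>haar)"
          using Wm Rn by (intro nn_integral_indicator[symmetric]) (auto simp: sets_haar)
        also have "\<dots> \<le> (\<integral>\<^sup>+ w. indicator V w * indicator E (act w (act n x)) \<partial>haar)"
          using x by (intro nn_integral_mono) (auto simp: W_def R_def act_add split: split_indicator)
        finally show "act n x \<in> F" using Wpos x by (auto simp: F_def intro: less_le_trans)
      qed
      ultimately show ?thesis by simp
    qed
    ultimately show ?thesis by blast
  qed
  define \<N> where "\<N> = {N. open N \<and> N \<subseteq> U \<and> (\<lambda>g. act g x) ` N \<in> sets M}"
  obtain \<N>' where N': "\<N>' \<subseteq> \<N>" "countable \<N>'" "\<Union>\<N>' = \<Union>\<N>"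
    using Lindelof[of \<N>] unfolding \<N>_def by blast
  have "g \<in> \<Union>\<N>" if "g \<in> U" for g
    using nbhd[OF that] unfolding \<N>_def by auto
  moreover have "\<Union>\<N> \<subseteq> U" unfolding \<N>_def by auto
  ultimately have "U = \<Union>\<N>'" unfolding N'(3) by auto
  then have "(\<lambda>g. act g x) ` U = (\<Union>N\<in>\<N>'. (\<lambda>g. act g x) ` N)" by blast
  also have "\<dots> \<in> sets M" using N'(1,2) by (intro sets.countable_UN') (auto simp: \<N>_def)
  finally show ?thesis .
qed

end

section \<open>Dissipative ergodic actions are essentially transitive\<close>

lemma (in borel_action) nonsingular_null_iff:
  assumes "nonsingular_G_space act M" "A \<in> sets M"
  shows "act g -` A \<inter> space M \<in> null_sets M \<longleftrightarrow> A \<in> null_sets M"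
proof -
  have sets: "act g -` A \<inter> space M \<in> sets M" using assms(2) by measurable
  have "equivalent_measures (translated act M (- g)) M"
    using assms(1) by (simp add: nonsingular_G_space_def)
  then have "null_sets (translated act M (- g)) = null_sets M"
    by (auto simp: equivalent_measures_def absolutely_continuous_def)
  moreover have "A \<in> null_sets (translated act M (- g)) \<longleftrightarrow> act g -` A \<inter> space M \<in> null_sets M"
    unfolding translated_def minus_minus using assms(2) sets
    by (subst null_sets_distr_iff) auto
  ultimately show ?thesis by simp
qed

locale dissipative_action = haar_action act M haar
  for act :: "'g::{topological_group_add, second_countable_topology, t2_space} \<Rightarrow> 'x \<Rightarrow> 'x"
    and M :: "'x measure" and haar :: "'g measure" +
  fixes nab :: "'g \<Rightarrow> 'x \<Rightarrow> real" and f :: "'x \<Rightarrow> real"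
  assumes nonsingular: "nonsingular_G_space act M"
    and cocycle: "RN_cocycle act M nab"
    and f_L1: "f \<in> L1_plus M"
    and S_finite: "AE x in M. S_fun haar act nab f x < \<infinity>"
begin

lemma standard_borel_M: "standard_borel M"
  using borel_G_space by (simp add: borel_G_space_def)

lemma measurable_nab [measurable (raw)]:
  assumes "a \<in> N \<rightarrow>\<^sub>M borel" "b \<in> N \<rightarrow>\<^sub>M M"
  shows "(\<lambda>z. nab (a z) (b z)) \<in> borel_measurable N"
proof -
  have "(\<lambda>(g, x). nab g x) \<in> borel_measurable (borel \<Otimes>\<^sub>M M)"
    using cocycle by (simp add: RN_cocycle_def)
  from measurable_compose[OF measurable_Pair[OF assms] this] show ?thesis by simp
qed

lemma measurable_f [measurable]: "f \<in> borel_measurable M"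
  using f_L1 by (auto simp: L1_plus_def)

lemma f_pos: "x \<in> space M \<Longrightarrow> f x > 0"
  using f_L1 by (auto simp: L1_plus_def)

lemma nab_pos: "x \<in> space M \<Longrightarrow> nab g x > 0"
  using cocycle by (simp add: RN_cocycle_def)

lemma nab_add: "x \<in> space M \<Longrightarrow> nab (g + h) x = nab g (act h x) * nab h x"
  using cocycle by (simp add: RN_cocycle_def)

definition weight :: "'x \<Rightarrow> 'g \<Rightarrow> ennreal" where
  "weight x g = ennreal (nab g x * f (act g x))"

lemma measurable_weight [measurable (raw)]:
  assumes "a \<in> N \<rightarrow>\<^sub>M borel" "b \<in> N \<rightarrow>\<^sub>M M"
  shows "(\<lambda>z. weight (b z) (a z)) \<in> borel_measurable N"
  using assms unfolding weight_def by measurable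

lemma weight_pos: "x \<in> space M \<Longrightarrow> weight x g > 0"
  by (simp add: weight_def nab_pos f_pos)

abbreviation "orbit_total x \<equiv> S_fun haar act nab f x"

text \<open>
  The image of the measure with density \<open>weight x\<close> under the orbit map of \<open>x\<close>, as a function of
  the point for a fixed set.
\<close>

definition mass :: "'x set \<Rightarrow> 'x \<Rightarrow> ennreal" where
  "mass A x = (\<integral>\<^sup>+ g. indicator A (act g x) * weight x g \<partial>haar)"

lemma total_eq: "orbit_total x = (\<integral>\<^sup>+ g. weight x g \<partial>haar)"
  by (simp add: S_fun_def weight_def)

lemma measurable_total [measurable]: "orbit_total \<in> borel_measurable M"
  unfolding total_eq[abs_def] by measurable

lemma measurable_mass [measurable]:
  assumes [measurable]: "A \<in> sets M" shows "mass A \<in> borel_measurable M"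
  unfolding mass_def[abs_def] by measurable

lemma mass_le_total: "mass A x \<le> orbit_total x"
  unfolding mass_def total_eq by (intro nn_integral_mono) (auto split: split_indicator)

lemma total_pos: assumes "x \<in> space M" shows "orbit_total x > 0"
proof (rule ccontr)
  assume "\<not> orbit_total x > 0"
  then have "(\<integral>\<^sup>+ g. weight x g \<partial>haar) = 0" by (simp add: total_eq)
  then have "AE g in haar. weight x g = 0" using assms by (subst (asm) nn_integral_0_iff_AE) auto
  then have "AE g in haar. False"
    by eventually_elim (use weight_pos[OF assms] in \<open>metis less_irrefl\<close>)
  then obtain N where "{g \<in> space haar. \<not> False} \<subseteq> N" "emeasure haar N = 0" by (rule AE_E)
  moreover from this have "N = UNIV" by auto
  ultimately have "emeasure haar UNIV = 0" by simp
  then show False using haar by (simp add: left_haar_measure_def)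
qed

text \<open>
  By the cocycle identity, passing from \<open>x\<close> to \<open>act h x\<close> translates the density by \<open>h\<close> on the
  right and divides it by \<open>nab h x\<close>; the right translation contributes the modular factor.
\<close>

lemma weight_translate:
  assumes x: "x \<in> space M"
  obtains t where "0 < t" "t < \<infinity>"
    "\<And>w. w \<in> borel_measurable borel \<Longrightarrow>
       (\<integral>\<^sup>+ g. w (g + h) * weight (act h x) g \<partial>haar) = t * (\<integral>\<^sup>+ g. w g * weight x g \<partial>haar)"
proof -
  obtain c where c: "0 < c" "c < \<infinity>"
    "\<And>w. w \<in> borel_measurable borel \<Longrightarrow> (\<integral>\<^sup>+ x. w (x + h) \<partial>haar) = c * (\<integral>\<^sup>+ x. w x \<partial>haar)"
    using left_haar_right_translate[OF lc haar] by metis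
  \<comment> \<open>The modular constant \<open>c\<close> and the cocycle value \<open>nab h x\<close> together give the factor \<open>t\<close>.\<close>
  define r where "r = 1 / nab h x"
  have r: "r > 0" using nab_pos[OF x] by (simp add: r_def)
  have weight_eq: "weight (act h x) g = ennreal r * weight x (g + h)" for g
  proof -
    have "nab g (act h x) * f (act g (act h x)) = r * (nab (g + h) x * f (act (g + h) x))"
      using nab_pos[OF x, of h] by (simp add: nab_add[OF x] act_add[OF x] r_def)
    then show ?thesis using r by (simp add: weight_def ennreal_mult')
  qed
  show ?thesis
  proof (rule that)
    show "0 < ennreal r * c" "ennreal r * c < \<infinity>"
      using r c by (auto simp: ennreal_zero_less_mult_iff ennreal_mult_less_top)
    fix w :: "'g \<Rightarrow> ennreal" assume w [measurable]: "w \<in> borel_measurable borel"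
    have [measurable]: "(\<lambda>g. w g * weight x g) \<in> borel_measurable borel" using x by measurable
    have "(\<integral>\<^sup>+ g. w (g + h) * weight (act h x) g \<partial>haar) = (\<integral>\<^sup>+ g. ennreal r * (w (g + h) * weight x (g + h)) \<partial>haar)"
      by (simp add: weight_eq ac_simps)
    also have "\<dots> = ennreal r * (\<integral>\<^sup>+ g. w (g + h) * weight x (g + h) \<partial>haar)"
      using x by (intro nn_integral_cmult) measurable
    also have "\<dots> = ennreal r * (c * (\<integral>\<^sup>+ g. w g * weight x g \<partial>haar))"
      by (subst c(3)) auto
    finally show "(\<integral>\<^sup>+ g. w (g + h) * weight (act h x) g \<partial>haar) = ennreal r * c * (\<integral>\<^sup>+ g. w g * weight x g \<partial>haar)"
      by (simp add: mult.assoc)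
  qed
qed

lemma mass_translate:
  assumes x: "x \<in> space M"
  obtains t where "0 < t" "t < \<infinity>" "orbit_total (act h x) = t * orbit_total x"
    "\<And>A. A \<in> sets M \<Longrightarrow> mass A (act h x) = t * mass A x"
proof -
  obtain t where t: "0 < t" "t < \<infinity>" "\<And>w. w \<in> borel_measurable borel \<Longrightarrow>
       (\<integral>\<^sup>+ g. w (g + h) * weight (act h x) g \<partial>haar) = t * (\<integral>\<^sup>+ g. w g * weight x g \<partial>haar)"
    using weight_translate[OF x, of h] by metis
  show ?thesis
  proof (rule that[OF t(1,2)])
    show "orbit_total (act h x) = t * orbit_total x"
      using t(3)[of "\<lambda>_. 1"] by (simp add: total_eq)
    fix A assume [measurable]: "A \<in> sets M"
    have "(\<lambda>g. indicator A (act g x) :: ennreal) \<in> borel_measurable borel"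
      using x by measurable
    from t(3)[OF this] show "mass A (act h x) = t * mass A x"
      using x by (simp add: mass_def act_add)
  qed
qed

lemma mass_zero_off_orbit:
  assumes "\<And>g. act g x \<notin> A" shows "mass A x = 0"
  using assms by (simp add: mass_def)

text \<open>
  By \<open>mass_translate\<close> the normalized orbital masses are invariant functions. They are compared on a
  countable generator closed under intersection, which determines the measures.
\<close>

lemma mass_proportional:
  assumes erg: "ergodic_G_space act M"
  obtains Y where "conull M Y" "G_invariant act M Y" "Y \<subseteq> {x\<in>space M. orbit_total x < \<infinity>}"
    "\<And>A x y. A \<in> sets M \<Longrightarrow> x \<in> Y \<Longrightarrow> y \<in> Y \<Longrightarrow> mass A x * orbit_total y = mass A y * orbit_total x"
proof -
  obtain G :: "nat \<Rightarrow> 'x set" where G: "sets M = sigma_sets (space M) (range G)"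
    "Int_stable (range G)" "space M \<in> range G"
    using standard_borel_generator[OF standard_borel_M] by metis
  have [measurable]: "G n \<in> sets M" for n using G(1) by (auto intro: sigma_sets.Basic)
  define X where "X = {x\<in>space M. orbit_total x < \<infinity>}"
  define p where "p n x = enn2real (mass (G n) x) / enn2real (orbit_total x)" for n x
  have [measurable]: "X \<in> sets M" unfolding X_def by measurable
  have "space M - X \<in> null_sets M"
    using S_finite \<open>X \<in> sets M\<close> by (subst (asm) AE_iff_null) (auto simp: X_def set_diff_eq conj_commute cong: conj_cong)
  then have Xc: "conull M X" by (simp add: conull_def)
  have Xi: "G_invariant act M X"
  proof (rule G_invariantI)
    fix g x assume "x \<in> X"
    then have x: "x \<in> space M" "orbit_total x < \<infinity>" by (auto simp: X_def)
    obtain t where "0 < t" "t < \<infinity>" "orbit_total (act g x) = t * orbit_total x"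
      using mass_translate[OF x(1), of g] by metis
    then show "act g x \<in> X" using x by (simp add: X_def ennreal_mult_less_top)
  qed (auto simp: X_def)
  have pinv: "p n (act g x) = p n x" if "x \<in> X" for n g x
  proof -
    have x: "x \<in> space M" using that by (simp add: X_def)
    obtain t where t: "0 < t" "t < \<infinity>" "orbit_total (act g x) = t * orbit_total x" "mass (G n) (act g x) = t * mass (G n) x"
      using mass_translate[OF x, of g] \<open>G n \<in> sets M\<close> by metis
    have "enn2real t \<noteq> 0" using t(1,2) by (auto simp: enn2real_eq_0_iff)
    then show ?thesis by (simp add: p_def t enn2real_mult)
  qed
  have pm: "p n \<in> borel_measurable M" for n unfolding p_def by measurable
  show ?thesis
  proof (rule ergodic_common_value[where p = p, OF erg Xc Xi pm pinv])
    fix Y assume Y: "conull M Y" "G_invariant act M Y" "Y \<subseteq> X"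
      "\<And>n x y. x \<in> Y \<Longrightarrow> y \<in> Y \<Longrightarrow> p n x = p n y"
    show ?thesis
    proof (rule that[OF Y(1,2)])
      show "Y \<subseteq> {x\<in>space M. orbit_total x < \<infinity>}" using Y(3) by (simp add: X_def)
      fix A x y assume A: "A \<in> sets M" and xy: "x \<in> Y" "y \<in> Y"
      have x: "x \<in> space M" "orbit_total x < \<infinity>" "orbit_total x > 0" and y: "y \<in> space M" "orbit_total y < \<infinity>" "orbit_total y > 0"
        using Y(3) xy total_pos by (auto simp: X_def)
      \<comment> \<open>Cross-multiplying by the total masses avoids division of extended reals.\<close>
      define N where "N z c = scale_measure c (distr (density haar (weight z)) M (\<lambda>g. act g z))" for z c
      have em: "emeasure (N z c) A = c * mass A z" if z: "z \<in> space M" and A [measurable]: "A \<in> sets M" for z c A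
      proof -
        have "(\<lambda>g. act g z) -` A \<in> sets haar"
          using measurable_sets[OF measurable_act[of "\<lambda>h. h" borel "\<lambda>_. z"] A] z by (simp add: sets_haar)
        moreover have "weight z \<in> borel_measurable haar" "(\<lambda>g. act g z) \<in> density haar (weight z) \<rightarrow>\<^sub>M M"
          using z by measurable
        ultimately show ?thesis unfolding N_def
          by (simp add: emeasure_distr emeasure_density mass_def ac_simps indicator_vimage)
      qed
      have "N x (orbit_total y) = N y (orbit_total x)"
      proof (rule measure_eqI_generator_eq[where E="range G" and \<Omega>="space M" and A="\<lambda>_. space M"])
        show "range G \<subseteq> Pow (space M)" using \<open>\<And>n. G n \<in> sets M\<close> sets.sets_into_space by blast
        show "sets (N x (orbit_total y)) = sigma_sets (space M) (range G)" "sets (N y (orbit_total x)) = sigma_sets (space M) (range G)"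
          by (simp_all add: N_def G(1))
        show "emeasure (N x (orbit_total y)) B = emeasure (N y (orbit_total x)) B" if "B \<in> range G" for B
        proof -
          obtain n where n: "B = G n" using \<open>B \<in> range G\<close> by blast
          have fin: "mass (G n) x < \<infinity>" "mass (G n) y < \<infinity>"
            using mass_le_total x(2) y(2) by (auto intro: le_less_trans)
          have "enn2real (orbit_total x) > 0" "enn2real (orbit_total y) > 0"
            using x y by (auto simp: enn2real_positive_iff)
          then have "enn2real (mass (G n) x) * enn2real (orbit_total y) = enn2real (mass (G n) y) * enn2real (orbit_total x)"
            using Y(4)[OF xy, of n] by (simp add: p_def field_simps)
          then have "enn2real (mass (G n) x * orbit_total y) = enn2real (mass (G n) y * orbit_total x)"
            by (simp add: enn2real_mult)
          moreover have "mass (G n) x * orbit_total y < \<infinity>" "mass (G n) y * orbit_total x < \<infinity>"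
            using fin x y by (auto simp: ennreal_mult_less_top)
          ultimately have "mass (G n) x * orbit_total y = mass (G n) y * orbit_total x"
            by (metis ennreal_enn2real infinity_ennreal_def)
          then show ?thesis using em[OF x(1), of B] em[OF y(1), of B] n by (simp add: mult.commute)
        qed
        have "mass (space M) x \<le> orbit_total x" by (rule mass_le_total)
        then show "emeasure (N x (orbit_total y)) (space M) \<noteq> \<infinity>"
          using x y em[OF x(1), of "space M"] by (auto simp: ennreal_mult_eq_top_iff top_unique)
      qed (use G in auto)
      then have "emeasure (N x (orbit_total y)) A = emeasure (N y (orbit_total x)) A" by simp
      then show "mass A x * orbit_total y = mass A y * orbit_total x"
        using em[OF x(1) A] em[OF y(1) A] by (simp add: mult.commute)
    qed
  qed
qed

text \<open>
  A point \<open>x\<close> of the set given by \<open>mass_proportional\<close> charges a countable union \<open>B\<close> of compact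
  pieces of its own orbit. Every other point \<open>y\<close> of that set charges \<open>B\<close> as well, so the
  orbit of \<open>y\<close> meets the orbit of \<open>x\<close>.
\<close>

lemma conull_orbit:
  assumes erg: "ergodic_G_space act M"
  obtains x where "x \<in> space M" "orbit_total x < \<infinity>" "conull M (range (\<lambda>g. act g x))"
    "G_invariant act M (range (\<lambda>g. act g x))"
proof (rule mass_proportional[OF erg])
  fix Y assume Y: "conull M Y" "G_invariant act M Y" "Y \<subseteq> {x\<in>space M. orbit_total x < \<infinity>}"
    "\<And>A x y. A \<in> sets M \<Longrightarrow> x \<in> Y \<Longrightarrow> y \<in> Y \<Longrightarrow> mass A x * orbit_total y = mass A y * orbit_total x"
  have "Y \<noteq> {}"
  proof
    assume "Y = {}"
    then have "emeasure M (space M) = 0" using Y(1) by (auto simp: conull_def)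
    then show False using nonsingular by (simp add: nonsingular_G_space_def)
  qed
  then obtain x where x: "x \<in> Y" by blast
  then have xM: "x \<in> space M" "orbit_total x < \<infinity>" using Y(3) by auto
  obtain C where C: "\<And>n::nat. (\<lambda>g. act g x) ` C n \<in> sets M" "UNIV - (\<Union>n. C n) \<in> null_sets haar"
    using orbit_set_approx[OF standard_borel_M xM(1) borel_open[OF open_UNIV]] by metis
  define B where "B = (\<Union>n. (\<lambda>g. act g x) ` C n)"
  have B: "B \<in> sets M" unfolding B_def using C(1) by auto
  have "AE g in haar. g \<in> (\<Union>n. C n)"
    using AE_not_in[OF C(2)] by eventually_elim auto
  then have "AE g in haar. indicator B (act g x) * weight x g = weight x g"
  proof eventually_elim
    case (elim g)
    then have "act g x \<in> B" unfolding B_def by blast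
    then show ?case by simp
  qed
  then have "mass B x = orbit_total x" unfolding mass_def total_eq
    by (rule nn_integral_cong_AE)
  have meet: "y \<in> range (\<lambda>g. act g x)" if y: "y \<in> Y" for y
  proof -
    have yM: "y \<in> space M" using Y(3) y by auto
    have "mass B y * orbit_total x = orbit_total x * orbit_total y"
      using Y(4)[OF B y x] \<open>mass B x = orbit_total x\<close> by simp
    then have "mass B y \<noteq> 0" using total_pos[OF xM(1)] total_pos[OF yM] by auto
    then obtain g where "act g y \<in> B" using mass_zero_off_orbit by blast
    then obtain h where "act g y = act h x" by (auto simp: B_def)
    then have "y = act (- g + h) x" using act_minus(1)[OF yM, of g] xM(1) by (simp add: act_add)
    then show ?thesis by blast
  qed
  have "range (\<lambda>g. act g x) = Y"
    using meet G_invariantD[OF Y(2) x] by blast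
  then show ?thesis using that[OF xM] Y(1,2) by simp
qed

text \<open>
  The finite measure \<open>\<rho>\<close> with density \<open>weight x\<close> is invariant under right translation by
  elements of the stabilizer: by \<open>weight_translate\<close> it is multiplied by a constant, which is one
  because the total mass is finite and positive. Let \<open>C\<close> be a compact set that carries two thirds of
  \<open>\<rho>\<close> and on which the orbit map followed by the injection \<open>\<iota>\<close> is continuous. For \<open>k\<close> in the stabilizer \<open>C\<close> meets its
  translate by \<open>k\<close>, so \<open>k\<close> is a difference of elements of \<open>C\<close>. If \<open>k n\<close> are in the stabilizer and converge to
  \<open>l\<close>, then some \<open>g\<close> in \<open>C\<close> has \<open>g + k n\<close> in \<open>C\<close> for infinitely many \<open>n\<close>, since the upper limit of the
  translates also carries two thirds of the mass; continuity on \<open>C\<close> then shows that \<open>l\<close> fixes \<open>x\<close>.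
\<close>

lemma stab_compact:
  assumes x: "x \<in> space M" "orbit_total x < \<infinity>"
  shows "closed_subgroup (stab x)" "compact (stab x)"
proof -
  have "- a \<in> stab x" if "a \<in> stab x" for a
    using that x(1) act_minus(1)[OF x(1), of a] by (simp add: stab_def)
  then have sub: "0 \<in> stab x" "\<And>a b. a \<in> stab x \<Longrightarrow> b \<in> stab x \<Longrightarrow> a + b \<in> stab x"
    "\<And>a. a \<in> stab x \<Longrightarrow> - a \<in> stab x"
    using x(1) by (auto simp: stab_def act_add)
  define \<rho> where "\<rho> = density haar (weight x)"
  have [measurable]: "weight x \<in> borel_measurable borel" using x by measurable
  have s\<rho>: "sets \<rho> = sets borel" by (simp add: \<rho>_def sets_haar)
  have em: "emeasure \<rho> B = (\<integral>\<^sup>+ g. indicator B g * weight x g \<partial>haar)" if "B \<in> sets borel" for B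
    unfolding \<rho>_def using that by (subst emeasure_density) (auto simp: sets_haar mult.commute)
  have orbit_total: "emeasure \<rho> UNIV = orbit_total x" using em[of UNIV] by (simp add: total_eq)
  have fin: "finite_measure \<rho>"
    by (rule finite_measureI) (use orbit_total x sets_eq_imp_space_eq[OF s\<rho>] in auto)
  interpret \<rho>: finite_measure \<rho> by fact
  have inv: "emeasure \<rho> {g. g + k \<in> B} = emeasure \<rho> B" if k: "k \<in> stab x" and B [measurable]: "B \<in> sets borel" for k B
  proof -
    obtain t where t: "\<And>w. w \<in> borel_measurable borel \<Longrightarrow>
       (\<integral>\<^sup>+ g. w (g + k) * weight (act k x) g \<partial>haar) = t * (\<integral>\<^sup>+ g. w g * weight x g \<partial>haar)"
      using weight_translate[OF x(1), of k] by metis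
    have kx: "act k x = x" using k by (simp add: stab_def)
    have "orbit_total x = t * orbit_total x" using t[of "\<lambda>_. 1"] by (simp add: kx total_eq)
    then have "orbit_total x * 1 = orbit_total x * t" by (metis mult.commute mult_1_right)
    then have "t = 1" using total_pos[OF x(1)] x(2) unfolding ennreal_mult_cancel_left by auto
    have m: "{g. g + k \<in> B} \<in> sets borel"
      using measurable_sets_borel[of "\<lambda>g. g + k" borel B] by (simp add: vimage_def)
    have "emeasure \<rho> {g. g + k \<in> B} = (\<integral>\<^sup>+ g. indicator B (g + k) * weight x g \<partial>haar)"
      unfolding em[OF m] by (intro nn_integral_cong) (simp split: split_indicator)
    also have "\<dots> = emeasure \<rho> B" using t[of "indicator B"] \<open>t = 1\<close> by (simp add: kx em)
    finally show ?thesis .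
  qed
  obtain \<iota> :: "'x \<Rightarrow> nat \<Rightarrow> real" where \<iota>: "\<iota> \<in> borel_measurable M" "inj_on \<iota> (space M)"
    using standard_borel_embedding[OF standard_borel_M] by metis
  define \<theta> where "\<theta> g = \<iota> (act g x)" for g
  have \<theta>: "\<theta> \<in> borel_measurable borel"
    unfolding \<theta>_def using x by (intro measurable_compose[OF _ \<iota>(1)]) measurable
  define T where "T = enn2real (orbit_total x)"
  have T: "orbit_total x = ennreal T" "T > 0"
    using x total_pos[OF x(1)] by (auto simp: T_def enn2real_positive_iff)
  have "0 < T / 3" using T by simp
  then obtain C where C: "compact C" "continuous_on C \<theta>" "emeasure \<rho> (UNIV - C) \<le> ennreal (T / 3)"
    using Lusin_compact[OF lc fin s\<rho> \<theta> borel_open[OF open_UNIV]] by metis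
  have [measurable]: "C \<in> sets borel" using C(1) by (rule borel_compact)
  have meet: "C \<inter> L \<noteq> {}" if L: "L \<in> sets borel" "emeasure \<rho> C \<le> emeasure \<rho> L" for L
  proof
    assume "C \<inter> L = {}"
    then have "emeasure \<rho> L \<le> emeasure \<rho> (UNIV - C)"
      using s\<rho> by (intro emeasure_mono) auto
    then have *: "emeasure \<rho> L \<le> ennreal (T / 3)" "emeasure \<rho> C \<le> ennreal (T / 3)"
      using C(3) L(2) by auto
    have "ennreal T = emeasure \<rho> (C \<union> (UNIV - C))" using orbit_total T by simp
    also have "\<dots> \<le> emeasure \<rho> C + emeasure \<rho> (UNIV - C)"
      using s\<rho> by (intro emeasure_subadditive) auto
    also have "\<dots> \<le> ennreal (T / 3) + ennreal (T / 3)" using * C(3) by (intro add_mono)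
    also have "\<dots> = ennreal (T / 3 + T / 3)" using T by (intro ennreal_plus[symmetric]) auto
    finally show False using T by (simp add: ennreal_le_iff)
  qed
  have mC: "{g. g + k \<in> C} \<in> sets borel" for k
    using measurable_sets_borel[of "\<lambda>g. g + k" borel C] by (simp add: vimage_def)
  have sub_C: "stab x \<subseteq> (\<lambda>p. - fst p + snd p) ` (C \<times> C)"
  proof
    fix k assume k: "k \<in> stab x"
    obtain g where "g \<in> C" "g + k \<in> C"
      using meet[OF mC[of k]] inv[OF k, of C] by auto
    then show "k \<in> (\<lambda>p. - fst p + snd p) ` (C \<times> C)"
      by (intro image_eqI[of _ _ "(g, g + k)"]) (auto simp: add.assoc[symmetric])
  qed
  have closed: "closed (stab x)"
    unfolding closed_sequential_limits
  proof (intro allI impI)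
    fix k :: "nat \<Rightarrow> 'g" and l assume "(\<forall>n. k n \<in> stab x) \<and> k \<longlonglongrightarrow> l"
    then have k: "\<And>n. k n \<in> stab x" "k \<longlonglongrightarrow> l" by auto
    define L where "L n = {g. g + k n \<in> C}" for n
    have Lm [measurable]: "L n \<in> sets borel" for n unfolding L_def by (rule mC)
    have LC: "emeasure \<rho> (L n) = emeasure \<rho> C" for n unfolding L_def using inv[OF k(1)] by simp
    define U where "U m = (\<Union>n\<in>{m..}. L n)" for m
    have Um: "U m \<in> sets borel" for m unfolding U_def by auto
    have "(\<lambda>m. emeasure \<rho> (U m)) \<longlonglongrightarrow> emeasure \<rho> (\<Inter>m. U m)"
    proof (rule Lim_emeasure_decseq)
      show "range U \<subseteq> sets \<rho>" using Um s\<rho> by auto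
      show "decseq U" unfolding U_def by (intro antimonoI UN_mono) auto
    qed simp
    moreover have "emeasure \<rho> C \<le> emeasure \<rho> (U m)" for m
      unfolding LC[of m, symmetric] using Um s\<rho> by (intro emeasure_mono) (auto simp: U_def)
    ultimately have "emeasure \<rho> C \<le> emeasure \<rho> (\<Inter>m. U m)"
      by (intro LIMSEQ_le_const[of "\<lambda>m. emeasure \<rho> (U m)"]) auto
    moreover have "(\<Inter>m. U m) \<in> sets borel" using Um by auto
    ultimately obtain g where g: "g \<in> C" "\<And>m. g \<in> U m" using meet by blast
    have ev: "\<exists>n\<ge>m. g + k n \<in> C" for m using g(2)[of m] by (auto simp: U_def L_def)
    have lim: "(\<lambda>n. g + k n) \<longlonglongrightarrow> g + l" using k(2) by (intro tendsto_intros)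
    have freq: "\<exists>\<^sub>F n in sequentially. g + k n \<in> C"
      unfolding frequently_sequentially using ev by blast
    have "g + l \<in> C"
    proof (rule ccontr)
      assume "g + l \<notin> C"
      then have "\<forall>\<^sub>F n in sequentially. g + k n \<in> - C"
        using lim C(1) by (intro topological_tendstoD) (auto intro: compact_imp_closed)
      then show False using freq by (auto simp: frequently_def)
    qed
    have "\<theta> (g + l) = \<theta> g"
    proof (rule ccontr)
      assume "\<theta> (g + l) \<noteq> \<theta> g"
      then obtain A where A: "open A" "A \<inter> C = \<theta> -` (- {\<theta> g}) \<inter> C" "g + l \<in> A"
        using C(2) \<open>g + l \<in> C\<close> unfolding continuous_on_open_invariant
        by (metis (no_types, lifting) ComplI IntD1 IntI closed_singleton open_Compl singletonD vimageI)
      then have evA: "\<forall>\<^sub>F n in sequentially. g + k n \<in> A" using lim by (intro topological_tendstoD)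
      have notA: "g + k n \<notin> A" if "g + k n \<in> C" for n
      proof -
        have "\<theta> (g + k n) = \<theta> g" using k(1)[of n] x by (simp add: \<theta>_def act_add stab_def)
        then show ?thesis using A(2) that by blast
      qed
      from evA have "\<forall>\<^sub>F n in sequentially. g + k n \<notin> C"
        by eventually_elim (use notA in blast)
      then show False using freq by (auto simp: frequently_def)
    qed
    then have "act (g + l) x = act g x" using \<iota>(2) x by (auto simp: \<theta>_def dest: inj_onD)
    then have "- g + (g + l) \<in> stab x" using same_image_iff[OF x(1), of g "g + l"] by simp
    then show "l \<in> stab x" by (simp add: add.assoc[symmetric])
  qed
  show "closed_subgroup (stab x)" using closed sub by (auto simp: closed_subgroup_def)
  have "compact ((\<lambda>p. - fst p + snd p) ` (C \<times> C))"
    using C(1) by (intro compact_continuous_image compact_Times continuous_intros)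
  then show "compact (stab x)"
    using compact_Int_closed[OF _ closed] sub_C by (metis Int_absorb1)
qed

end

section \<open>The orbit as a coset space\<close>

text \<open>
  The action is jointly continuous, and since both topologies have countable bases, the preimage of an
  open set is a countable union of open rectangles.
\<close>

lemma measurable_coset_act:
  fixes K :: "'g::{topological_group_add, second_countable_topology} set"
  assumes K: "closed_subgroup K"
  shows "(\<lambda>(g, A). coset_act g A) \<in> borel \<Otimes>\<^sub>M coset_borel K \<rightarrow>\<^sub>M coset_borel K"
proof -
  have "(\<lambda>(g, A). coset_act g A) \<in> borel \<Otimes>\<^sub>M coset_borel K \<rightarrow>\<^sub>M
      sigma (left_cosets K) {U. U \<subseteq> left_cosets K \<and> open {g. g +o K \<in> U}}"
  proof (rule measurable_measure_of)
    show "(\<lambda>(g, A). coset_act g A) \<in> space (borel \<Otimes>\<^sub>M coset_borel K) \<rightarrow> left_cosets K"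
      by (auto simp: space_pair_measure left_cosets_def coset_act_def coset_add[symmetric])
    fix U :: "'g set set" assume "U \<in> {U. U \<subseteq> left_cosets K \<and> open {g. g +o K \<in> U}}"
    then have U: "open {g. g +o K \<in> U}" by simp
    obtain \<B> :: "'g set set" where \<B>: "countable \<B>" "topological_basis \<B>"
      using ex_countable_basis by blast
    define I where "I = {(V, W) \<in> \<B> \<times> \<B>. \<forall>v\<in>V. \<forall>w\<in>W. (v + w) +o K \<in> U}"
    have "countable I" unfolding I_def using \<B>(1) by (intro countable_subset[OF _ countable_SIGMA]) auto
    define R where "R p = fst p \<times> (\<lambda>g. g +o K) ` snd p" for p :: "'g set \<times> 'g set"
    have R: "R p \<in> sets (borel \<Otimes>\<^sub>M coset_borel K)" if p: "p \<in> I" for p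
    proof -
      have "open (fst p)" "open (snd p)" using p \<B>(2) topological_basis_open by (auto simp: I_def)
      moreover from this have "openin (coset_topology K) ((\<lambda>g. g +o K) ` snd p)"
        using quotient_open[OF K] by (simp add: open_map_def)
      ultimately show ?thesis unfolding R_def
        by (intro pair_measureI) (auto simp: sets_coset_borel intro: sigma_sets.Basic)
    qed
    have "(\<lambda>(g, A). coset_act g A) -` U \<inter> space (borel \<Otimes>\<^sub>M coset_borel K) = (\<Union>p\<in>I. R p)"
    proof (intro set_eqI iffI)
      fix z assume "z \<in> (\<lambda>(g, A). coset_act g A) -` U \<inter> space (borel \<Otimes>\<^sub>M coset_borel K)"
      then obtain g A where z: "z = (g, A)" and gA: "coset_act g A \<in> U" "(g, A) \<in> space (borel \<Otimes>\<^sub>M coset_borel K)"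
        by (cases z) auto
      then obtain h where h: "A = h +o K" by (auto simp: space_pair_measure left_cosets_def)
      have "open ((\<lambda>p. fst p + snd p) -` {g. g +o K \<in> U})"
        by (intro open_vimage U continuous_intros)
      moreover have "(g, h) \<in> (\<lambda>p. fst p + snd p) -` {g. g +o K \<in> U}"
        using gA(1) h by (simp add: coset_act_def coset_add)
      ultimately obtain V W where VW: "open V" "open W" "(g, h) \<in> V \<times> W"
        "V \<times> W \<subseteq> (\<lambda>p. fst p + snd p) -` {g. g +o K \<in> U}"
        by (rule open_prod_elim)
      have "g \<in> V" "h \<in> W" using VW(3) by auto
      obtain V' where V': "V' \<in> \<B>" "g \<in> V'" "V' \<subseteq> V"
        using topological_basisE[OF \<B>(2) VW(1) \<open>g \<in> V\<close>] by metis
      obtain W' where W': "W' \<in> \<B>" "h \<in> W'" "W' \<subseteq> W"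
        using topological_basisE[OF \<B>(2) VW(2) \<open>h \<in> W\<close>] by metis
      have "(v + w) +o K \<in> U" if "v \<in> V'" "w \<in> W'" for v w
      proof -
        have "(v, w) \<in> V \<times> W" using that V'(3) W'(3) by blast
        then show ?thesis using VW(4) by auto
      qed
      then have "(V', W') \<in> I" using V'(1) W'(1) by (simp add: I_def)
      moreover have "(g, A) \<in> R (V', W')" using V' W' h by (auto simp: R_def)
      ultimately show "z \<in> (\<Union>p\<in>I. R p)" unfolding z by blast
    next
      fix z assume "z \<in> (\<Union>p\<in>I. R p)"
      then obtain V W where "(V, W) \<in> I" "z \<in> R (V, W)" by auto
      moreover obtain g A where z: "z = (g, A)" by (cases z)
      ultimately have VW: "(V, W) \<in> I" "(g, A) \<in> R (V, W)" by auto
      then obtain h where h: "h \<in> W" "A = h +o K" by (auto simp: R_def)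
      have g: "g \<in> V" using VW(2) by (simp add: R_def)
      have "coset_act g A \<in> U" using VW(1) g h by (auto simp: I_def coset_act_def coset_add[symmetric])
      then show "z \<in> (\<lambda>(g, A). coset_act g A) -` U \<inter> space (borel \<Otimes>\<^sub>M coset_borel K)"
        using h z by (auto simp: space_pair_measure left_cosets_def)
    qed
    moreover have "(\<Union>p\<in>I. R p) \<in> sets (borel \<Otimes>\<^sub>M coset_borel K)"
      using R \<open>countable I\<close> by (intro sets.countable_UN') auto
    ultimately show "(\<lambda>(g, A). coset_act g A) -` U \<inter> space (borel \<Otimes>\<^sub>M coset_borel K)
        \<in> sets (borel \<Otimes>\<^sub>M coset_borel K)" by simp
  qed auto
  then show ?thesis by (simp add: coset_borel_def)
qed

lemma borel_G_space_coset:
  fixes K :: "'g::{topological_group_add, second_countable_topology, t2_space} set"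
  assumes lc: "locally_compact_space (euclidean :: 'g topology)" and K: "closed_subgroup K"
    and \<kappa>: "sets \<kappa> = sets (coset_borel K)"
  shows "borel_G_space coset_act \<kappa>"
proof -
  have sp: "space \<kappa> = left_cosets K" using sets_eq_imp_space_eq[OF \<kappa>] by simp
  have "standard_borel \<kappa>"
    unfolding standard_borel_def
    using completely_metrizable_coset_topology[OF lc K] sp
    by (intro exI[of _ "coset_topology K"]) (simp add: \<kappa> sets_coset_borel)
  moreover have "(\<lambda>(g, A). coset_act g A) \<in> borel \<Otimes>\<^sub>M \<kappa> \<rightarrow>\<^sub>M \<kappa>"
    using measurable_coset_act[OF K]
    by (subst measurable_cong_sets[OF sets_pair_measure_cong[OF refl \<kappa>] \<kappa>])
  moreover have "coset_act 0 x = x" for x :: "'g set"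
    by (auto simp: coset_act_def mem_coset_iff)
  moreover have "coset_act (g + h) x = coset_act g (coset_act h x)" for g h and x :: "'g set"
    by (simp add: coset_act_def coset_add)
  ultimately show ?thesis by (simp add: borel_G_space_def)
qed

context borel_action
begin

text \<open>
  For \<open>y\<close> in the orbit of \<open>x\<close> this set is a left coset of the stabilizer of \<open>x\<close>. It is the
  inverse of the orbit map.
\<close>

definition transporter :: "'x \<Rightarrow> 'x \<Rightarrow> 'g set" where
  "transporter x y = {g. act g x = y}"

lemma transporter_act:
  assumes "x \<in> space M" shows "transporter x (act h x) = h +o stab x"
proof (rule set_eqI)
  fix g
  have "g \<in> transporter x (act h x) \<longleftrightarrow> act h x = act g x" unfolding transporter_def by auto
  then show "g \<in> transporter x (act h x) \<longleftrightarrow> g \<in> h +o stab x"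
    by (simp only: same_image_iff[OF assms] mem_coset_iff)
qed

lemma bij_betw_transporter:
  assumes x: "x \<in> space M"
  shows "bij_betw (transporter x) (range (\<lambda>g. act g x)) (left_cosets (stab x))"
proof (rule bij_betwI')
  show "transporter x y = transporter x z \<longleftrightarrow> y = z"
    if "y \<in> range (\<lambda>g. act g x)" "z \<in> range (\<lambda>g. act g x)" for y z
    using that unfolding transporter_def by blast
qed (auto simp: left_cosets_def transporter_act[OF x])

lemma coset_act_transporter:
  assumes x: "x \<in> space M" and y: "y \<in> range (\<lambda>g. act g x)"
  shows "transporter x (act g y) = coset_act g (transporter x y)"
proof -
  obtain h where h: "y = act h x" using y by blast
  then show ?thesis using x by (simp add: transporter_act coset_act_def coset_add flip: act_add)
qed

end

lemma (in haar_action) measurable_transporter: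
  assumes st: "standard_borel M" and x: "x \<in> space M"
    and orbit: "range (\<lambda>g. act g x) \<in> sets M" and sub: "closed_subgroup (stab x)"
  shows "transporter x \<in> restrict_space M (range (\<lambda>g. act g x)) \<rightarrow>\<^sub>M coset_borel (stab x)"
  unfolding coset_borel_def
proof (rule measurable_measure_of)
  have O: "range (\<lambda>g. act g x) \<subseteq> space M" using x by auto
  then have sp: "space (restrict_space M (range (\<lambda>g. act g x))) = range (\<lambda>g. act g x)"
    by (simp add: space_restrict_space Int_absorb2)
  show "transporter x \<in> space (restrict_space M (range (\<lambda>g. act g x))) \<rightarrow> left_cosets (stab x)"
    unfolding sp using bij_betw_transporter[OF x] by (auto simp: bij_betw_def)
  fix U assume "U \<in> {U. U \<subseteq> left_cosets (stab x) \<and> open {g. g +o stab x \<in> U}}"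
  then have U: "open {g. g +o stab x \<in> U}" by simp
  have "(\<lambda>g. act g x) ` {g. g +o stab x \<in> U} \<in> sets M"
  proof (rule orbit_image_open[OF st x orbit U])
    fix g k assume "g \<in> {g. g +o stab x \<in> U}" "k \<in> stab x"
    then show "g + k \<in> {g. g +o stab x \<in> U}"
      using coset_eq_iff[OF sub, of g "g + k"] by (simp add: add.assoc[symmetric])
  qed
  moreover have "transporter x -` U \<inter> range (\<lambda>g. act g x) = (\<lambda>g. act g x) ` {g. g +o stab x \<in> U}"
    using transporter_act[OF x] by auto
  ultimately show "transporter x -` U \<inter> space (restrict_space M (range (\<lambda>g. act g x)))
      \<in> sets (restrict_space M (range (\<lambda>g. act g x)))"
    unfolding sp using orbit O by (subst sets_restrict_space_iff) (auto simp: Int_absorb2)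
qed auto

context dissipative_action
begin

text \<open>
  The coset space receives the image of the finite measure with density \<open>f\<close>. Starting from
  a finite measure avoids having to transport a \<open>\<sigma>\<close>-finite exhaustion along \<open>\<phi>\<close>.
\<close>

theorem isomorphic_coset_space:
  assumes erg: "ergodic_G_space act M"
  shows "\<exists>K \<kappa>. compactly_fibered K \<kappa> \<and> isomorphic_G_spaces act M coset_act \<kappa>"
proof (rule conull_orbit[OF erg])
  fix x assume x: "x \<in> space M" "orbit_total x < \<infinity>" and cn: "conull M (range (\<lambda>g. act g x))"
    and inv: "G_invariant act M (range (\<lambda>g. act g x))"
  define X where "X = range (\<lambda>g. act g x)"
  note cn = cn[folded X_def] and inv = inv[folded X_def]
  define K where "K = stab x"
  define \<phi> where "\<phi> = transporter x"
  have K: "closed_subgroup K" "compact K" unfolding K_def using stab_compact[OF x] by auto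
  have Xs [measurable]: "X \<in> sets M" and XM: "X \<subseteq> space M" and Xn: "space M - X \<in> null_sets M"
    using cn inv by (auto simp: conull_def G_invariant_def)
  define D where "D = density M (\<lambda>x. ennreal (f x))"
  have sD [simp]: "sets D = sets M" "space D = space M" by (simp_all add: D_def)
  have \<phi>m: "\<phi> \<in> restrict_space M X \<rightarrow>\<^sub>M coset_borel K"
    unfolding \<phi>_def X_def K_def using measurable_transporter[OF standard_borel_M x(1)] Xs K(1)
    by (simp add: X_def K_def)
  have \<phi>D: "\<phi> \<in> restrict_space D X \<rightarrow>\<^sub>M coset_borel K"
    using \<phi>m by (subst measurable_cong_sets[OF sets_restrict_space_cong[OF sD(1)] refl])
  have \<phi>b: "bij_betw \<phi> X (left_cosets K)"
    unfolding \<phi>_def X_def K_def by (rule bij_betw_transporter[OF x(1)])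
  have \<phi>act: "\<phi> (act g y) = coset_act g (\<phi> y)" if "y \<in> X" for g y
    unfolding \<phi>_def using coset_act_transporter[OF x(1)] that by (simp add: X_def)
  define \<kappa> where "\<kappa> = distr (restrict_space D X) (coset_borel K) \<phi>"
  have s\<kappa>: "sets \<kappa> = sets (coset_borel K)" and sp\<kappa>: "space \<kappa> = left_cosets K" by (simp_all add: \<kappa>_def)
  have spR: "space (restrict_space D X) = X" "space (restrict_space M X) = X"
    using XM by (auto simp: space_restrict_space)
  have nullD: "A \<in> null_sets D \<longleftrightarrow> A \<in> null_sets M" for A
  proof -
    have "A \<in> null_sets D \<longleftrightarrow> A \<in> sets M \<and> (AE x\<in>A in M. ennreal (f x) = 0)"
      unfolding D_def by (subst null_sets_density_iff) auto
    also have "(AE x\<in>A in M. ennreal (f x) = 0) \<longleftrightarrow> (AE x in M. x \<notin> A)"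
      by (intro AE_cong) (use f_pos in \<open>auto simp: ennreal_eq_0_iff\<close>, metis leD)
    finally show ?thesis using AE_iff_null_sets[of A M] by (auto intro: AE_not_in)
  qed
  have vimage: "\<phi> -` B \<inter> X \<in> sets M" if "B \<in> sets (coset_borel K)" for B
    using measurable_sets[OF \<phi>m that] spR Xs by (simp add: sets_restrict_space_iff)
  have null\<kappa>: "B \<in> null_sets \<kappa> \<longleftrightarrow> B \<in> sets (coset_borel K) \<and> \<phi> -` B \<inter> X \<in> null_sets M" for B
    unfolding \<kappa>_def null_sets_distr_iff[OF \<phi>D] spR
    using Xs by (subst null_sets_restrict_space) (auto simp: nullD)
  have nullM: "B \<in> null_sets (distr (restrict_space M X) \<kappa> \<phi>) \<longleftrightarrow> B \<in> null_sets \<kappa>" for B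
  proof -
    have "\<phi> \<in> restrict_space M X \<rightarrow>\<^sub>M \<kappa>" using \<phi>m by (subst measurable_cong_sets[OF refl s\<kappa>])
    from null_sets_distr_iff[OF this, of B] show ?thesis
      unfolding spR null\<kappa> using Xs by (subst (asm) null_sets_restrict_space) (auto simp: s\<kappa>)
  qed
  have "finite_measure \<kappa>"
  proof (rule finite_measureI)
    have "emeasure \<kappa> (space \<kappa>) = emeasure (restrict_space D X) (\<phi> -` left_cosets K \<inter> space (restrict_space D X))"
      unfolding sp\<kappa> unfolding \<kappa>_def using sets.top[of "coset_borel K"] by (intro emeasure_distr \<phi>D) simp
    also have "\<dots> \<le> emeasure D (space D)"
      using Xs XM by (subst emeasure_restrict_space) (auto intro!: emeasure_mono simp: spR)
    also have "\<dots> = (\<integral>\<^sup>+ x. ennreal (f x) \<partial>M)"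
      unfolding D_def by (subst emeasure_density) (auto intro!: nn_integral_cong)
    also have "\<dots> = (\<integral>\<^sup>+ x. ennreal (norm (f x)) \<partial>M)"
      by (intro nn_integral_cong) (simp add: abs_of_pos[OF f_pos])
    also have "\<dots> < \<infinity>" using f_L1 by (auto simp: L1_plus_def integrable_iff_bounded)
    finally show "emeasure \<kappa> (space \<kappa>) \<noteq> \<infinity>" by simp
  qed
  then have sf: "sigma_finite_measure \<kappa>" by (simp add: finite_measure_def)
  have borel\<kappa>: "borel_G_space coset_act \<kappa>" by (rule borel_G_space_coset[OF lc K(1) s\<kappa>])
  interpret \<kappa>: borel_action coset_act \<kappa> by unfold_locales (rule borel\<kappa>)
  have nonzero: "emeasure \<kappa> (space \<kappa>) \<noteq> 0"
  proof
    assume "emeasure \<kappa> (space \<kappa>) = 0"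
    then have "space \<kappa> \<in> null_sets \<kappa>" by (simp add: null_sets_def)
    then have "\<phi> -` left_cosets K \<inter> X \<in> null_sets M" by (simp add: null\<kappa> sp\<kappa>)
    moreover have "\<phi> -` left_cosets K \<inter> X = X" using \<phi>b by (auto simp: bij_betw_def)
    ultimately have "X \<union> (space M - X) \<in> null_sets M" using Xn by (intro null_sets.Un) auto
    moreover have "X \<union> (space M - X) = space M" using XM by blast
    ultimately show False using nonsingular by (auto simp: nonsingular_G_space_def)
  qed
  have quasi: "equivalent_measures (translated coset_act \<kappa> g) \<kappa>" for g
  proof -
    have m: "coset_act (- g) \<in> \<kappa> \<rightarrow>\<^sub>M \<kappa>" by measurable
    have "B \<in> null_sets (translated coset_act \<kappa> g) \<longleftrightarrow> B \<in> null_sets \<kappa>" for B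
    proof (cases "B \<in> sets (coset_borel K)")
      case True
      have eq: "\<phi> -` (coset_act (- g) -` B \<inter> space \<kappa>) \<inter> X = act (- g) -` (\<phi> -` B \<inter> X) \<inter> space M"
      proof (rule set_eqI)
        fix y
        have "y \<in> X" if "y \<in> space M" "act (- g) y \<in> X"
          using G_invariantD[OF inv that(2), of g] that(1) by simp
        then have "y \<in> X \<longleftrightarrow> y \<in> space M \<and> act (- g) y \<in> X"
          using XM G_invariantD[OF inv] by blast
        moreover have "\<phi> y \<in> space \<kappa>" "\<phi> (act (- g) y) = coset_act (- g) (\<phi> y)" if "y \<in> X"
          using that \<phi>act \<phi>b by (auto simp: sp\<kappa> bij_betw_def)
        ultimately show "y \<in> \<phi> -` (coset_act (- g) -` B \<inter> space \<kappa>) \<inter> X \<longleftrightarrow> y \<in> act (- g) -` (\<phi> -` B \<inter> X) \<inter> space M"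
          by auto
      qed
      have "B \<in> null_sets (translated coset_act \<kappa> g) \<longleftrightarrow> coset_act (- g) -` B \<inter> space \<kappa> \<in> null_sets \<kappa>"
        unfolding translated_def null_sets_distr_iff[OF m] using True s\<kappa> by simp
      also have "\<dots> \<longleftrightarrow> act (- g) -` (\<phi> -` B \<inter> X) \<inter> space M \<in> null_sets M"
        using measurable_sets[OF m] True s\<kappa> unfolding null\<kappa> eq by simp
      also have "\<dots> \<longleftrightarrow> B \<in> null_sets \<kappa>"
        unfolding nonsingular_null_iff[OF nonsingular vimage[OF True]] null\<kappa> using True by simp
      finally show ?thesis .
    next
      case False
      then show ?thesis using s\<kappa> by (auto simp: null_sets_def translated_def)
    qed
    then show ?thesis
      by (auto simp: equivalent_measures_def absolutely_continuous_def translated_def)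
  qed
  have "nonsingular_G_space coset_act \<kappa>"
    unfolding nonsingular_G_space_def using borel\<kappa> sf nonzero quasi by blast
  then have "compactly_fibered K \<kappa>"
    using K s\<kappa> sp\<kappa> by (simp add: compactly_fibered_def coset_G_space_def)
  moreover have "isomorphic_G_spaces act M coset_act \<kappa>"
    unfolding isomorphic_G_spaces_def
  proof (intro exI conjI)
    show "G_invariant act M X" "conull M X" by fact+
    show "G_invariant coset_act \<kappa> (left_cosets K)"
      using \<kappa>.act_space by (intro \<kappa>.G_invariantI) (simp_all add: sp\<kappa>)
    show "conull \<kappa> (left_cosets K)" using sets.top[of \<kappa>] by (simp add: conull_def sp\<kappa>)
    show "\<phi> \<in> restrict_space M X \<rightarrow>\<^sub>M restrict_space \<kappa> (left_cosets K)"
    proof (rule measurable_restrict_space2)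
      show "\<phi> \<in> restrict_space M X \<rightarrow>\<^sub>M \<kappa>"
        using \<phi>m by (subst measurable_cong_sets[OF refl s\<kappa>])
      show "\<phi> \<in> space (restrict_space M X) \<rightarrow> left_cosets K"
        using \<phi>b spR by (auto simp: bij_betw_def)
    qed
    show "bij_betw \<phi> X (left_cosets K)" by (rule \<phi>b)
    show "equivalent_measures (distr (restrict_space M X) \<kappa> \<phi>) \<kappa>"
      using nullM by (auto simp: equivalent_measures_def absolutely_continuous_def)
    show "\<forall>g. AE y in M. y \<in> X \<longrightarrow> \<phi> (act g y) = coset_act g (\<phi> y)"
      using \<phi>act by (intro allI AE_I2) auto
  qed
  ultimately show ?thesis by blast
qed

end

theorem totally_dissipative_imp_coset_space:
  fixes haar :: "'g::{topological_group_add, second_countable_topology, t2_space} measure"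
  assumes lc: "locally_compact_space (euclidean :: 'g topology)" and haar: "left_haar_measure haar"
    and ns: "nonsingular_G_space act M" and erg: "ergodic_G_space act M"
    and diss: "totally_dissipative haar act M"
  shows "\<exists>K \<kappa>. compactly_fibered K \<kappa> \<and> isomorphic_G_spaces act M coset_act \<kappa>"
proof -
  obtain nab C D where nab: "RN_cocycle act M nab" and hopf: "Hopf_decomposition haar act M nab C D"
    and C0: "emeasure M C = 0"
    using diss unfolding totally_dissipative_def by metis
  interpret sigma_finite_measure M using ns by (simp add: nonsingular_G_space_def)
  obtain h where h: "h \<in> borel_measurable M" "integral\<^sup>N M h \<noteq> \<infinity>"
    "\<And>x. x \<in> space M \<Longrightarrow> 0 < h x \<and> h x < \<infinity>"
    using Ex_finite_integrable_function by metis
  define f where "f x = enn2real (h x)" for x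
  have f_h: "ennreal (f x) = h x" "f x > 0" if "x \<in> space M" for x
    using h(3)[OF that] by (auto simp: f_def enn2real_positive_iff less_top)
  have "integrable M f"
  proof (rule integrableI_bounded)
    show "f \<in> borel_measurable M" using h(1) unfolding f_def by measurable
    have "(\<integral>\<^sup>+ x. ennreal (norm (f x)) \<partial>M) = integral\<^sup>N M h"
      by (intro nn_integral_cong) (simp add: abs_of_pos[OF f_h(2)] f_h(1))
    then show "(\<integral>\<^sup>+ x. ennreal (norm (f x)) \<partial>M) < \<infinity>" using h(2) by (simp add: less_top)
  qed
  then have f: "f \<in> L1_plus M" using f_h by (simp add: L1_plus_def)
  have "C \<in> null_sets M" using C0 hopf by (auto simp: Hopf_decomposition_def)
  from AE_not_in[OF this]
  have "AE x in M. S_fun haar act nab f x < \<infinity>"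
  proof -
    have "AE x in M. (x \<in> C \<longleftrightarrow> S_fun haar act nab f x = \<infinity>) \<and> (x \<in> D \<longleftrightarrow> S_fun haar act nab f x < \<infinity>)"
      using hopf f unfolding Hopf_decomposition_def by blast
    with AE_not_in[OF \<open>C \<in> null_sets M\<close>] show ?thesis
      by eventually_elim (auto simp: less_top)
  qed
  then interpret dissipative_action act M haar nab f
    using lc haar ns nab f by unfold_locales (auto simp: nonsingular_G_space_def)
  show ?thesis by (rule isomorphic_coset_space[OF erg])
qed

section \<open>Coset spaces of compact subgroups are dissipative\<close>

lemma AE_const_iff:
  assumes "emeasure M (space M) \<noteq> 0" shows "(AE x in M. P) \<longleftrightarrow> P"
proof -
  have "ae_filter M \<noteq> bot" using assms by (simp add: ae_filter_eq_bot_iff)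
  then show ?thesis by (rule eventually_const)
qed

lemma (in borel_action) AE_act_notin_iff:
  assumes "nonsingular_G_space act M" "A \<in> sets M"
  shows "(AE x in M. act g x \<notin> A) \<longleftrightarrow> A \<in> null_sets M"
proof -
  have m: "act g -` A \<inter> space M \<in> sets M" using assms(2) by measurable
  have "(AE x in M. act g x \<notin> A) \<longleftrightarrow> (AE x in M. x \<notin> act g -` A \<inter> space M)"
    by (intro AE_cong) auto
  also have "\<dots> \<longleftrightarrow> act g -` A \<inter> space M \<in> null_sets M"
    using AE_iff_null_sets[OF m] by simp
  finally show ?thesis using nonsingular_null_iff[OF assms] by simp
qed

text \<open>
  The saturation of \<open>C\<close> is the sum \<open>C + K\<close> of two compact sets, hence compact, and in particular
  closed.
\<close>

lemma compact_coset_image: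
  fixes K :: "'g::{topological_group_add, t2_space} set"
  assumes K: "closed_subgroup K" "compact K" and C: "compact C"
  shows "compact {g. g +o K \<in> (\<lambda>g. g +o K) ` C}" "(\<lambda>g. g +o K) ` C \<in> sets (coset_borel K)"
proof -
  have "{g. g +o K \<in> (\<lambda>g. g +o K) ` C} = (\<lambda>p. fst p + snd p) ` (C \<times> K)"
  proof (intro set_eqI iffI)
    fix g assume "g \<in> {g. g +o K \<in> (\<lambda>g. g +o K) ` C}"
    then obtain c where c: "c \<in> C" "c +o K = g +o K" by auto
    then have "- c + g \<in> K" using coset_eq_iff[OF K(1)] by simp
    then show "g \<in> (\<lambda>p. fst p + snd p) ` (C \<times> K)"
      using c(1) by (intro image_eqI[of _ _ "(c, - c + g)"]) (auto simp: add.assoc[symmetric])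
  next
    fix g assume "g \<in> (\<lambda>p. fst p + snd p) ` (C \<times> K)"
    then obtain c k where "c \<in> C" "k \<in> K" "g = c + k" by auto
    then show "g \<in> {g. g +o K \<in> (\<lambda>g. g +o K) ` C}"
      using coset_eq_iff[OF K(1), of c g] by (auto simp: add.assoc[symmetric])
  qed
  moreover have "compact ((\<lambda>p. fst p + snd p) ` (C \<times> K))"
    using C K(2) by (intro compact_continuous_image compact_Times continuous_intros)
  ultimately show cp: "compact {g. g +o K \<in> (\<lambda>g. g +o K) ` C}" by simp
  have "openin (coset_topology K) (left_cosets K - (\<lambda>g. g +o K) ` C)"
  proof -
    have "{g. g +o K \<in> left_cosets K - (\<lambda>g. g +o K) ` C} = - {g. g +o K \<in> (\<lambda>g. g +o K) ` C}"
      by (auto simp: left_cosets_def)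
    then show ?thesis using compact_imp_closed[OF cp] by (simp add: openin_coset_topology open_Compl)
  qed
  then have "left_cosets K - (\<lambda>g. g +o K) ` C \<in> sets (coset_borel K)"
    by (simp add: sets_coset_borel sigma_sets.Basic)
  then have "left_cosets K - (left_cosets K - (\<lambda>g. g +o K) ` C) \<in> sets (coset_borel K)"
    using sets.compl_sets[of _ "coset_borel K"] by simp
  moreover have "left_cosets K - (left_cosets K - (\<lambda>g. g +o K) ` C) = (\<lambda>g. g +o K) ` C"
    by (auto simp: left_cosets_def)
  ultimately show "(\<lambda>g. g +o K) ` C \<in> sets (coset_borel K)" by simp
qed

text \<open>
  Uniqueness of the nonsingular measure class. Apply Fubini's theorem to the pairs \<open>(g, y)\<close> with
  \<open>coset_act g y \<in> B\<close>: the section at \<open>g\<close> is null if and only if \<open>B\<close> is, by quasi-invariance, and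
  the section at \<open>y\<close> is a right translate of the preimage of \<open>B\<close> in the group.
\<close>

theorem coset_null_iff:
  fixes haar :: "'g::{topological_group_add, second_countable_topology, t2_space} measure"
  assumes lc: "locally_compact_space (euclidean :: 'g topology)" and haar: "left_haar_measure haar"
    and \<kappa>: "coset_G_space K \<kappa>" and B: "B \<in> sets \<kappa>"
  shows "B \<in> null_sets \<kappa> \<longleftrightarrow> {g. g +o K \<in> B} \<in> null_sets haar"
proof -
  have ns: "nonsingular_G_space coset_act \<kappa>" and sp: "space \<kappa> = left_cosets K"
    and sets: "sets \<kappa> = sets (coset_borel K)"
    using \<kappa> by (auto simp: coset_G_space_def)
  interpret haar_action coset_act \<kappa> haar
    using ns lc haar by unfold_locales (simp_all add: nonsingular_G_space_def)
  interpret \<kappa>: sigma_finite_measure \<kappa> using ns by (simp add: nonsingular_G_space_def)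
  interpret pair_sigma_finite haar \<kappa> ..
  have B' [measurable]: "{g. g +o K \<in> B} \<in> sets borel"
    using measurable_sets[OF measurable_quotient[of K], of B] B sets by (simp add: vimage_def)
  have h0: "emeasure haar (space haar) \<noteq> 0" using haar by (simp add: left_haar_measure_def)
  have \<kappa>0: "emeasure \<kappa> (space \<kappa>) \<noteq> 0" using ns by (simp add: nonsingular_G_space_def)
  have "B \<in> null_sets \<kappa> \<longleftrightarrow> (AE g in haar. AE y in \<kappa>. coset_act g y \<notin> B)"
    unfolding AE_act_notin_iff[OF ns B] AE_const_iff[OF h0] ..
  also have "\<dots> \<longleftrightarrow> (AE y in \<kappa>. AE g in haar. coset_act g y \<notin> B)"
  proof (rule AE_commute)
    note B [measurable]
    show "{z \<in> space (haar \<Otimes>\<^sub>M \<kappa>). coset_act (fst z) (snd z) \<notin> B} \<in> sets (haar \<Otimes>\<^sub>M \<kappa>)"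
      by measurable
  qed
  also have "\<dots> \<longleftrightarrow> (AE y in \<kappa>. {g. g +o K \<in> B} \<in> null_sets haar)"
  proof (rule AE_cong)
    fix y assume "y \<in> space \<kappa>"
    then obtain h where h: "y = h +o K" by (auto simp: sp left_cosets_def)
    have m: "{g. g + h \<in> {g. g +o K \<in> B}} \<in> sets haar"
      using measurable_sets_borel[of "\<lambda>g. g + h" borel, OF _ B'] by (simp add: vimage_def sets_haar)
    have "(AE g in haar. coset_act g y \<notin> B) \<longleftrightarrow> (AE g in haar. g \<notin> {g. g + h \<in> {g. g +o K \<in> B}})"
      by (simp add: h coset_act_def coset_add)
    also have "\<dots> \<longleftrightarrow> {g. g + h \<in> {g. g +o K \<in> B}} \<in> null_sets haar"
      using AE_iff_null_sets[OF m] by simp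
    also have "\<dots> \<longleftrightarrow> {g. g +o K \<in> B} \<in> null_sets haar"
      by (rule left_haar_null_right_translate[OF lc haar B'])
    finally show "(AE g in haar. coset_act g y \<notin> B) \<longleftrightarrow> {g. g +o K \<in> B} \<in> null_sets haar" .
  qed
  also have "\<dots> \<longleftrightarrow> {g. g +o K \<in> B} \<in> null_sets haar"
    by (rule AE_const_iff[OF \<kappa>0])
  finally show ?thesis .
qed

locale coset_isomorphism = haar_action act M haar
  for act :: "'g::{topological_group_add, second_countable_topology, t2_space} \<Rightarrow> 'x \<Rightarrow> 'x"
    and M :: "'x measure" and haar :: "'g measure" +
  fixes K :: "'g set" and \<kappa> :: "'g set measure" and \<phi> :: "'x \<Rightarrow> 'g set" and X :: "'x set"
  assumes nonsingular: "nonsingular_G_space act M"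
    and coset_space: "coset_G_space K \<kappa>" and K_compact: "compact K"
    and X_inv: "G_invariant act M X" and X_conull: "conull M X"
    and \<phi>_measurable: "\<phi> \<in> restrict_space M X \<rightarrow>\<^sub>M \<kappa>" and \<phi>_inj: "inj_on \<phi> X"
    and \<phi>_equiv: "equivalent_measures (distr (restrict_space M X) \<kappa> \<phi>) \<kappa>"
    and \<phi>_AE_equivariant: "\<And>g. AE x in M. x \<in> X \<longrightarrow> \<phi> (act g x) = coset_act g (\<phi> x)"
begin

lemma K_subgroup: "closed_subgroup K" and space_\<kappa>: "space \<kappa> = left_cosets K"
  and sets_\<kappa>: "sets \<kappa> = sets (coset_borel K)" and nonsingular_\<kappa>: "nonsingular_G_space coset_act \<kappa>"
  using coset_space by (auto simp: coset_G_space_def)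

sublocale M: sigma_finite_measure M
  using nonsingular by (simp add: nonsingular_G_space_def)

sublocale coset: borel_action coset_act \<kappa>
  using nonsingular_\<kappa> by unfold_locales (simp add: nonsingular_G_space_def)

lemma X_sets [measurable]: "X \<in> sets M" and X_space: "X \<subseteq> space M"
  and X_null: "space M - X \<in> null_sets M"
  using X_inv X_conull by (auto simp: conull_def G_invariant_def)

lemma M_nonzero: "emeasure M (space M) \<noteq> 0"
  using nonsingular by (simp add: nonsingular_G_space_def)

lemma AE_X: "AE x in M. x \<in> X"
  using AE_not_in[OF X_null] by (rule AE_mp) (auto intro!: AE_I2)

lemma \<phi>_space: "x \<in> X \<Longrightarrow> \<phi> x \<in> left_cosets K"
  using measurable_space[OF \<phi>_measurable] X_space space_\<kappa> by (auto simp: space_restrict_space)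

lemma \<phi>_vimage: "B \<in> sets \<kappa> \<Longrightarrow> \<phi> -` B \<inter> X \<in> sets M"
  using measurable_sets[OF \<phi>_measurable, of B] X_space
  by (simp add: sets_restrict_space_iff space_restrict_space Int_absorb2)

lemma \<phi>_null_iff:
  assumes "B \<in> sets \<kappa>" shows "\<phi> -` B \<inter> X \<in> null_sets M \<longleftrightarrow> B \<in> null_sets \<kappa>"
proof -
  have "null_sets (distr (restrict_space M X) \<kappa> \<phi>) = null_sets \<kappa>"
    using \<phi>_equiv by (auto simp: equivalent_measures_def absolutely_continuous_def)
  moreover have "B \<in> null_sets (distr (restrict_space M X) \<kappa> \<phi>) \<longleftrightarrow> \<phi> -` B \<inter> X \<in> null_sets M"
    unfolding null_sets_distr_iff[OF \<phi>_measurable] using assms X_space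
    by (simp add: null_sets_restrict_space space_restrict_space Int_absorb2)
  ultimately show ?thesis by simp
qed

text \<open>
  Equivariance holds for each group element at almost every point. By Fubini's theorem it holds, at
  almost every point, for almost every group element.
\<close>

lemma generic_point_exists:
  obtains x h where "x \<in> X" "\<phi> x = h +o K" "AE g in haar. \<phi> (act g x) = (g + h) +o K"
proof -
  interpret pair_sigma_finite haar M ..
  have "standard_borel \<kappa>" using nonsingular_\<kappa> by (simp add: nonsingular_G_space_def borel_G_space_def)
  then obtain \<iota> :: "'g set \<Rightarrow> nat \<Rightarrow> real" where \<iota> [measurable]: "\<iota> \<in> borel_measurable \<kappa>" and inj: "inj_on \<iota> (space \<kappa>)"
    using standard_borel_embedding by metis
  \<comment> \<open>An arbitrary value outside \<open>X\<close> makes \<open>\<phi>\<close> measurable on the whole space.\<close>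
  define \<Phi> where "\<Phi> x = (if x \<in> X then \<phi> x else 0 +o K)" for x
  have "0 +o K \<in> space \<kappa>" by (simp add: space_\<kappa> left_cosets_def)
  then have [measurable]: "\<Phi> \<in> M \<rightarrow>\<^sub>M \<kappa>"
    unfolding \<Phi>_def using measurable_restrict_space_iff[of X M "0 +o K" \<kappa> \<phi>] \<phi>_measurable by simp
  have eq_iff: "\<iota> (\<Phi> (act g x)) = \<iota> (coset_act g (\<Phi> x)) \<longleftrightarrow> \<Phi> (act g x) = coset_act g (\<Phi> x)"
    if "x \<in> space M" for g x
    using that measurable_space[OF \<open>\<Phi> \<in> M \<rightarrow>\<^sub>M \<kappa>\<close>] inj by (auto dest: inj_onD)
  have "(AE g in haar. AE x in M. \<iota> (\<Phi> (act g x)) = \<iota> (coset_act g (\<Phi> x)))"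
  proof (rule AE_I2)
    fix g
    show "AE x in M. \<iota> (\<Phi> (act g x)) = \<iota> (coset_act g (\<Phi> x))"
      using AE_X \<phi>_AE_equivariant[of g]
    proof eventually_elim
      case (elim x)
      then show ?case using G_invariantD[OF X_inv, of x g] by (simp add: \<Phi>_def)
    qed
  qed
  moreover have "{z \<in> space (haar \<Otimes>\<^sub>M M). \<iota> (\<Phi> (act (fst z) (snd z))) = \<iota> (coset_act (fst z) (\<Phi> (snd z)))} \<in> sets (haar \<Otimes>\<^sub>M M)"
    by (intro measurable_equality_set) measurable
  ultimately have "AE x in M. AE g in haar. \<iota> (\<Phi> (act g x)) = \<iota> (coset_act g (\<Phi> x))"
    using AE_commute[of "\<lambda>g x. \<iota> (\<Phi> (act g x)) = \<iota> (coset_act g (\<Phi> x))"] by simp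
  with AE_X have "AE x in M. x \<in> X \<and> (AE g in haar. \<iota> (\<Phi> (act g x)) = \<iota> (coset_act g (\<Phi> x)))"
    by eventually_elim simp
  moreover have "ae_filter M \<noteq> bot" using M_nonzero by (simp add: ae_filter_eq_bot_iff)
  ultimately obtain x where x: "x \<in> X" "AE g in haar. \<iota> (\<Phi> (act g x)) = \<iota> (coset_act g (\<Phi> x))"
    using eventually_happens' by blast
  obtain h where h: "\<phi> x = h +o K" using \<phi>_space[OF x(1)] by (auto simp: left_cosets_def)
  have "AE g in haar. \<phi> (act g x) = (g + h) +o K"
    using x(2)
  proof eventually_elim
    case (elim g)
    then have "\<Phi> (act g x) = coset_act g (\<Phi> x)" using eq_iff x(1) X_space by blast
    then show ?case using x(1) G_invariantD[OF X_inv x(1), of g] h by (simp add: \<Phi>_def coset_act_def coset_add)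
  qed
  with x(1) h that show ?thesis by blast
qed

end

locale generic_point = coset_isomorphism act M haar K \<kappa> \<phi> X
  for act :: "'g::{topological_group_add, second_countable_topology, t2_space} \<Rightarrow> 'x \<Rightarrow> 'x"
    and M :: "'x measure" and haar :: "'g measure"
    and K :: "'g set" and \<kappa> :: "'g set measure" and \<phi> :: "'x \<Rightarrow> 'g set" and X :: "'x set" +
  fixes x :: 'x and h :: 'g
  assumes x_X: "x \<in> X" and AE_generic: "AE g in haar. \<phi> (act g x) = (g + h) +o K"
begin

lemma x_space [simp]: "x \<in> space M"
  using x_X X_space by blast

text \<open>
  The points that \<open>\<phi>\<close> sends to the cosets \<open>coset_act c (\<phi> x)\<close> with \<open>c \<in> C\<close>.
  If \<open>C\<close> consists of group elements at which the orbit of \<open>x\<close> is equivariant, these points are the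
  \<open>act c x\<close> with \<open>c \<in> C\<close>. Unlike an orbit image, a tile is visibly measurable.
\<close>

definition tile :: "'g set \<Rightarrow> 'x set" where
  "tile C = \<phi> -` ((\<lambda>c. (c + h) +o K) ` C) \<inter> X"

lemma compact_shift: "compact C \<Longrightarrow> compact ((\<lambda>c. c + h) ` (C :: 'g set))"
  by (intro compact_continuous_image continuous_intros)

lemma tile_coset_sets: assumes "compact C" shows "(\<lambda>c. (c + h) +o K) ` C \<in> sets \<kappa>"
  using compact_coset_image(2)[OF K_subgroup K_compact compact_shift[OF assms]]
  by (simp add: sets_\<kappa> image_image)

lemma tile_sets [measurable]: "compact C \<Longrightarrow> tile C \<in> sets M"
  unfolding tile_def by (intro \<phi>_vimage tile_coset_sets)

lemma generic_set:
  "\<exists>Q\<in>sets borel. - Q \<in> null_sets haar \<and> (\<forall>g\<in>Q. \<phi> (act g x) = (g + h) +o K)"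
proof -
  obtain N where N: "{g \<in> space haar. \<not> \<phi> (act g x) = (g + h) +o K} \<subseteq> N" "emeasure haar N = 0" "N \<in> sets haar"
    using AE_generic by (rule AE_E)
  show ?thesis
  proof (intro bexI[of _ "- N"] conjI ballI)
    show "- N \<in> sets borel" using N(3) by (auto simp: sets_haar)
    show "- (- N) \<in> null_sets haar" using N by auto
  qed (use N in auto)
qed

lemma tile_subset_orbit:
  assumes "\<And>g. g \<in> C \<Longrightarrow> \<phi> (act g x) = (g + h) +o K"
  shows "tile C \<subseteq> (\<lambda>g. act g x) ` C"
proof
  fix y assume "y \<in> tile C"
  then obtain c where c: "c \<in> C" "\<phi> y = (c + h) +o K" "y \<in> X" by (auto simp: tile_def)
  then have "\<phi> y = \<phi> (act c x)" using assms by simp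
  then have "y = act c x" using \<phi>_inj c(3) G_invariantD[OF X_inv x_X, of c] by (simp add: inj_on_eq_iff)
  then show "y \<in> (\<lambda>g. act g x) ` C" using c(1) by blast
qed

lemma tile_null_iff:
  assumes "compact C"
  shows "tile C \<in> null_sets M \<longleftrightarrow> {g. g +o K \<in> (\<lambda>c. (c + h) +o K) ` C} \<in> null_sets haar"
  unfolding tile_def \<phi>_null_iff[OF tile_coset_sets[OF assms]]
  by (rule coset_null_iff[OF lc haar coset_space tile_coset_sets[OF assms]])

lemma null_if_tile_null:
  assumes C: "compact C" and null: "tile C \<in> null_sets M"
  shows "C \<in> null_sets haar"
proof -
  have Cb: "C \<in> sets borel" using C by (rule borel_compact)
  have "{g. g + (- h) \<in> C} = (\<lambda>c. c + h) ` C"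
    by (auto simp: image_iff add.assoc intro!: bexI[of _ "_ - h"])
  moreover have "(\<lambda>c. c + h) ` C \<in> null_sets haar"
  proof (rule null_sets_subset)
    show "{g. g +o K \<in> (\<lambda>c. (c + h) +o K) ` C} \<in> null_sets haar"
      using null tile_null_iff[OF C] by simp
    show "(\<lambda>c. c + h) ` C \<in> sets haar" using compact_shift[OF C] by (simp add: sets_haar borel_compact)
  qed auto
  ultimately show ?thesis using left_haar_null_right_translate[OF lc haar Cb, of "- h"] by simp
qed

lemma conull_tiles:
  assumes C: "\<And>n::nat. compact (C n)" and null: "UNIV - (\<Union>n. C n) \<in> null_sets haar"
  shows "space M - (\<Union>n. tile (C n)) \<in> null_sets M"
proof -
  define D where "D = (\<Union>n. (\<lambda>c. (c + h) +o K) ` C n)"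
  have D: "D \<in> sets \<kappa>" unfolding D_def using tile_coset_sets[OF C] by auto
  then have D': "space \<kappa> - D \<in> sets \<kappa>" by auto
  have "{g. g +o K \<in> space \<kappa> - D} \<in> null_sets haar"
  proof (rule null_sets_subset)
    show "{g. g + (- h) \<in> UNIV - (\<Union>n. C n)} \<in> null_sets haar"
      using left_haar_null_right_translate[OF lc haar, of "UNIV - (\<Union>n. C n)" "- h"] null by (auto simp: sets_haar)
    show "{g. g +o K \<in> space \<kappa> - D} \<in> sets haar"
      using measurable_sets[OF measurable_quotient[of K], of "space \<kappa> - D"] D' by (simp add: vimage_def sets_haar sets_\<kappa>)
    show "{g. g +o K \<in> space \<kappa> - D} \<subseteq> {g. g + (- h) \<in> UNIV - (\<Union>n. C n)}"
    proof
      fix g assume g: "g \<in> {g. g +o K \<in> space \<kappa> - D}"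
      have "g + - h \<notin> C n" for n
      proof
        assume "g + - h \<in> C n"
        then have "(g + - h + h) +o K \<in> D" unfolding D_def by blast
        then show False using g by (simp add: add.assoc)
      qed
      then show "g \<in> {g. g + (- h) \<in> UNIV - (\<Union>n. C n)}" by blast
    qed
  qed
  then have "space \<kappa> - D \<in> null_sets \<kappa>" using coset_null_iff[OF lc haar coset_space D'] by simp
  then have n: "\<phi> -` (space \<kappa> - D) \<inter> X \<in> null_sets M" using \<phi>_null_iff[OF D'] by simp
  show ?thesis
  proof (rule null_sets_subset[OF null_sets.Un[OF X_null n]])
    show "space M - (\<Union>n. tile (C n)) \<in> sets M" using tile_sets[OF C] by auto
    show "space M - (\<Union>n. tile (C n)) \<subseteq> (space M - X) \<union> (\<phi> -` (space \<kappa> - D) \<inter> X)"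
      using \<phi>_space by (auto simp: tile_def D_def space_\<kappa>)
  qed
qed

lemma orbit_vimage_sets: "A \<in> sets M \<Longrightarrow> {g. act g x \<in> A} \<in> sets borel"
  using measurable_sets[OF measurable_act[of "\<lambda>g. g" borel "\<lambda>_. x"]] by (simp add: vimage_def)

text \<open>
  Both directions exhaust a set of group elements by compact sets and pass to the tiles over them. If
  the visiting times of \<open>A\<close> are null, then tiles over compact sets that avoid these times cover almost
  everything and are disjoint from \<open>A\<close>. If \<open>A\<close> is null, then tiles over compact sets of
  visiting times lie in \<open>A\<close>, hence are null, and so are the compact sets.
\<close>

theorem orbit_null_iff:
  assumes A: "A \<in> sets M"
  shows "{g. act g x \<in> A} \<in> null_sets haar \<longleftrightarrow> A \<in> null_sets M"
proof -
  obtain Q where Q: "Q \<in> sets borel" "- Q \<in> null_sets haar" "\<And>g. g \<in> Q \<Longrightarrow> \<phi> (act g x) = (g + h) +o K"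
    using generic_set by blast
  define A' where "A' = {g. act g x \<in> A}"
  have A': "A' \<in> sets borel" unfolding A'_def using A by (rule orbit_vimage_sets)
  have const: "(\<lambda>_. 0::real) \<in> borel_measurable borel" by simp
  note approx = sigma_compact_conull[OF lc haar.sigma_finite_measure_axioms sets_haar const]
  show ?thesis unfolding A'_def[symmetric]
  proof
    assume null: "A' \<in> null_sets haar"
    have "Q - A' \<in> sets borel" using Q(1) A' by auto
    then obtain C where C: "\<And>n::nat. compact (C n)" "\<And>n. C n \<subseteq> Q - A'" "(Q - A') - (\<Union>n. C n) \<in> null_sets haar"
      using approx by metis
    have Cs: "(\<Union>n. C n) \<in> sets borel" using borel_compact[OF C(1)] by auto
    have "UNIV - (\<Union>n. C n) \<in> null_sets haar"
    proof (rule null_sets_subset[OF null_sets.Un[OF null_sets.Un[OF Q(2) null] C(3)]])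
      show "UNIV - (\<Union>n. C n) \<in> sets haar" using Cs by (auto simp: sets_haar)
    qed auto
    then have "space M - (\<Union>n. tile (C n)) \<in> null_sets M" by (rule conull_tiles[OF C(1)])
    moreover have "A \<inter> tile (C n) = {}" for n
    proof -
      have "tile (C n) \<subseteq> (\<lambda>g. act g x) ` C n" using C(2) Q(3) by (intro tile_subset_orbit) blast
      then show ?thesis using C(2)[of n] by (auto simp: A'_def)
    qed
    then have "A \<subseteq> space M - (\<Union>n. tile (C n))" using sets.sets_into_space[OF A] by blast
    ultimately show "A \<in> null_sets M" using A null_sets_subset by blast
  next
    assume null: "A \<in> null_sets M"
    have "Q \<inter> A' \<in> sets borel" using Q(1) A' by auto
    then obtain C where C: "\<And>n::nat. compact (C n)" "\<And>n. C n \<subseteq> Q \<inter> A'" "(Q \<inter> A') - (\<Union>n. C n) \<in> null_sets haar"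
      using approx by metis
    have "C n \<in> null_sets haar" for n
    proof (rule null_if_tile_null[OF C(1)], rule null_sets_subset[OF null])
      show "tile (C n) \<in> sets M" by (rule tile_sets[OF C(1)])
      have "tile (C n) \<subseteq> (\<lambda>g. act g x) ` C n" using C(2) Q(3) by (intro tile_subset_orbit) blast
      then show "tile (C n) \<subseteq> A" using C(2)[of n] by (auto simp: A'_def)
    qed
    then have Cn: "(\<Union>n. C n) \<in> null_sets haar" by (intro null_sets_UN) auto
    show "A' \<in> null_sets haar"
    proof (rule null_sets_subset[OF null_sets.Un[OF null_sets.Un[OF Q(2) Cn] C(3)]])
      show "A' \<in> sets haar" using A' by (simp add: sets_haar)
    qed auto
  qed
qed

definition orbit_measure :: "'x measure" where
  "orbit_measure = distr haar M (\<lambda>g. act g x)"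

lemma sets_orbit_measure [simp, measurable_cong]: "sets orbit_measure = sets M"
  and space_orbit_measure [simp]: "space orbit_measure = space M"
  by (simp_all add: orbit_measure_def)

lemma orbit_map_measurable: "(\<lambda>g. act g x) \<in> haar \<rightarrow>\<^sub>M M"
  by measurable

lemma null_sets_orbit_measure: "null_sets orbit_measure = null_sets M"
proof -
  have "A \<in> null_sets orbit_measure \<longleftrightarrow> A \<in> null_sets M" for A
  proof (cases "A \<in> sets M")
    case True
    then show ?thesis unfolding orbit_measure_def null_sets_distr_iff[OF orbit_map_measurable]
      using orbit_null_iff[OF True] by (simp add: vimage_def)
  qed (auto simp: null_sets_def)
  then show ?thesis by blast
qed

lemma nn_integral_orbit_measure:
  "w \<in> borel_measurable M \<Longrightarrow> (\<integral>\<^sup>+ y. w y \<partial>orbit_measure) = (\<integral>\<^sup>+ g. w (act g x) \<partial>haar)"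
  unfolding orbit_measure_def by (rule nn_integral_distr[OF orbit_map_measurable]) simp

lemma orbit_measure_invariant:
  assumes [measurable]: "w \<in> borel_measurable M"
  shows "(\<integral>\<^sup>+ y. w (act a y) \<partial>orbit_measure) = (\<integral>\<^sup>+ y. w y \<partial>orbit_measure)"
proof -
  have "(\<integral>\<^sup>+ y. w (act a y) \<partial>orbit_measure) = (\<integral>\<^sup>+ g. w (act a (act g x)) \<partial>haar)"
    by (rule nn_integral_orbit_measure) measurable
  also have "\<dots> = (\<integral>\<^sup>+ g. w (act (a + g) x) \<partial>haar)" by (simp add: act_add)
  also have "\<dots> = (\<integral>\<^sup>+ g. w (act g x) \<partial>haar)"
    by (rule left_haar_nn_integral[OF haar]) measurable
  finally show ?thesis by (simp add: nn_integral_orbit_measure)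
qed

lemma tile_cover:
  obtains C where "\<And>n::nat. compact (C n)" "\<And>n. tile (C n) \<subseteq> range (\<lambda>g. act g x)"
    "space M - (\<Union>n. tile (C n)) \<in> null_sets M"
proof -
  obtain Q where Q: "Q \<in> sets borel" "- Q \<in> null_sets haar" "\<And>g. g \<in> Q \<Longrightarrow> \<phi> (act g x) = (g + h) +o K"
    using generic_set by blast
  have "(\<lambda>_. 0::real) \<in> borel_measurable borel" by simp
  then obtain C where C: "\<And>n::nat. compact (C n)" "\<And>n. C n \<subseteq> Q" "Q - (\<Union>n. C n) \<in> null_sets haar"
    using sigma_compact_conull[OF lc haar.sigma_finite_measure_axioms sets_haar _ Q(1)] by metis
  have Cs: "(\<Union>n. C n) \<in> sets borel" using borel_compact[OF C(1)] by auto
  have "UNIV - (\<Union>n. C n) \<in> null_sets haar"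
  proof (rule null_sets_subset[OF null_sets.Un[OF Q(2) C(3)]])
    show "UNIV - (\<Union>n. C n) \<in> sets haar" using Cs by (auto simp: sets_haar)
  qed auto
  then have "space M - (\<Union>n. tile (C n)) \<in> null_sets M" by (rule conull_tiles[OF C(1)])
  moreover have "tile (C n) \<subseteq> range (\<lambda>g. act g x)" for n
  proof -
    have "tile (C n) \<subseteq> (\<lambda>g. act g x) ` C n" using C(2) Q(3) by (intro tile_subset_orbit) blast
    then show ?thesis by blast
  qed
  ultimately show ?thesis using C(1) by (intro that[of C]) auto
qed

text \<open>
  Compactness of \<open>K\<close> is decisive here: the visiting times of a tile over a compact set form,
  up to a null set, a compact set.
\<close>

lemma orbit_measure_tile_finite:
  assumes C: "compact C"
  shows "emeasure orbit_measure (tile C) < \<infinity>"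
proof -
  define S where "S = {g. g +o K \<in> (\<lambda>c. (c + h) +o K) ` C}"
  have "compact S" unfolding S_def
    using compact_coset_image(1)[OF K_subgroup K_compact compact_shift[OF C]] by (simp add: image_image)
  then have S: "compact {g. g + h \<in> S}" by (rule compact_right_translate)
  have "emeasure orbit_measure (tile C) = emeasure haar ((\<lambda>g. act g x) -` tile C \<inter> space haar)"
    unfolding orbit_measure_def by (intro emeasure_distr orbit_map_measurable tile_sets C)
  also have "\<dots> = emeasure haar {g. act g x \<in> tile C}" by (simp add: vimage_def)
  also have "\<dots> \<le> emeasure haar {g. g + h \<in> S}"
  proof (rule emeasure_mono_AE)
    show "AE g in haar. g \<in> {g. act g x \<in> tile C} \<longrightarrow> g \<in> {g. g + h \<in> S}"
      using AE_generic by eventually_elim (simp add: tile_def S_def)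
    show "{g. g + h \<in> S} \<in> sets haar" using S by (simp add: sets_haar borel_compact)
  qed
  also have "\<dots> < \<infinity>" using haar S by (simp add: left_haar_measure_def)
  finally show ?thesis .
qed

lemma sigma_finite_orbit_measure: "sigma_finite_measure orbit_measure"
proof (rule tile_cover)
  fix C :: "nat \<Rightarrow> 'g set" assume C: "\<And>n. compact (C n)" "space M - (\<Union>n. tile (C n)) \<in> null_sets M"
  define R where "R = space M - (\<Union>n. tile (C n))"
  have R: "R \<in> null_sets orbit_measure" using C(2) by (simp add: R_def null_sets_orbit_measure)
  have T: "tile (C n) \<in> sets M" for n using C(1) by (rule tile_sets)
  show ?thesis
  proof
    show "\<exists>A. countable A \<and> A \<subseteq> sets orbit_measure \<and> \<Union> A = space orbit_measure \<and> (\<forall>a\<in>A. emeasure orbit_measure a \<noteq> \<infinity>)"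
    proof (intro exI conjI)
      show "countable (insert R (range (\<lambda>n. tile (C n))))" by simp
      show "insert R (range (\<lambda>n. tile (C n))) \<subseteq> sets orbit_measure" using R T by auto
      show "\<Union> (insert R (range (\<lambda>n. tile (C n)))) = space orbit_measure"
        using sets.sets_into_space[OF T] by (auto simp: R_def)
      show "\<forall>a\<in>insert R (range (\<lambda>n. tile (C n))). emeasure orbit_measure a \<noteq> \<infinity>"
        using R orbit_measure_tile_finite[OF C(1)] by (auto simp: less_top)
    qed
  qed
qed

text \<open>
  The density is positive and finite almost everywhere. Replacing it by \<open>1\<close> on the exceptional
  null set makes quotients of its values a cocycle everywhere.
\<close>

lemma positive_density_exists:
  obtains F :: "'x \<Rightarrow> real" where "F \<in> borel_measurable M" "\<And>y. F y > 0"
    "M = density orbit_measure (\<lambda>y. ennreal (F y))"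
proof -
  interpret O: sigma_finite_measure orbit_measure by (rule sigma_finite_orbit_measure)
  have ac: "absolutely_continuous orbit_measure M"
    by (simp add: absolutely_continuous_def null_sets_orbit_measure)
  define F0 where "F0 = RN_deriv orbit_measure M"
  have F0 [measurable]: "F0 \<in> borel_measurable M"
    using borel_measurable_RN_deriv[of orbit_measure M] by (simp add: F0_def)
  have dens: "density orbit_measure F0 = M"
    unfolding F0_def using O.density_RN_deriv[OF ac] by simp
  have fin: "AE y in orbit_measure. F0 y \<noteq> \<infinity>"
    unfolding F0_def using O.RN_deriv_finite[OF M.sigma_finite_measure_axioms ac] by simp
  define Z where "Z = {y \<in> space M. F0 y = 0}"
  have Z: "Z \<in> sets M" unfolding Z_def by measurable
  have "emeasure M Z = emeasure (density orbit_measure F0) Z" by (simp add: dens)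
  also have "\<dots> = (\<integral>\<^sup>+ y. F0 y * indicator Z y \<partial>orbit_measure)"
    using Z by (intro emeasure_density) simp_all
  also have "\<dots> = (\<integral>\<^sup>+ y. 0 \<partial>orbit_measure)"
    by (intro nn_integral_cong) (auto simp: Z_def split: split_indicator)
  finally have "Z \<in> null_sets orbit_measure" using Z null_sets_orbit_measure by (simp add: null_sets_def)
  then have pos: "AE y in orbit_measure. F0 y \<noteq> 0"
    by (rule AE_I') (auto simp: Z_def)
  define F where "F y = (if 0 < F0 y \<and> F0 y < \<infinity> then enn2real (F0 y) else 1)" for y
  have "F \<in> borel_measurable M" unfolding F_def by measurable
  moreover have "F y > 0" for y by (simp add: F_def enn2real_positive_iff)
  moreover have "M = density orbit_measure (\<lambda>y. ennreal (F y))"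
  proof -
    have "AE y in orbit_measure. F0 y = ennreal (F y)"
      using fin pos
    proof eventually_elim
      case (elim y)
      then show ?case by (simp add: F_def zero_less_iff_neq_zero less_top)
    qed
    then have "density orbit_measure F0 = density orbit_measure (\<lambda>y. ennreal (F y))"
      using \<open>F \<in> borel_measurable M\<close> by (intro density_cong) simp_all
    then show ?thesis by (simp add: dens)
  qed
  ultimately show ?thesis using that by blast
qed

text \<open>
  Since \<open>orbit_measure\<close> is invariant, the cocycle of \<open>M\<close> is the coboundary of its density \<open>F\<close>. The
  orbital sum of \<open>f\<close> at a point \<open>act a x\<close> is the integral of \<open>F * f\<close> along the orbit of \<open>x\<close>, that is, the
  integral of \<open>f\<close> with respect to \<open>M\<close>, times the modular constant of \<open>a\<close> and \<open>1 / F (act a x)\<close>. The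
  conservative part can therefore be taken to be empty.
\<close>

theorem totally_dissipative_if_coset: "totally_dissipative haar act M"
proof (rule positive_density_exists)
  fix F :: "'x \<Rightarrow> real"
  assume F [measurable]: "F \<in> borel_measurable M" and F_pos: "\<And>y. F y > 0"
    and M_eq: "M = density orbit_measure (\<lambda>y. ennreal (F y))"
  have int_M: "(\<integral>\<^sup>+ y. w y \<partial>M) = (\<integral>\<^sup>+ y. ennreal (F y) * w y \<partial>orbit_measure)"
    if [measurable]: "w \<in> borel_measurable M" for w
  proof -
    have "(\<integral>\<^sup>+ y. w y \<partial>M) = (\<integral>\<^sup>+ y. w y \<partial>density orbit_measure (\<lambda>y. ennreal (F y)))"
      using M_eq by simp
    also have "\<dots> = (\<integral>\<^sup>+ y. ennreal (F y) * w y \<partial>orbit_measure)"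
      by (intro nn_integral_density) simp_all
    finally show ?thesis .
  qed
  define nab where "nab g y = F (act g y) / F y" for g y
  have nab [measurable]: "nab g \<in> borel_measurable M" for g unfolding nab_def by measurable
  have cocycle: "RN_cocycle act M nab"
    unfolding RN_cocycle_def
  proof (intro conjI allI ballI)
    show "(\<lambda>(g, y). nab g y) \<in> borel_measurable (borel \<Otimes>\<^sub>M M)"
      unfolding nab_def by measurable
    show "nab g y > 0" for g y using F_pos by (simp add: nab_def)
    show "nab 0 y = 1" if "y \<in> space M" for y using F_pos[of y] that by (simp add: nab_def)
    show "nab (g + h) y = nab g (act h y) * nab h y" if "y \<in> space M" for g h y
      using F_pos[of "act h y"] that by (simp add: nab_def act_add)
    fix g
    have "density M (\<lambda>y. ennreal (nab g y)) = translated act M g"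
    proof (rule measure_eqI)
      show "sets (density M (\<lambda>y. ennreal (nab g y))) = sets (translated act M g)" by (simp add: translated_def)
      fix A assume "A \<in> sets (density M (\<lambda>y. ennreal (nab g y)))"
      then have A [measurable]: "A \<in> sets M" by simp
      have "emeasure (density M (\<lambda>y. ennreal (nab g y))) A = (\<integral>\<^sup>+ y. ennreal (nab g y) * indicator A y \<partial>M)"
        by (intro emeasure_density) simp_all
      also have "\<dots> = (\<integral>\<^sup>+ y. ennreal (F y) * (ennreal (nab g y) * indicator A y) \<partial>orbit_measure)"
        by (intro int_M) measurable
      also have "\<dots> = (\<integral>\<^sup>+ y. ennreal (F (act g y)) * indicator A (act (- g) (act g y)) \<partial>orbit_measure)"
      proof (intro nn_integral_cong)
        fix y assume "y \<in> space orbit_measure"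
        moreover have "ennreal (F y) * ennreal (nab g y) = ennreal (F (act g y))"
          using F_pos[of y] F_pos[of "act g y"] by (simp add: nab_def flip: ennreal_mult)
        ultimately show "ennreal (F y) * (ennreal (nab g y) * indicator A y)
            = ennreal (F (act g y)) * indicator A (act (- g) (act g y))"
          by (simp add: mult.assoc[symmetric])
      qed
      also have "\<dots> = (\<integral>\<^sup>+ y. ennreal (F y) * indicator A (act (- g) y) \<partial>orbit_measure)"
        by (rule orbit_measure_invariant[of "\<lambda>y. ennreal (F y) * indicator A (act (- g) y)"]) measurable
      also have "\<dots> = (\<integral>\<^sup>+ y. indicator A (act (- g) y) \<partial>M)"
        by (rule int_M[symmetric]) measurable
      also have "\<dots> = (\<integral>\<^sup>+ y. indicator A y \<partial>translated act M g)"
        unfolding translated_def by (rule nn_integral_distr[symmetric]) simp_all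
      also have "\<dots> = emeasure (translated act M g) A"
        by (rule nn_integral_indicator) (simp add: translated_def)
      finally show "emeasure (density M (\<lambda>y. ennreal (nab g y))) A = emeasure (translated act M g) A" .
    qed
    then show "AE y in M. ennreal (nab g y) = RN_deriv M (translated act M g) y"
      by (intro M.RN_deriv_unique) simp_all
  qed
  have orbit: "AE y in M. y \<in> range (\<lambda>g. act g x)"
  proof (rule tile_cover)
    fix C :: "nat \<Rightarrow> 'g set"
    assume C: "\<And>n. tile (C n) \<subseteq> range (\<lambda>g. act g x)" "space M - (\<Union>n. tile (C n)) \<in> null_sets M"
    show ?thesis by (rule AE_I'[OF C(2)]) (use C(1) in blast)
  qed
  have finite_sum: "AE y in M. S_fun haar act nab f y < \<infinity>" if "f \<in> L1_plus M" for f
  proof -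
    have f [measurable]: "f \<in> borel_measurable M" and f_pos: "\<And>y. y \<in> space M \<Longrightarrow> f y > 0"
      and f_int: "integrable M f" using that by (auto simp: L1_plus_def)
    define I where "I = (\<integral>\<^sup>+ g. ennreal (F (act g x) * f (act g x)) \<partial>haar)"
    have "I = (\<integral>\<^sup>+ y. ennreal (F y * f y) \<partial>orbit_measure)"
      unfolding I_def by (intro nn_integral_orbit_measure[symmetric]) measurable
    also have "\<dots> = (\<integral>\<^sup>+ y. ennreal (F y) * ennreal (norm (f y)) \<partial>orbit_measure)"
    proof (intro nn_integral_cong)
      fix y assume "y \<in> space orbit_measure"
      then show "ennreal (F y * f y) = ennreal (F y) * ennreal (norm (f y))"
        using F_pos[of y] f_pos[of y] by (simp add: ennreal_mult)
    qed
    also have "\<dots> = (\<integral>\<^sup>+ y. ennreal (norm (f y)) \<partial>M)"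
      by (intro int_M[symmetric]) measurable
    also have "\<dots> < \<infinity>" using f_int by (simp add: integrable_iff_bounded)
    finally have I: "I < \<infinity>" .
    from orbit show ?thesis
    proof eventually_elim
      case (elim y)
      then obtain a where y: "y = act a x" by blast
      obtain c where c: "c < \<infinity>" "\<And>w. w \<in> borel_measurable borel \<Longrightarrow>
          (\<integral>\<^sup>+ g. w (g + a) \<partial>haar) = c * (\<integral>\<^sup>+ g. w g \<partial>haar)"
        using left_haar_right_translate[OF lc haar, of a] by metis
      have "S_fun haar act nab f y = (\<integral>\<^sup>+ g. ennreal (1 / F y) * ennreal (F (act (g + a) x) * f (act (g + a) x)) \<partial>haar)"
        unfolding S_fun_def
      proof (intro nn_integral_cong)
        fix g
        have "nab g y * f (act g y) = 1 / F y * (F (act (g + a) x) * f (act (g + a) x))"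
          by (simp add: nab_def y act_add)
        then show "ennreal (nab g y * f (act g y)) = ennreal (1 / F y) * ennreal (F (act (g + a) x) * f (act (g + a) x))"
          using F_pos[of y] by (simp add: ennreal_mult'[symmetric])
      qed
      also have "\<dots> = ennreal (1 / F y) * (\<integral>\<^sup>+ g. ennreal (F (act (g + a) x) * f (act (g + a) x)) \<partial>haar)"
        by (intro nn_integral_cmult) measurable
      also have "\<dots> = ennreal (1 / F y) * (c * I)"
        unfolding I_def by (subst c(2)) measurable
      also have "\<dots> < \<infinity>" using c(1) I by (simp add: ennreal_mult_less_top)
      finally show ?case .
    qed
  qed
  have "Hopf_decomposition haar act M nab {} (space M)"
    unfolding Hopf_decomposition_def
  proof (intro conjI ballI)
    show "G_invariant act M {}" "G_invariant act M (space M)" by (intro G_invariantI; simp)+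
    fix f assume "f \<in> L1_plus M"
    from finite_sum[OF this] AE_space
    show "AE y in M. (y \<in> {} \<longleftrightarrow> S_fun haar act nab f y = \<infinity>) \<and> (y \<in> space M \<longleftrightarrow> S_fun haar act nab f y < \<infinity>)"
      by eventually_elim auto
  qed auto
  then show ?thesis
    using cocycle unfolding totally_dissipative_def by (intro exI[of _ nab] exI[of _ "{}"] exI[of _ "space M"]) simp
qed

end

theorem coset_space_imp_totally_dissipative:
  fixes haar :: "'g::{topological_group_add, second_countable_topology, t2_space} measure"
  assumes lc: "locally_compact_space (euclidean :: 'g topology)" and haar: "left_haar_measure haar"
    and ns: "nonsingular_G_space act M"
    and \<kappa>: "compactly_fibered K \<kappa>" and iso: "isomorphic_G_spaces act M coset_act \<kappa>"
  shows "totally_dissipative haar act M"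
proof -
  obtain X Y \<phi> where iso': "G_invariant act M X \<and> conull M X \<and> G_invariant coset_act \<kappa> Y \<and> conull \<kappa> Y \<and>
      \<phi> \<in> restrict_space M X \<rightarrow>\<^sub>M restrict_space \<kappa> Y \<and> bij_betw \<phi> X Y \<and>
      equivalent_measures (distr (restrict_space M X) \<kappa> \<phi>) \<kappa> \<and>
      (\<forall>g. AE x in M. x \<in> X \<longrightarrow> \<phi> (act g x) = coset_act g (\<phi> x))"
    using iso unfolding isomorphic_G_spaces_def by (elim exE)
  then have X: "G_invariant act M X" "conull M X"
    and \<phi>: "\<phi> \<in> restrict_space M X \<rightarrow>\<^sub>M restrict_space \<kappa> Y" "inj_on \<phi> X"
      "equivalent_measures (distr (restrict_space M X) \<kappa> \<phi>) \<kappa>"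
      "\<And>g. AE x in M. x \<in> X \<longrightarrow> \<phi> (act g x) = coset_act g (\<phi> x)"
    by (auto simp: bij_betw_def)
  have \<phi>\<kappa>: "\<phi> \<in> restrict_space M X \<rightarrow>\<^sub>M \<kappa>"
    using \<phi>(1) by (simp add: measurable_restrict_space2_iff)
  interpret coset_isomorphism act M haar K \<kappa> \<phi> X
    using ns lc haar \<kappa> X \<phi> \<phi>\<kappa>
    by unfold_locales (simp_all add: nonsingular_G_space_def compactly_fibered_def)
  show ?thesis
  proof (rule generic_point_exists)
    fix x h assume "x \<in> X" "AE g in haar. \<phi> (act g x) = (g + h) +o K"
    then interpret generic_point act M haar K \<kappa> \<phi> X x h by unfold_locales
    show ?thesis by (rule totally_dissipative_if_coset)
  qed
qed

section \<open>Characterization of totally dissipative ergodic actions\<close>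

theorem theoremF:
  fixes haar :: "'g::{topological_group_add, second_countable_topology, t2_space} measure"
    and act :: "'g \<Rightarrow> 'x \<Rightarrow> 'x"
    and M :: "'x measure"
  assumes "locally_compact_space (euclidean :: 'g topology)"
    and "left_haar_measure haar"
    and "nonsingular_G_space act M"
    and "ergodic_G_space act M"
  shows "totally_dissipative haar act M \<longleftrightarrow>
    (\<exists>K \<kappa>. compactly_fibered K \<kappa> \<and> isomorphic_G_spaces act M coset_act \<kappa>)"
proof
  assume "totally_dissipative haar act M"
  then show "\<exists>K \<kappa>. compactly_fibered K \<kappa> \<and> isomorphic_G_spaces act M coset_act \<kappa>"
    by (rule totally_dissipative_imp_coset_space[OF assms])
next
  assume "\<exists>K \<kappa>. compactly_fibered K \<kappa> \<and> isomorphic_G_spaces act M coset_act \<kappa>"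
  then obtain K \<kappa> where "compactly_fibered K \<kappa>" "isomorphic_G_spaces act M coset_act \<kappa>"
    by (elim exE conjE)
  then show "totally_dissipative haar act M"
    by (rule coset_space_imp_totally_dissipative[OF assms(1-3)])
qed

end
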